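(* Let $K$ be a field, $A$ a finite dimensional $K$-algebra, and $n$ a natural number. Let $X=X_1\oplus\cdots\oplus X_n$ and $Y=Y_1\oplus\cdots\oplus Y_n$ be finite dimensional multiplicity free tilting $A$-modules with all $X_i$ and $Y_i$ indecomposable. Then there exists a permutation $s$ of $\{1,\ldots,n\}$ such that for every $i=1,\ldots,n$, either $X_i\cong Y_{s(i)}$, or there exists a non-split short exact sequence of $A$-modules $$0\to U\to V\to W\to 0$$ with $\{U,W\}=\{X_i,Y_{s(i)}\}$.
   Context: All modules are finite dimensional left $A$-modules. A finite dimensional $A$-module $T$ is a tilting module if (α) its projective dimension is at most $1$, (β) $\operatorname{Ext}^1_A(T,T)=0$, and (γ) the number of isomorphism classes of indecomposable direct summands of $T$ equals the number of isomorphism classes of simple $A$-modules. A module is multiplicity free if its indecomposable direct summands (in a decomposition into indecomposables) are pairwise non-isomorphic. *)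

theory Defs
  imports Main "Jordan_Normal_Form.Matrix"
begin

text \<open>
  Conventions. K is a field type 'k, the algebra A is a ring type 'a with a K-scalar
  multiplication sc making it a finite dimensional K-algebra. A finite dimensional
  left A-module is represented (up to isomorphism) by its K-dimension d and a
  representation rho : 'a => 'k mat of A by d x d matrices acting on K^d.
\<close>

type_synonym ('a, 'k) amod = "nat \<times> ('a \<Rightarrow> 'k mat)"

definition fd_algebra :: "('k::field \<Rightarrow> 'a::ring_1 \<Rightarrow> 'a) \<Rightarrow> bool" where
  "fd_algebra sc \<longleftrightarrow> vector_space sc
     \<and> (\<forall>c a b. sc c (a * b) = sc c a * b \<and> sc c (a * b) = a * sc c b)
     \<and> (\<exists>B. finite B \<and> module.span sc B = UNIV)"

definition is_mod :: "('k::field \<Rightarrow> 'a::ring_1 \<Rightarrow> 'a) \<Rightarrow> ('a, 'k) amod \<Rightarrow> bool" where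
  "is_mod sc M \<longleftrightarrow>
     (\<forall>a. snd M a \<in> carrier_mat (fst M) (fst M))
   \<and> (\<forall>a b. snd M (a + b) = snd M a + snd M b)
   \<and> (\<forall>a b. snd M (a * b) = snd M a * snd M b)
   \<and> snd M 1 = 1\<^sub>m (fst M)
   \<and> (\<forall>c a. snd M (sc c a) = c \<cdot>\<^sub>m snd M a)"

definition is_hom :: "('a::ring_1, 'k::field) amod \<Rightarrow> ('a, 'k) amod \<Rightarrow> 'k mat \<Rightarrow> bool" where
  "is_hom M N f \<longleftrightarrow> f \<in> carrier_mat (fst N) (fst M) \<and> (\<forall>a. f * snd M a = snd N a * f)"

definition injective_map :: "'k::field mat \<Rightarrow> bool" where
  "injective_map f \<longleftrightarrow> (\<forall>v \<in> carrier_vec (dim_col f). f *\<^sub>v v = 0\<^sub>v (dim_row f) \<longrightarrow> v = 0\<^sub>v (dim_col f))"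

definition surjective_map :: "'k::field mat \<Rightarrow> bool" where
  "surjective_map f \<longleftrightarrow> (\<forall>w \<in> carrier_vec (dim_row f). \<exists>v \<in> carrier_vec (dim_col f). f *\<^sub>v v = w)"

definition iso :: "('a::ring_1, 'k::field) amod \<Rightarrow> ('a, 'k) amod \<Rightarrow> bool" where
  "iso M N \<longleftrightarrow> (\<exists>f g. is_hom M N f \<and> is_hom N M g \<and> g * f = 1\<^sub>m (fst M) \<and> f * g = 1\<^sub>m (fst N))"

definition dsum :: "('a, 'k::field) amod \<Rightarrow> ('a, 'k) amod \<Rightarrow> ('a, 'k) amod" where
  "dsum M N = (fst M + fst N,
     \<lambda>a. four_block_mat (snd M a) (0\<^sub>m (fst M) (fst N)) (0\<^sub>m (fst N) (fst M)) (snd N a))"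

text \<open>The direct sum X_0 + ... + X_(n-1) (indices shifted to start at 0).\<close>
fun bigsum :: "(nat \<Rightarrow> ('a, 'k::field) amod) \<Rightarrow> nat \<Rightarrow> ('a, 'k) amod" where
  "bigsum X 0 = (0, \<lambda>a. 0\<^sub>m 0 0)"
| "bigsum X (Suc n) = dsum (bigsum X n) (X n)"

definition indecomposable :: "('k::field \<Rightarrow> 'a::ring_1 \<Rightarrow> 'a) \<Rightarrow> ('a, 'k) amod \<Rightarrow> bool" where
  "indecomposable sc M \<longleftrightarrow> is_mod sc M \<and> fst M > 0 \<and>
     \<not> (\<exists>U V. is_mod sc U \<and> is_mod sc V \<and> fst U > 0 \<and> fst V > 0 \<and> iso M (dsum U V))"

definition ses :: "('a::ring_1, 'k::field) amod \<Rightarrow> ('a, 'k) amod \<Rightarrow> ('a, 'k) amod \<Rightarrow> 'k mat \<Rightarrow> 'k mat \<Rightarrow> bool" where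
  "ses U V W f g \<longleftrightarrow> is_hom U V f \<and> is_hom V W g \<and> injective_map f \<and> surjective_map g
     \<and> g * f = 0\<^sub>m (fst W) (fst U)
     \<and> (\<forall>v \<in> carrier_vec (fst V). g *\<^sub>v v = 0\<^sub>v (fst W) \<longrightarrow> (\<exists>u \<in> carrier_vec (fst U). f *\<^sub>v u = v))"

definition splits :: "('a::ring_1, 'k::field) amod \<Rightarrow> ('a, 'k) amod \<Rightarrow> 'k mat \<Rightarrow> bool" where
  "splits V W g \<longleftrightarrow> (\<exists>s. is_hom W V s \<and> g * s = 1\<^sub>m (fst W))"

definition nonsplit_ses_exists :: "('k::field \<Rightarrow> 'a::ring_1 \<Rightarrow> 'a) \<Rightarrow> ('a, 'k) amod \<Rightarrow> ('a, 'k) amod \<Rightarrow> bool" where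
  "nonsplit_ses_exists sc U W \<longleftrightarrow> (\<exists>V f g. is_mod sc V \<and> ses U V W f g \<and> \<not> splits V W g)"

text \<open>Ext^1(M,N) = 0, via Yoneda: every extension 0 -> N -> E -> M -> 0 splits.\<close>
definition ext1_zero :: "('k::field \<Rightarrow> 'a::ring_1 \<Rightarrow> 'a) \<Rightarrow> ('a, 'k) amod \<Rightarrow> ('a, 'k) amod \<Rightarrow> bool" where
  "ext1_zero sc M N \<longleftrightarrow> (\<forall>E f g. is_mod sc E \<and> ses N E M f g \<longrightarrow> splits E M g)"

definition projective :: "('k::field \<Rightarrow> 'a::ring_1 \<Rightarrow> 'a) \<Rightarrow> ('a, 'k) amod \<Rightarrow> bool" where
  "projective sc P \<longleftrightarrow> is_mod sc P \<and>
     (\<forall>V g. is_mod sc V \<and> is_hom V P g \<and> surjective_map g \<longrightarrow> splits V P g)"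

definition pd_le_1 :: "('k::field \<Rightarrow> 'a::ring_1 \<Rightarrow> 'a) \<Rightarrow> ('a, 'k) amod \<Rightarrow> bool" where
  "pd_le_1 sc T \<longleftrightarrow> (\<exists>P0 P1 f g. projective sc P0 \<and> projective sc P1 \<and> ses P1 P0 T f g)"

definition simple_mod :: "('k::field \<Rightarrow> 'a::ring_1 \<Rightarrow> 'a) \<Rightarrow> ('a, 'k) amod \<Rightarrow> bool" where
  "simple_mod sc S \<longleftrightarrow> is_mod sc S \<and> fst S > 0 \<and>
     (\<forall>U f. is_mod sc U \<and> is_hom U S f \<and> injective_map f \<and> fst U > 0 \<longrightarrow> fst U = fst S)"

definition iso_rel :: "('k::field \<Rightarrow> 'a::ring_1 \<Rightarrow> 'a) \<Rightarrow> (('a, 'k) amod \<times> ('a, 'k) amod) set" where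
  "iso_rel sc = {(M, N). is_mod sc M \<and> is_mod sc N \<and> iso M N}"

definition direct_summand :: "('k::field \<Rightarrow> 'a::ring_1 \<Rightarrow> 'a) \<Rightarrow> ('a, 'k) amod \<Rightarrow> ('a, 'k) amod \<Rightarrow> bool" where
  "direct_summand sc M T \<longleftrightarrow> (\<exists>Z. is_mod sc Z \<and> iso T (dsum M Z))"

definition num_simples :: "('k::field \<Rightarrow> 'a::ring_1 \<Rightarrow> 'a) \<Rightarrow> nat" where
  "num_simples sc = card ({S. simple_mod sc S} // iso_rel sc)"

definition num_indec_summands :: "('k::field \<Rightarrow> 'a::ring_1 \<Rightarrow> 'a) \<Rightarrow> ('a, 'k) amod \<Rightarrow> nat" where
  "num_indec_summands sc T =
     card ({M. indecomposable sc M \<and> direct_summand sc M T} // iso_rel sc)"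

definition tilting :: "('k::field \<Rightarrow> 'a::ring_1 \<Rightarrow> 'a) \<Rightarrow> ('a, 'k) amod \<Rightarrow> bool" where
  "tilting sc T \<longleftrightarrow> is_mod sc T \<and> pd_le_1 sc T \<and> ext1_zero sc T T
     \<and> num_indec_summands sc T = num_simples sc"

end

theory Submission
  imports Defs "HOL-Library.Function_Algebras" "Jordan_Normal_Form.Determinant"
begin

text \<open>
  By Hall's theorem it suffices that indecomposables $Z_1, \ldots, Z_m$ that are pairwise
  non-isomorphic, have projective dimension at most 1 and satisfy $Ext^1(Z_i, Z_j) = 0$ for all
  $i, j$ number at most the simple modules: a set $J$ violating Hall's condition would yield too
  large a family, namely the $X_i$ with $i \in J$ together with the $Y_k$ not adjacent to $J$.

  For the bound, choose projective presentations $0 \to Q_j \to P_j \to Z_j \to 0$ and put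
  $\phi_j(N) = dim\, Hom(P_j, N) - dim\, Hom(Q_j, N)$. This is additive on short exact sequences, so
  it only depends on the composition factors of $N$, and it equals $dim\, Hom(Z_j, N)$ if $N$ is
  generated by the $Z_i$. Let $f : E \to Z_i$ be a right radical approximation by a sum of the
  $Z_j$, and let $K$ be the trace of the $Z_j$ in the kernel of $f$. Then
  $\phi_j(E) - \phi_j(Z_i) - \phi_j(K)$ is the negative of the dimension of $Hom(Z_j, Z_i)$ modulo
  radical maps, which vanishes precisely if $j \neq i$. Hence the $\phi_j$ are linearly independent
  functions of the composition factors.
\<close>

subsection \<open>Linear algebra\<close>

text \<open>The kernel of f itself could not serve as K: \<open>phi_j(N)\<close> is dim Hom(Z_j, N)
  only where Ext^1(Z_j, N) vanishes, and for projective dimension at most 1 this vanishing passes to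
  quotients but in general not to submodules. The trace is a quotient of a sum of the Z_j and admits
  the same maps from each Z_j as the kernel, so nothing is lost. Working with such test modules
  avoids completing the family to a tilting module. Ext groups are never formed: the vanishing of
  Ext^1(Z_j, N) is used as the statement that every map Q_j -> N extends to P_j. The bound n on the
  number of simple modules comes from the tilting condition, because by Krull-Schmidt every
  indecomposable summand of X is isomorphic to some X_i. Independence of the phi_j concerns integer
  vectors, so the characteristic of the field does not enter.\<close>

lemma (in vector_space) dim_mono_finite:
  assumes "U \<subseteq> V" "V \<subseteq> span T" "finite T"
  shows "dim U \<le> dim V"
proof -
  obtain B where B: "B \<subseteq> V" "independent B" "V \<subseteq> span B" "card B = dim V"
    using basis_exists[of V] by blast
  \<comment> \<open>Finiteness matters: \<open>dim\<close> of an infinite dimensional space is 0,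
    the \<open>card\<close> of an infinite basis.\<close>
  have "finite B" using independent_span_bound[OF assms(3) B(2)] B(1) assms(2) by blast
  then show ?thesis using dim_le_card[of U B] B assms(1) by auto
qed

lemma (in vector_space) dim_psubset_finite:
  assumes "U \<subseteq> V" "V \<subseteq> span T" "finite T" "subspace U" "x \<in> V" "x \<notin> U"
  shows "dim U < dim V"
proof -
  obtain B where B: "B \<subseteq> U" "independent B" "U \<subseteq> span B" "card B = dim U"
    using basis_exists[of U] by blast
  have fB: "finite B" using independent_span_bound[OF assms(3) B(2)] B(1) assms(1,2) by blast
  have "x \<notin> span B" using B(1) assms(4,6) span_minimal by blast
  then have i: "independent (insert x B)" and "x \<notin> B"
    using B(2) independent_insertI span_base by blast+
  then have "Suc (dim U) = dim (insert x B)"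
    using dim_eq_card_independent[OF i] fB B(4) by simp
  also have "\<dots> \<le> dim V"
    by (rule dim_mono_finite[OF _ assms(2,3)]) (use B(1) assms(1,5) in auto)
  finally show ?thesis by simp
qed

text \<open>The linear map that kills B and fixes C pointwise sends x to 0, as x is in the span of
  B, and to x, as x is in the span of C.\<close>

lemma (in vector_space) independent_Un_span_Int:
  assumes "independent (B \<union> C)" "B \<inter> C = {}" "x \<in> span B" "x \<in> span C"
  shows "x = 0"
proof -
  interpret p: vector_space_pair scale scale ..
  obtain g where g: "Vector_Spaces.linear scale scale g" "\<forall>x\<in>B \<union> C. g x = (if x \<in> B then 0 else x)"
    using p.linear_independent_extend[OF assms(1), of "\<lambda>x. if x \<in> B then 0 else x"] by auto
  interpret g: Vector_Spaces.linear scale scale g by fact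
  have "g x = 0" using assms(3) g.eq_0_on_span[of B x] g(2) by auto
  moreover have "g x = x"
  proof -
    have "subspace {y. g y = y}" by (auto simp: subspace_def g.add g.scale g.zero)
    moreover have "C \<subseteq> {y. g y = y}" using g(2) assms(2) by auto
    ultimately show ?thesis using assms(4) span_minimal by blast
  qed
  ultimately show ?thesis by simp
qed

text \<open>A basis B of the kernel in S extends to a basis of S, and the added vectors C are mapped
  bijectively onto a basis of the image. Finiteness is asked of S alone, since the function space to
  which this is applied is infinite dimensional.\<close>

lemma (in Vector_Spaces.linear) dim_image_plus_dim_kernel:
  assumes S: "vs1.subspace S" "S \<subseteq> vs1.span T" "finite T"
  shows "vs1.dim S = vs2.dim (f ` S) + vs1.dim {x \<in> S. f x = 0}"
proof -
  define K where "K = {x \<in> S. f x = 0}"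
  obtain B where B: "B \<subseteq> K" "vs1.independent B" "K \<subseteq> vs1.span B" "card B = vs1.dim K"
    using vs1.basis_exists[of K] by blast
  obtain B' where B': "B \<subseteq> B'" "B' \<subseteq> S" "vs1.independent B'" "S \<subseteq> vs1.span B'"
    using vs1.maximal_independent_subset_extend[of B S] B K_def by auto
  define C where "C = B' - B"
  have fin: "finite B'" using vs1.independent_span_bound[OF S(3) B'(3)] B'(2) S(2) by blast
  have card: "card B' = card B + card C"
    using fin B'(1) unfolding C_def by (metis card_Diff_subset card_mono finite_subset le_add_diff_inverse)
  have CS: "C \<subseteq> S" using B'(2) C_def by auto
  have spC: "vs1.span C \<subseteq> S" using CS S(1) vs1.span_minimal by blast
  have inj: "inj_on f (vs1.span C)"
  proof (rule inj_onI)
    fix x y assume xy: "x \<in> vs1.span C" "y \<in> vs1.span C" "f x = f y"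
    then have d: "x - y \<in> vs1.span C" "f (x - y) = 0" by (auto simp: vs1.span_diff diff)
    then have "x - y \<in> vs1.span B" using B(3) spC K_def by auto
    then have "x - y = 0"
      using vs1.independent_Un_span_Int[of B C "x - y"] d(1) B'(1,3) C_def
      by (simp add: Un_absorb1)
    then show "x = y" by simp
  qed
  have ind: "vs2.independent (f ` C)"
    by (rule independent_inj_on_image) (use inj B'(3) C_def vs1.independent_mono in auto)
  have sp: "f ` S \<subseteq> vs2.span (f ` C)"
  proof -
    have "f x \<in> vs2.span (f ` C)" if "x \<in> S" for x
    proof -
      have "x \<in> vs1.span B'" using that B'(4) by auto
      moreover have "vs1.subspace {y. f y \<in> vs2.span (f ` C)}"
        by (auto simp: vs1.subspace_def add scale zero vs2.span_add vs2.span_scale vs2.span_zero)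
      moreover have "B' \<subseteq> {y. f y \<in> vs2.span (f ` C)}"
      proof
        fix x assume x: "x \<in> B'"
        show "x \<in> {y. f y \<in> vs2.span (f ` C)}"
        proof (cases "x \<in> B")
          case True
          then show ?thesis using B(1) by (auto simp: K_def vs2.span_zero)
        next
          case False
          then have "f x \<in> f ` C" using x by (auto simp: C_def)
          then show ?thesis by (simp add: vs2.span_base)
        qed
      qed
      ultimately show ?thesis using vs1.span_minimal by blast
    qed
    then show ?thesis by blast
  qed
  have "vs2.dim (f ` S) = card (f ` C)"
    by (rule vs2.dim_unique[OF _ sp ind]) (use CS in auto)
  also have "\<dots> = card C" by (rule card_image) (use inj inj_on_subset vs1.span_superset in blast)
  finally show ?thesis using card B(4) vs1.basis_card_eq_dim[OF B'(2,4,3)] K_def by simp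
qed

section \<open>Injective and surjective matrices\<close>

lemma injective_mapI:
  assumes "f \<in> carrier_mat m n" "\<And>v. v \<in> carrier_vec n \<Longrightarrow> f *\<^sub>v v = 0\<^sub>v m \<Longrightarrow> v = 0\<^sub>v n"
  shows "injective_map f"
  using assms unfolding injective_map_def by auto

lemma injective_mapD:
  assumes "injective_map f" "f \<in> carrier_mat m n" "v \<in> carrier_vec n" "f *\<^sub>v v = 0\<^sub>v m"
  shows "v = 0\<^sub>v n"
  using assms unfolding injective_map_def by auto

lemma surjective_mapI:
  assumes "f \<in> carrier_mat m n" "\<And>w. w \<in> carrier_vec m \<Longrightarrow> \<exists>v\<in>carrier_vec n. f *\<^sub>v v = w"
  shows "surjective_map f"
  using assms unfolding surjective_map_def by auto

lemma surjective_mapD: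
  assumes "surjective_map f" "f \<in> carrier_mat m n" "w \<in> carrier_vec m"
  shows "\<exists>v\<in>carrier_vec n. f *\<^sub>v v = w"
  using assms unfolding surjective_map_def by auto

lemma mat_eq_on_vecI:
  fixes A :: "'k::field mat"
  assumes A: "A \<in> carrier_mat m n" and B: "B \<in> carrier_mat m n"
    and eq: "\<And>v. v \<in> carrier_vec n \<Longrightarrow> A *\<^sub>v v = B *\<^sub>v v"
  shows "A = B"
proof (rule eq_matI)
  fix i j assume ij: "i < dim_row B" "j < dim_col B"
  then have "A $$ (i, j) = (A *\<^sub>v unit_vec n j) $ i" using A B by auto
  also have "\<dots> = (B *\<^sub>v unit_vec n j) $ i" using eq by simp
  also have "\<dots> = B $$ (i, j)" using ij A B by auto
  finally show "A $$ (i, j) = B $$ (i, j)" .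
qed (use A B in auto)

lemma mult_mat_vec_zero [simp]:
  fixes A :: "'k::field mat"
  assumes "A \<in> carrier_mat m n"
  shows "A *\<^sub>v 0\<^sub>v n = 0\<^sub>v m"
  using assms by (intro eq_vecI) auto

lemma zero_mat_mult_vec [simp]:
  fixes v :: "'k::field vec"
  assumes "v \<in> carrier_vec n"
  shows "0\<^sub>m m n *\<^sub>v v = 0\<^sub>v m"
  using assms by (intro eq_vecI) auto

lemma injective_map_cancel_vec:
  assumes inj: "injective_map f" and f: "f \<in> carrier_mat m n"
    and v: "v \<in> carrier_vec n" "w \<in> carrier_vec n" "f *\<^sub>v v = f *\<^sub>v w"
  shows "v = w"
proof -
  have fv: "f *\<^sub>v v \<in> carrier_vec m" using f v by simp
  have "f *\<^sub>v (v - w) = f *\<^sub>v v - f *\<^sub>v w" using f v by (simp add: mult_minus_distrib_mat_vec)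
  also have "\<dots> = 0\<^sub>v m" using v(3) fv by simp
  finally have z: "v - w = 0\<^sub>v n" using injective_mapD[OF inj f] v by simp
  show ?thesis
  proof (rule eq_vecI)
    fix i assume "i < dim_vec w"
    then have i: "i < n" using v by simp
    have "(v - w) $ i = v $ i - w $ i" using i v by simp
    moreover have "(v - w) $ i = 0" unfolding z using i by simp
    ultimately show "v $ i = w $ i" by simp
  qed (use v in auto)
qed

lemma injective_map_cancel:
  assumes "injective_map f" "f \<in> carrier_mat m n" "A \<in> carrier_mat n k" "B \<in> carrier_mat n k"
    "f * A = f * B"
  shows "A = B"
proof (rule mat_eq_on_vecI[OF assms(3,4)])
  fix v :: "'a vec" assume v: "v \<in> carrier_vec k"
  have "f *\<^sub>v (A *\<^sub>v v) = f *\<^sub>v (B *\<^sub>v v)"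
    using assms v by (metis assoc_mult_mat_vec)
  then show "A *\<^sub>v v = B *\<^sub>v v"
    using injective_map_cancel_vec[OF assms(1,2)] assms v by simp
qed

lemma surjective_map_cancel:
  assumes "surjective_map f" "f \<in> carrier_mat m n" "A \<in> carrier_mat k m" "B \<in> carrier_mat k m"
    "A * f = B * f"
  shows "A = B"
proof (rule mat_eq_on_vecI[OF assms(3,4)])
  fix w :: "'a vec" assume "w \<in> carrier_vec m"
  then obtain v where v: "v \<in> carrier_vec n" "f *\<^sub>v v = w" using surjective_mapD assms by blast
  have "(A * f) *\<^sub>v v = (B * f) *\<^sub>v v" using assms by simp
  moreover have "(A * f) *\<^sub>v v = A *\<^sub>v w" "(B * f) *\<^sub>v v = B *\<^sub>v w"
    using assoc_mult_mat_vec[OF assms(3,2) v(1)] assoc_mult_mat_vec[OF assms(4,2) v(1)] v(2) by simp_all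
  ultimately show "A *\<^sub>v w = B *\<^sub>v w" by simp
qed

text \<open>The columns of C are preimages under u of the columns of B.\<close>

lemma mat_factor_through_image:
  fixes u :: "'k::field mat"
  assumes u: "u \<in> carrier_mat d r" and B: "B \<in> carrier_mat d k"
    and ex: "\<And>v. v \<in> carrier_vec k \<Longrightarrow> \<exists>x\<in>carrier_vec r. u *\<^sub>v x = B *\<^sub>v v"
  shows "\<exists>C\<in>carrier_mat r k. u * C = B"
proof -
  have "\<forall>j. \<exists>x\<in>carrier_vec r. u *\<^sub>v x = B *\<^sub>v unit_vec k j" using ex by simp
  then obtain x where x: "\<And>j. x j \<in> carrier_vec r" "\<And>j. u *\<^sub>v x j = B *\<^sub>v unit_vec k j" by metis
  define C where "C = mat r k (\<lambda>(i, j). x j $ i)"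
  have C: "C \<in> carrier_mat r k" by (simp add: C_def)
  have "u * C = B"
  proof (rule eq_matI)
    fix i j assume ij: "i < dim_row B" "j < dim_col B"
    have cC: "col C j = x j" using x(1)[of j] ij B by (intro eq_vecI) (auto simp: C_def)
    have "(u * C) $$ (i, j) = (u *\<^sub>v x j) $ i" using ij B u C by (simp add: cC)
    also have "\<dots> = B $$ (i, j)" using ij B x(2)[of j] by simp
    finally show "(u * C) $$ (i, j) = B $$ (i, j)" .
  qed (use u B C in auto)
  then show ?thesis using C by blast
qed

lemma surjective_map_right_inverse:
  assumes "surjective_map g" "g \<in> carrier_mat m n"
  obtains s where "s \<in> carrier_mat n m" "g * s = 1\<^sub>m m"
  using mat_factor_through_image[OF assms(2), of "1\<^sub>m m" m] surjective_mapD[OF assms] by auto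

lemma injective_map_dim_le:
  assumes inj: "injective_map u" and u: "u \<in> carrier_mat d r"
  shows "r \<le> d"
proof (rule ccontr)
  assume lt: "\<not> r \<le> d"
  \<comment> \<open>If d < r, zero rows pad u to a square matrix. Its row d is zero, so its
    determinant vanishes, and a vector killed by A is killed by u.\<close>
  define A where "A = mat\<^sub>r r r (\<lambda>i. if i = d then 0\<^sub>v r else if i < d then row u i else 0\<^sub>v r)"
  have A: "A \<in> carrier_mat r r" by (simp add: A_def)
  have "det A = 0" unfolding A_def by (rule det_row_0) (use lt u in auto)
  then obtain v where v: "v \<in> carrier_vec r" "v \<noteq> 0\<^sub>v r" "A *\<^sub>v v = 0\<^sub>v r"
    using det_0_iff_vec_prod_zero_field[OF A] by blast
  have "u *\<^sub>v v = 0\<^sub>v d"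
  proof (rule eq_vecI)
    fix i assume i: "i < dim_vec (0\<^sub>v d :: 'a vec)"
    then have "(u *\<^sub>v v) $ i = row u i \<bullet> v" using u by simp
    also have "\<dots> = (A *\<^sub>v v) $ i" using i lt u by (simp add: A_def)
    also have "\<dots> = 0" using i lt v(3) by simp
    finally show "(u *\<^sub>v v) $ i = 0\<^sub>v d $ i" using i by simp
  qed (use u in auto)
  then show False using injective_mapD[OF inj u v(1)] v(2) by blast
qed

lemma injective_map_square_inverse:
  assumes inj: "injective_map u" and u: "u \<in> carrier_mat d d"
  obtains t where "t \<in> carrier_mat d d" "t * u = 1\<^sub>m d" "u * t = 1\<^sub>m d"
proof -
  have "det u \<noteq> 0" using det_0_iff_vec_prod_zero_field[OF u] injective_mapD[OF inj u] by blast
  then have "u \<in> Units (ring_mat TYPE('a) d ())" by (rule det_non_zero_imp_unit[OF u])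
  then show ?thesis using that unfolding Units_def ring_mat_def by auto
qed

lemma left_inverse_injective:
  assumes "p * u = 1\<^sub>m n" "p \<in> carrier_mat n m" "u \<in> carrier_mat m n"
  shows "injective_map u"
proof (rule injective_mapI[OF assms(3)])
  fix v :: "'a vec" assume v: "v \<in> carrier_vec n" "u *\<^sub>v v = 0\<^sub>v m"
  have "(p * u) *\<^sub>v v = p *\<^sub>v (u *\<^sub>v v)"
    by (rule assoc_mult_mat_vec[OF assms(2,3) v(1)])
  then show "v = 0\<^sub>v n" using assms(1,2) v by simp
qed

lemma right_inverse_surjective:
  assumes "g * s = 1\<^sub>m m" "g \<in> carrier_mat m n" "s \<in> carrier_mat n m"
  shows "surjective_map g"
proof (rule surjective_mapI[OF assms(2)])
  fix w :: "'a vec" assume w: "w \<in> carrier_vec m"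
  have "g *\<^sub>v (s *\<^sub>v w) = (g * s) *\<^sub>v w" using assms(2,3) w by simp
  then show "\<exists>v\<in>carrier_vec n. g *\<^sub>v v = w" using assms w by (intro bexI[of _ "s *\<^sub>v w"]) auto
qed

lemma surjective_map_square_injective:
  assumes "surjective_map g" "g \<in> carrier_mat d d"
  shows "injective_map g"
proof -
  obtain s where "s \<in> carrier_mat d d" "g * s = 1\<^sub>m d"
    using surjective_map_right_inverse[OF assms] .
  then show ?thesis using mat_mult_left_right_inverse left_inverse_injective assms(2) by metis
qed

subsection \<open>Block matrices and subspaces\<close>

definition inj_fst :: "nat \<Rightarrow> nat \<Rightarrow> 'k::field mat" where
  "inj_fst m n = mat (m + n) m (\<lambda>(i, j). if i = j then 1 else 0)"

definition inj_snd :: "nat \<Rightarrow> nat \<Rightarrow> 'k::field mat" where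
  "inj_snd m n = mat (m + n) n (\<lambda>(i, j). if i = m + j then 1 else 0)"

definition proj_fst :: "nat \<Rightarrow> nat \<Rightarrow> 'k::field mat" where
  "proj_fst m n = mat m (m + n) (\<lambda>(i, j). if i = j then 1 else 0)"

definition proj_snd :: "nat \<Rightarrow> nat \<Rightarrow> 'k::field mat" where
  "proj_snd m n = mat n (m + n) (\<lambda>(i, j). if j = m + i then 1 else 0)"

lemma block_carrier [simp]:
  "inj_fst m n \<in> carrier_mat (m + n) m" "inj_snd m n \<in> carrier_mat (m + n) n"
  "proj_fst m n \<in> carrier_mat m (m + n)" "proj_snd m n \<in> carrier_mat n (m + n)"
  by (auto simp: inj_fst_def inj_snd_def proj_fst_def proj_snd_def)

lemma col_inj_fst: "j < m \<Longrightarrow> col (inj_fst m n) j = unit_vec (m + n) j"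
  and col_inj_snd: "j < n \<Longrightarrow> col (inj_snd m n) j = unit_vec (m + n) (m + j)"
  and row_proj_fst: "i < m \<Longrightarrow> row (proj_fst m n) i = unit_vec (m + n) i"
  and row_proj_snd: "i < n \<Longrightarrow> row (proj_snd m n) i = unit_vec (m + n) (m + i)"
  and row_inj_fst: "i < m + n \<Longrightarrow> row (inj_fst m n) i = (if i < m then unit_vec m i else 0\<^sub>v m)"
  and row_inj_snd: "i < m + n \<Longrightarrow> row (inj_snd m n) i = (if i < m then 0\<^sub>v n else unit_vec n (i - m))"
  and col_proj_fst: "j < m + n \<Longrightarrow> col (proj_fst m n) j = (if j < m then unit_vec m j else 0\<^sub>v m)"
  and col_proj_snd: "j < m + n \<Longrightarrow> col (proj_snd m n) j = (if j < m then 0\<^sub>v n else unit_vec n (j - m))"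
  by (auto intro!: eq_vecI simp: inj_fst_def inj_snd_def proj_fst_def proj_snd_def)

lemma block_dim [simp]:
  "dim_row (inj_fst m n) = m + n" "dim_col (inj_fst m n) = m"
  "dim_row (inj_snd m n) = m + n" "dim_col (inj_snd m n) = n"
  "dim_row (proj_fst m n) = m" "dim_col (proj_fst m n) = m + n"
  "dim_row (proj_snd m n) = n" "dim_col (proj_snd m n) = m + n"
  by (auto simp: inj_fst_def inj_snd_def proj_fst_def proj_snd_def)

text \<open>The biproduct identities. With \<open>block_intertwine\<close> they allow later
  calculations in a direct sum without opening block matrices.\<close>

lemma block_identities:
  "proj_fst m n * inj_fst m n = (1\<^sub>m m :: 'k::field mat)"
  "proj_snd m n * inj_snd m n = (1\<^sub>m n :: 'k::field mat)"
  "proj_fst m n * inj_snd m n = (0\<^sub>m m n :: 'k::field mat)"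
  "proj_snd m n * inj_fst m n = (0\<^sub>m n m :: 'k::field mat)"
  "inj_fst m n * proj_fst m n + inj_snd m n * proj_snd m n = (1\<^sub>m (m + n) :: 'k::field mat)"
  by (auto intro!: eq_matI simp: col_inj_fst col_inj_snd row_proj_fst row_proj_snd row_inj_fst
      row_inj_snd col_proj_fst col_proj_snd)

lemma block_intertwine:
  fixes A B :: "'k::field mat"
  assumes [simp]: "A \<in> carrier_mat m m" "B \<in> carrier_mat n n"
  defines "D \<equiv> four_block_mat A (0\<^sub>m m n) (0\<^sub>m n m) B"
  shows "inj_fst m n * A = D * inj_fst m n" "inj_snd m n * B = D * inj_snd m n"
    "proj_fst m n * D = A * proj_fst m n" "proj_snd m n * D = B * proj_snd m n"
proof -
  have [simp]: "dim_row A = m" "dim_col A = m" "dim_row B = n" "dim_col B = n"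
    using carrier_matD[OF assms(1)] carrier_matD[OF assms(2)] by blast+
  show "inj_fst m n * A = D * inj_fst m n" "inj_snd m n * B = D * inj_snd m n"
    "proj_fst m n * D = A * proj_fst m n" "proj_snd m n * D = B * proj_snd m n"
    unfolding D_def
    by (auto intro!: eq_matI simp: col_inj_fst col_inj_snd row_proj_fst row_proj_snd row_inj_fst
        row_inj_snd col_proj_fst col_proj_snd)
qed

text \<open>The block row (f | g), that is, the map out of a direct sum induced by f and g.\<close>

definition hcat :: "nat \<Rightarrow> nat \<Rightarrow> 'k::field mat \<Rightarrow> 'k mat \<Rightarrow> 'k mat" where
  "hcat m n f g = f * proj_fst m n + g * proj_snd m n"

lemma hcat_carrier [simp]:
  "f \<in> carrier_mat d m \<Longrightarrow> g \<in> carrier_mat d n \<Longrightarrow> hcat m n f g \<in> carrier_mat d (m + n)"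
  unfolding hcat_def by (rule add_carrier_mat[OF mult_carrier_mat[OF _ block_carrier(4)]])

lemma hcat_vec:
  fixes f g :: "'k::field mat"
  assumes "f \<in> carrier_mat d m" "g \<in> carrier_mat d n" "v \<in> carrier_vec (m + n)"
  shows "hcat m n f g *\<^sub>v v = f *\<^sub>v (proj_fst m n *\<^sub>v v) + g *\<^sub>v (proj_snd m n *\<^sub>v v)"
proof -
  have "hcat m n f g *\<^sub>v v = (f * proj_fst m n) *\<^sub>v v + (g * proj_snd m n) *\<^sub>v v"
    unfolding hcat_def
    by (rule add_mult_distrib_mat_vec[of _ d "m + n"]) (use assms mult_carrier_mat[OF assms(2)] in auto)
  then show ?thesis using assms assoc_mult_mat_vec[OF _ block_carrier(3) assms(3)]
      assoc_mult_mat_vec[OF _ block_carrier(4) assms(3)] by metis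
qed

lemma block_vec_eq:
  fixes v :: "'k::field vec"
  assumes "v \<in> carrier_vec (m + n)"
  shows "inj_fst m n *\<^sub>v (proj_fst m n *\<^sub>v v) + inj_snd m n *\<^sub>v (proj_snd m n *\<^sub>v v) = v"
proof -
  have "hcat m n (inj_fst m n) (inj_snd m n) = (1\<^sub>m (m + n) :: 'k mat)"
    unfolding hcat_def by (rule block_identities)
  then show ?thesis using hcat_vec[of "inj_fst m n" "m+n" m "inj_snd m n" n v] assms by simp
qed

lemma hcat_inj:
  fixes f g :: "'k::field mat"
  assumes f: "f \<in> carrier_mat d m" and g: "g \<in> carrier_mat d n"
  shows "hcat m n f g * inj_fst m n = f" "hcat m n f g * inj_snd m n = g"
proof -
  have a: "X * proj_fst m n \<in> carrier_mat d (m + n)" if "X \<in> carrier_mat d m" for X :: "'k mat"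
    using mult_carrier_mat[OF that block_carrier(3)] .
  have b: "X * proj_snd m n \<in> carrier_mat d (m + n)" if "X \<in> carrier_mat d n" for X :: "'k mat"
    using mult_carrier_mat[OF that block_carrier(4)] .
  show "hcat m n f g * inj_fst m n = f"
    unfolding hcat_def add_mult_distrib_mat[OF a[OF f] b[OF g] block_carrier(1)]
      assoc_mult_mat[OF f block_carrier(3) block_carrier(1)]
      assoc_mult_mat[OF g block_carrier(4) block_carrier(1)] block_identities
    using f g by simp
  show "hcat m n f g * inj_snd m n = g"
    unfolding hcat_def add_mult_distrib_mat[OF a[OF f] b[OF g] block_carrier(2)]
      assoc_mult_mat[OF f block_carrier(3) block_carrier(2)]
      assoc_mult_mat[OF g block_carrier(4) block_carrier(2)] block_identities
    using f g by simp
qed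

section \<open>Subspaces, bases and complements\<close>

definition subsp :: "nat \<Rightarrow> 'k::field vec set \<Rightarrow> bool" where
  "subsp d W \<longleftrightarrow> W \<subseteq> carrier_vec d \<and> 0\<^sub>v d \<in> W \<and> (\<forall>x\<in>W. \<forall>y\<in>W. x + y \<in> W)
     \<and> (\<forall>c. \<forall>x\<in>W. c \<cdot>\<^sub>v x \<in> W)"

lemma injective_hcatI:
  fixes u c :: "'k::field mat"
  assumes "u \<in> carrier_mat d r" "c \<in> carrier_mat d s"
    and "\<And>x y. x \<in> carrier_vec r \<Longrightarrow> y \<in> carrier_vec s \<Longrightarrow> u *\<^sub>v x + c *\<^sub>v y = 0\<^sub>v d \<Longrightarrow>
      x = 0\<^sub>v r \<and> y = 0\<^sub>v s"
  shows "injective_map (hcat r s u c)"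
proof (rule injective_mapI[OF hcat_carrier[OF assms(1,2)]])
  fix v :: "'k vec" assume v: "v \<in> carrier_vec (r + s)" "hcat r s u c *\<^sub>v v = 0\<^sub>v d"
  then have "proj_fst r s *\<^sub>v v = 0\<^sub>v r \<and> proj_snd r s *\<^sub>v v = 0\<^sub>v s"
    using assms(3)[of "proj_fst r s *\<^sub>v v" "proj_snd r s *\<^sub>v v"] hcat_vec[OF assms(1,2) v(1)]
    by (metis block_carrier(3,4) mult_mat_vec_carrier)
  then show "v = 0\<^sub>v (r + s)" using block_vec_eq[OF v(1)]
    by (metis block_carrier(1,2) mult_mat_vec_zero left_zero_vec zero_carrier_vec)
qed

text \<open>The number s of additional independent columns is at most d, so it can be chosen
  maximal; a vector of W not reached by u and c could be appended as one more column. With r = 0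
  this yields a basis of W, with W the whole space a complement of the image of u.\<close>

lemma extend_independent_columns:
  fixes u :: "'k::field mat"
  assumes u: "u \<in> carrier_mat d r" "injective_map u" and W: "subsp d W"
    and uW: "\<And>x. x \<in> carrier_vec r \<Longrightarrow> u *\<^sub>v x \<in> W"
  obtains s c where "c \<in> carrier_mat d s"
    "\<And>x y. x \<in> carrier_vec r \<Longrightarrow> y \<in> carrier_vec s \<Longrightarrow> u *\<^sub>v x + c *\<^sub>v y = 0\<^sub>v d \<Longrightarrow>
      x = 0\<^sub>v r \<and> y = 0\<^sub>v s"
    "\<And>y. y \<in> carrier_vec s \<Longrightarrow> c *\<^sub>v y \<in> W"
    "\<And>z. z \<in> W \<Longrightarrow> \<exists>x\<in>carrier_vec r. \<exists>y\<in>carrier_vec s. z = u *\<^sub>v x + c *\<^sub>v y"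
proof -
  define P where "P s \<longleftrightarrow> (\<exists>c\<in>carrier_mat d s. (\<forall>x\<in>carrier_vec r. \<forall>y\<in>carrier_vec s.
      u *\<^sub>v x + c *\<^sub>v y = 0\<^sub>v d \<longrightarrow> x = 0\<^sub>v r \<and> y = 0\<^sub>v s) \<and> (\<forall>y\<in>carrier_vec s. c *\<^sub>v y \<in> W))" for s
  have bound: "s \<le> d" if Ps: "P s" for s
  proof -
    obtain c where c: "c \<in> carrier_mat d s" "\<And>x y. x \<in> carrier_vec r \<Longrightarrow> y \<in> carrier_vec s \<Longrightarrow>
      u *\<^sub>v x + c *\<^sub>v y = 0\<^sub>v d \<Longrightarrow> x = 0\<^sub>v r \<and> y = 0\<^sub>v s" using Ps unfolding P_def by blast
    have "injective_map (hcat r s u c)" by (rule injective_hcatI[OF u(1) c])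
    then show ?thesis using injective_map_dim_le[OF _ hcat_carrier[OF u(1) c(1)]] by simp
  qed
  have "P 0" unfolding P_def
  proof (intro bexI[of _ "0\<^sub>m d 0"] conjI ballI impI)
    fix x y :: "'k vec"
    assume x: "x \<in> carrier_vec r" and y: "y \<in> carrier_vec 0"
      and z: "u *\<^sub>v x + 0\<^sub>m d 0 *\<^sub>v y = 0\<^sub>v d"
    have "u *\<^sub>v x \<in> carrier_vec d" using u(1) x by simp
    then have "u *\<^sub>v x = 0\<^sub>v d" using z y by simp
    then show "x = 0\<^sub>v r" using injective_mapD[OF u(2,1) x] by simp
    show "y = 0\<^sub>v 0" using y by auto
  next
    fix y :: "'k vec" assume "y \<in> carrier_vec 0"
    then show "0\<^sub>m d 0 *\<^sub>v y \<in> W" using W by (simp add: subsp_def)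
  qed simp
  then obtain s where s: "P s" "\<And>t. P t \<Longrightarrow> t \<le> s"
    using Nat.ex_has_greatest_nat[of P 0 d] bound by blast
  obtain c where c: "c \<in> carrier_mat d s" "\<And>x y. x \<in> carrier_vec r \<Longrightarrow> y \<in> carrier_vec s \<Longrightarrow>
      u *\<^sub>v x + c *\<^sub>v y = 0\<^sub>v d \<Longrightarrow> x = 0\<^sub>v r \<and> y = 0\<^sub>v s"
      "\<And>y. y \<in> carrier_vec s \<Longrightarrow> c *\<^sub>v y \<in> W" using s(1) unfolding P_def by blast
  have "\<exists>x\<in>carrier_vec r. \<exists>y\<in>carrier_vec s. z = u *\<^sub>v x + c *\<^sub>v y" if z: "z \<in> W" for z
  proof (rule ccontr)
    assume no: "\<not> ?thesis"
    have zd: "z \<in> carrier_vec d" using z W by (auto simp: subsp_def)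
    define w where "w = mat d 1 (\<lambda>(i, j). z $ i)"
    have w: "w \<in> carrier_mat d 1" by (simp add: w_def)
    have wy: "w *\<^sub>v y = (y $ 0) \<cdot>\<^sub>v z" if "y \<in> carrier_vec 1" for y
      using that zd by (intro eq_vecI) (auto simp: w_def scalar_prod_def)
    define c' where "c' = hcat s 1 c w"
    have c': "c' \<in> carrier_mat d (s + 1)" unfolding c'_def by (rule hcat_carrier[OF c(1) w])
    have "P (s + 1)" unfolding P_def
    proof (intro bexI[OF _ c'] conjI ballI impI)
      fix y :: "'k vec" assume y: "y \<in> carrier_vec (s + 1)"
      define y1 y2 where "y1 = proj_fst s 1 *\<^sub>v y" and "y2 = proj_snd s 1 *\<^sub>v y"
      have y1: "y1 \<in> carrier_vec s" unfolding y1_def using y by (metis block_carrier(3) mult_mat_vec_carrier)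
      have y2: "y2 \<in> carrier_vec 1" unfolding y2_def using y by (metis block_carrier(4) mult_mat_vec_carrier)
      have c'y: "c' *\<^sub>v y = c *\<^sub>v y1 + (y2 $ 0) \<cdot>\<^sub>v z"
        unfolding c'_def hcat_vec[OF c(1) w y] y1_def[symmetric] y2_def[symmetric] wy[OF y2] ..
      have c1: "c *\<^sub>v y1 \<in> carrier_vec d" using c(1) y1 by simp
      show "c' *\<^sub>v y \<in> W" unfolding c'y using c(3)[OF y1] z W by (simp add: subsp_def)
      fix x :: "'k vec" assume x: "x \<in> carrier_vec r" and e: "u *\<^sub>v x + c' *\<^sub>v y = 0\<^sub>v d"
      have ux: "u *\<^sub>v x \<in> carrier_vec d" using u(1) x by simp
      have e': "u *\<^sub>v x + (c *\<^sub>v y1 + (y2 $ 0) \<cdot>\<^sub>v z) = 0\<^sub>v d" using e c'y by simp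
      \<comment> \<open>Otherwise the relation could be solved for z, which was assumed not to be
        reached.\<close>
      have "y2 $ 0 = 0"
      proof (rule ccontr)
        assume ne: "y2 $ 0 \<noteq> 0"
        define a where "a = - inverse (y2 $ 0)"
        have "z = a \<cdot>\<^sub>v (u *\<^sub>v x) + a \<cdot>\<^sub>v (c *\<^sub>v y1)"
        proof (rule eq_vecI)
          fix i assume "i < dim_vec (a \<cdot>\<^sub>v (u *\<^sub>v x) + a \<cdot>\<^sub>v (c *\<^sub>v y1))"
          then have i: "i < d" using c(1) by simp
          have "(u *\<^sub>v x + (c *\<^sub>v y1 + (y2 $ 0) \<cdot>\<^sub>v z)) $ i = 0" using e' i by simp
          then have "(u *\<^sub>v x) $ i + ((c *\<^sub>v y1) $ i + y2 $ 0 * z $ i) = 0" using i ux c1 zd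
            by (simp del: index_mult_mat_vec)
          then have "y2 $ 0 * z $ i = - ((u *\<^sub>v x) $ i + (c *\<^sub>v y1) $ i)" by (simp add: algebra_simps eq_neg_iff_add_eq_0 del: index_mult_mat_vec)
          then have "z $ i = a * ((u *\<^sub>v x) $ i + (c *\<^sub>v y1) $ i)" using ne unfolding a_def
            by (simp add: field_simps del: index_mult_mat_vec)
          then show "z $ i = (a \<cdot>\<^sub>v (u *\<^sub>v x) + a \<cdot>\<^sub>v (c *\<^sub>v y1)) $ i"
            using i carrier_matD[OF c(1)] carrier_matD[OF u(1)]
            by (simp add: algebra_simps del: index_mult_mat_vec)
        qed (use zd c(1) in auto)
        also have "\<dots> = u *\<^sub>v (a \<cdot>\<^sub>v x) + c *\<^sub>v (a \<cdot>\<^sub>v y1)"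
          by (simp add: mult_mat_vec[OF u(1) x] mult_mat_vec[OF c(1) y1])
        finally show False using no x y1 by (metis smult_carrier_vec)
      qed
      then have y20: "y2 = 0\<^sub>v 1" using y2 by (intro eq_vecI) auto
      have "(0 :: 'k) \<cdot>\<^sub>v z = 0\<^sub>v d" using zd by (intro eq_vecI) auto
      then have "u *\<^sub>v x + c *\<^sub>v y1 = 0\<^sub>v d" using e' \<open>y2 $ 0 = 0\<close> c1 ux by simp
      then have xy: "x = 0\<^sub>v r" "y1 = 0\<^sub>v s" using c(2)[OF x y1] by auto
      show "x = 0\<^sub>v r" by fact
      show "y = 0\<^sub>v (s + 1)" using block_vec_eq[OF y] xy(2) y20
        unfolding y1_def[symmetric] y2_def[symmetric]
        by (metis block_carrier(1,2) mult_mat_vec_zero left_zero_vec zero_carrier_vec)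
    qed
    then show False using s(2) by fastforce
  qed
  then show ?thesis using that c by blast
qed

text \<open>Extending the empty matrix with d rows gives a basis of W, whose members are the columns
  of u.\<close>

lemma subspace_is_image:
  fixes W :: "'k::field vec set"
  assumes W: "subsp d W"
  obtains r u where "u \<in> carrier_mat d r" "injective_map u" "(\<lambda>x. u *\<^sub>v x) ` carrier_vec r = W"
proof -
  let ?u = "0\<^sub>m d 0 :: 'k mat"
  have inj: "injective_map ?u" by (rule injective_mapI[of _ d 0]) auto
  have im: "?u *\<^sub>v x \<in> W" if "x \<in> carrier_vec 0" for x using that W by (simp add: subsp_def)
  obtain s c where c: "c \<in> carrier_mat d s"
    "\<And>x y. x \<in> carrier_vec 0 \<Longrightarrow> y \<in> carrier_vec s \<Longrightarrow> ?u *\<^sub>v x + c *\<^sub>v y = 0\<^sub>v d \<Longrightarrow>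
      x = 0\<^sub>v 0 \<and> y = 0\<^sub>v s"
    "\<And>y. y \<in> carrier_vec s \<Longrightarrow> c *\<^sub>v y \<in> W"
    "\<And>z. z \<in> W \<Longrightarrow> \<exists>x\<in>carrier_vec 0. \<exists>y\<in>carrier_vec s. z = ?u *\<^sub>v x + c *\<^sub>v y"
    by (rule extend_independent_columns[OF _ inj W im]) auto
  have red: "?u *\<^sub>v x + c *\<^sub>v y = c *\<^sub>v y" if "x \<in> carrier_vec 0" "y \<in> carrier_vec s" for x y
    using that c(1) by (simp add: left_zero_vec[of _ d])
  have "injective_map c" using c(2)[of "0\<^sub>v 0"] red[of "0\<^sub>v 0"] by (intro injective_mapI[OF c(1)]) auto
  moreover have "(\<lambda>x. c *\<^sub>v x) ` carrier_vec s = W" using c(3,4) red by force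
  ultimately show ?thesis using that c(1) by blast
qed

text \<open>If c completes the columns of u to a basis, then h = (u | c) is invertible, and g is the
  second block of its inverse t: it reads off the c-coordinates and so vanishes exactly on the image
  of u.\<close>

lemma injective_map_complement:
  fixes u :: "'k::field mat"
  assumes u: "u \<in> carrier_mat d r" "injective_map u"
  obtains s g where "g \<in> carrier_mat s d" "surjective_map g"
    "\<And>x. x \<in> carrier_vec d \<Longrightarrow> g *\<^sub>v x = 0\<^sub>v s \<longleftrightarrow> (\<exists>y\<in>carrier_vec r. x = u *\<^sub>v y)" "r + s = d"
proof -
  have W: "subsp d (carrier_vec d :: 'k vec set)" by (auto simp: subsp_def)
  have uW: "u *\<^sub>v x \<in> carrier_vec d" if "x \<in> carrier_vec r" for x using that u by simp
  obtain s c where c: "c \<in> carrier_mat d s"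
    "\<And>x y. x \<in> carrier_vec r \<Longrightarrow> y \<in> carrier_vec s \<Longrightarrow> u *\<^sub>v x + c *\<^sub>v y = 0\<^sub>v d \<Longrightarrow>
      x = 0\<^sub>v r \<and> y = 0\<^sub>v s"
    "\<And>y. y \<in> carrier_vec s \<Longrightarrow> c *\<^sub>v y \<in> carrier_vec d"
    "\<And>z. z \<in> carrier_vec d \<Longrightarrow> \<exists>x\<in>carrier_vec r. \<exists>y\<in>carrier_vec s. z = u *\<^sub>v x + c *\<^sub>v y"
    by (rule extend_independent_columns[OF u W uW]) blast+
  define h where "h = hcat r s u c"
  have h: "h \<in> carrier_mat d (r + s)" "injective_map h"
    unfolding h_def by (rule hcat_carrier[OF u(1) c(1)]) (rule injective_hcatI[OF u(1) c(1,2)])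
  have hxy: "h *\<^sub>v (inj_fst r s *\<^sub>v x + inj_snd r s *\<^sub>v y) = u *\<^sub>v x + c *\<^sub>v y"
    if xy: "x \<in> carrier_vec r" "y \<in> carrier_vec s" for x y
  proof -
    have i: "inj_fst r s *\<^sub>v x \<in> carrier_vec (r + s)" "inj_snd r s *\<^sub>v y \<in> carrier_vec (r + s)"
      using xy mult_mat_vec_carrier[OF block_carrier(1)] mult_mat_vec_carrier[OF block_carrier(2)] by auto
    have "h *\<^sub>v (inj_fst r s *\<^sub>v x + inj_snd r s *\<^sub>v y) =
        h *\<^sub>v (inj_fst r s *\<^sub>v x) + h *\<^sub>v (inj_snd r s *\<^sub>v y)"
      by (rule mult_add_distrib_mat_vec[OF h(1) i])
    moreover have "h *\<^sub>v (inj_fst r s *\<^sub>v x) = u *\<^sub>v x" "h *\<^sub>v (inj_snd r s *\<^sub>v y) = c *\<^sub>v y"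
      using assoc_mult_mat_vec[OF h(1) block_carrier(1) xy(1)]
        assoc_mult_mat_vec[OF h(1) block_carrier(2) xy(2)] hcat_inj[OF u(1) c(1)] h_def by simp_all
    ultimately show ?thesis by simp
  qed
  have surj: "surjective_map h"
  proof (rule surjective_mapI[OF h(1)])
    fix z :: "'k vec" assume "z \<in> carrier_vec d"
    then obtain x y where xy: "x \<in> carrier_vec r" "y \<in> carrier_vec s" "z = u *\<^sub>v x + c *\<^sub>v y"
      using c(4) by blast
    moreover have "inj_fst r s *\<^sub>v x + inj_snd r s *\<^sub>v y \<in> carrier_vec (r + s)"
      by (rule add_carrier_vec[OF mult_mat_vec_carrier[OF block_carrier(1) xy(1)]
            mult_mat_vec_carrier[OF block_carrier(2) xy(2)]])
    ultimately show "\<exists>v\<in>carrier_vec (r + s). h *\<^sub>v v = z" using hxy by metis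
  qed
  obtain t where t: "t \<in> carrier_mat (r + s) d" "h * t = 1\<^sub>m d"
    using surjective_map_right_inverse[OF surj h(1)] .
  have "t * h = 1\<^sub>m (r + s)"
  proof (rule injective_map_cancel[OF h(2,1) mult_carrier_mat[OF t(1) h(1)] one_carrier_mat])
    show "h * (t * h) = h * 1\<^sub>m (r + s)"
      unfolding assoc_mult_mat[OF h(1) t(1) h(1), symmetric] t(2) using h(1) by simp
  qed
  then have d: "r + s = d" using injective_map_dim_le[OF h(2,1)]
      injective_map_dim_le[OF left_inverse_injective[OF t(2) h(1) t(1)] t(1)] by simp
  have th: "t * h = 1\<^sub>m (r + s)" by fact
  define g where "g = proj_snd r s * t"
  have g: "g \<in> carrier_mat s d" unfolding g_def using t(1) by (rule mult_carrier_mat[OF block_carrier(4)])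
  have gv: "g *\<^sub>v x = proj_snd r s *\<^sub>v (t *\<^sub>v x)" if "x \<in> carrier_vec d" for x
    unfolding g_def by (rule assoc_mult_mat_vec[OF block_carrier(4) t(1) that])
  have "g * (h * inj_snd r s) = 1\<^sub>m s"
  proof -
    have "g * (h * inj_snd r s) = proj_snd r s * (t * (h * inj_snd r s))"
      unfolding g_def by (rule assoc_mult_mat[OF block_carrier(4) t(1)]) (rule mult_carrier_mat[OF h(1) block_carrier(2)])
    also have "t * (h * inj_snd r s) = (t * h) * inj_snd r s"
      by (rule assoc_mult_mat[OF t(1) h(1) block_carrier(2), symmetric])
    finally show ?thesis unfolding th by (simp add: left_mult_one_mat[OF block_carrier(2)] block_identities)
  qed
  then have gs: "surjective_map g"
    by (rule right_inverse_surjective[OF _ g mult_carrier_mat[OF h(1) block_carrier(2)]])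
  have "g *\<^sub>v x = 0\<^sub>v s \<longleftrightarrow> (\<exists>y\<in>carrier_vec r. x = u *\<^sub>v y)" if x: "x \<in> carrier_vec d" for x
  proof
    assume z: "g *\<^sub>v x = 0\<^sub>v s"
    have tx: "t *\<^sub>v x \<in> carrier_vec (r + s)" using t(1) x by simp
    have "h *\<^sub>v (t *\<^sub>v x) = x" using assoc_mult_mat_vec[OF h(1) t(1) x] t(2) x by simp
    then have "x = u *\<^sub>v (proj_fst r s *\<^sub>v (t *\<^sub>v x)) + c *\<^sub>v (proj_snd r s *\<^sub>v (t *\<^sub>v x))"
      using hcat_vec[OF u(1) c(1) tx] h_def by simp
    also have "\<dots> = u *\<^sub>v (proj_fst r s *\<^sub>v (t *\<^sub>v x)) + 0\<^sub>v d"
      using z gv[OF x] mult_mat_vec_zero[OF c(1)] by simp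
    also have "\<dots> = u *\<^sub>v (proj_fst r s *\<^sub>v (t *\<^sub>v x))"
      using uW mult_mat_vec_carrier[OF block_carrier(3) tx] by simp
    finally show "\<exists>y\<in>carrier_vec r. x = u *\<^sub>v y" using mult_mat_vec_carrier[OF block_carrier(3) tx] by blast
  next
    assume "\<exists>y\<in>carrier_vec r. x = u *\<^sub>v y"
    then obtain y where y: "y \<in> carrier_vec r" "x = u *\<^sub>v y" by blast
    have iy: "inj_fst r s *\<^sub>v y \<in> carrier_vec (r + s)" by (rule mult_mat_vec_carrier[OF block_carrier(1) y(1)])
    have "x = h *\<^sub>v (inj_fst r s *\<^sub>v y)"
      using assoc_mult_mat_vec[OF h(1) block_carrier(1) y(1)] hcat_inj(1)[OF u(1) c(1)] h_def y(2) by simp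
    then have "t *\<^sub>v x = inj_fst r s *\<^sub>v y" using assoc_mult_mat_vec[OF t(1) h(1) iy] th iy by simp
    then have "g *\<^sub>v x = (proj_snd r s * inj_fst r s) *\<^sub>v y"
      using gv[OF x] assoc_mult_mat_vec[OF block_carrier(4) block_carrier(1) y(1)] by simp
    then show "g *\<^sub>v x = 0\<^sub>v s" using y(1) by (simp add: block_identities)
  qed
  then show ?thesis using that g gs d by blast
qed

subsection \<open>Morphisms of matrix modules\<close>

text \<open>Any linear section s of g gives C = h * s: the vector s (g x) - x lies in the kernel of
  g, hence is killed by h.\<close>

lemma mat_factor_through_surjective:
  fixes g :: "'k::field mat"
  assumes g: "g \<in> carrier_mat m n" "surjective_map g" and h: "h \<in> carrier_mat k n"
    and ker: "\<And>x. x \<in> carrier_vec n \<Longrightarrow> g *\<^sub>v x = 0\<^sub>v m \<Longrightarrow> h *\<^sub>v x = 0\<^sub>v k"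
  shows "\<exists>C\<in>carrier_mat k m. C * g = h"
proof -
  obtain s where s: "s \<in> carrier_mat n m" "g * s = 1\<^sub>m m" using surjective_map_right_inverse[OF g(2,1)] .
  have hs: "h * s \<in> carrier_mat k m" by (rule mult_carrier_mat[OF h s(1)])
  have "h * s * g = h"
  proof (rule mat_eq_on_vecI[OF mult_carrier_mat[OF hs g(1)] h])
    fix x :: "'k vec" assume x: "x \<in> carrier_vec n"
    have gx: "g *\<^sub>v x \<in> carrier_vec m" by (rule mult_mat_vec_carrier[OF g(1) x])
    have sx: "s *\<^sub>v (g *\<^sub>v x) \<in> carrier_vec n" by (rule mult_mat_vec_carrier[OF s(1) gx])
    have "g *\<^sub>v (s *\<^sub>v (g *\<^sub>v x)) = g *\<^sub>v x"
      unfolding assoc_mult_mat_vec[OF g(1) s(1) gx, symmetric] s(2) using gx by simp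
    then have "g *\<^sub>v (s *\<^sub>v (g *\<^sub>v x) - x) = 0\<^sub>v m"
      using mult_minus_distrib_mat_vec[OF g(1) sx x] gx by simp
    then have "h *\<^sub>v (s *\<^sub>v (g *\<^sub>v x) - x) = 0\<^sub>v k" using ker sx x by simp
    then have z: "h *\<^sub>v (s *\<^sub>v (g *\<^sub>v x)) - h *\<^sub>v x = 0\<^sub>v k"
      using mult_minus_distrib_mat_vec[OF h sx x] by simp
    have "h *\<^sub>v (s *\<^sub>v (g *\<^sub>v x)) = h *\<^sub>v x"
    proof (rule eq_vecI)
      fix i assume "i < dim_vec (h *\<^sub>v x)"
      then have i: "i < k" "i < dim_vec (h *\<^sub>v x)" using h by auto
      have "(h *\<^sub>v (s *\<^sub>v (g *\<^sub>v x)) - h *\<^sub>v x) $ i = (h *\<^sub>v (s *\<^sub>v (g *\<^sub>v x))) $ i - (h *\<^sub>v x) $ i"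
        by (rule index_minus_vec(1)[OF i(2)])
      then show "(h *\<^sub>v (s *\<^sub>v (g *\<^sub>v x))) $ i = (h *\<^sub>v x) $ i" unfolding z using i(1) by simp
    qed (use h in auto)
    then show "(h * s * g) *\<^sub>v x = h *\<^sub>v x"
      unfolding assoc_mult_mat_vec[OF hs g(1) x] assoc_mult_mat_vec[OF h s(1) gx] .
  qed
  then show ?thesis using hs by blast
qed

locale matrix_modules =
  fixes sc :: "'k::field \<Rightarrow> 'a::ring_1 \<Rightarrow> 'a"
begin

text \<open>Both module conditions are bundled in, so that the single fact \<open>mor M N f\<close>
  supplies all dimensions and laws that a calculation with f requires.\<close>

definition mor :: "('a, 'k) amod \<Rightarrow> ('a, 'k) amod \<Rightarrow> 'k mat \<Rightarrow> bool" where
  "mor M N f \<longleftrightarrow> is_mod sc M \<and> is_mod sc N \<and> is_hom M N f"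

lemma mod_carrier: "is_mod sc M \<Longrightarrow> snd M a \<in> carrier_mat (fst M) (fst M)"
  unfolding is_mod_def by blast

lemma mor_mod: "mor M N f \<Longrightarrow> is_mod sc M" "mor M N f \<Longrightarrow> is_mod sc N"
  and mor_hom: "mor M N f \<Longrightarrow> is_hom M N f"
  and mor_carrier: "mor M N f \<Longrightarrow> f \<in> carrier_mat (fst N) (fst M)"
  and mor_act: "mor M N f \<Longrightarrow> f * snd M a = snd N a * f"
  unfolding mor_def is_hom_def by blast+

lemma morI:
  assumes "is_mod sc M" "is_mod sc N" "f \<in> carrier_mat (fst N) (fst M)"
    "\<And>a. f * snd M a = snd N a * f"
  shows "mor M N f"
  using assms unfolding mor_def is_hom_def by blast

lemma mor_vec: "mor M N f \<Longrightarrow> x \<in> carrier_vec (fst M) \<Longrightarrow> f *\<^sub>v x \<in> carrier_vec (fst N)"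
  by (rule mult_mat_vec_carrier[OF mor_carrier])

lemma mor_act_vec:
  assumes "mor M N f" "x \<in> carrier_vec (fst M)"
  shows "f *\<^sub>v (snd M a *\<^sub>v x) = snd N a *\<^sub>v (f *\<^sub>v x)"
  using assoc_mult_mat_vec[OF mor_carrier[OF assms(1)] mod_carrier[OF mor_mod(1)[OF assms(1)]] assms(2)]
    assoc_mult_mat_vec[OF mod_carrier[OF mor_mod(2)[OF assms(1)]] mor_carrier[OF assms(1)] assms(2)]
    mor_act[OF assms(1)] by metis

lemma mor_assoc: "mor M N f \<Longrightarrow> mor N L g \<Longrightarrow> mor L K h \<Longrightarrow> h * g * f = h * (g * f)"
  by (rule assoc_mult_mat[OF mor_carrier mor_carrier mor_carrier])

lemma mor_assoc_vec: "mor M N f \<Longrightarrow> mor N L g \<Longrightarrow> x \<in> carrier_vec (fst M) \<Longrightarrow>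
    (g * f) *\<^sub>v x = g *\<^sub>v (f *\<^sub>v x)"
  by (rule assoc_mult_mat_vec[OF mor_carrier mor_carrier])

lemma mor_comp:
  assumes f: "mor M N f" and g: "mor N L g"
  shows "mor M L (g * f)"
proof (rule morI[OF mor_mod(1)[OF f] mor_mod(2)[OF g] mult_carrier_mat[OF mor_carrier[OF g] mor_carrier[OF f]]])
  fix a
  note c = mor_carrier[OF f] mor_carrier[OF g] mod_carrier[OF mor_mod(1)[OF f], of a]
    mod_carrier[OF mor_mod(2)[OF f], of a] mod_carrier[OF mor_mod(2)[OF g], of a]
  have "g * f * snd M a = g * (snd N a * f)"
    using assoc_mult_mat[OF c(2,1,3)] mor_act[OF f] by simp
  also have "\<dots> = snd L a * g * f"
    using assoc_mult_mat[OF c(2,4,1)] mor_act[OF g] by simp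
  also have "\<dots> = snd L a * (g * f)" by (rule assoc_mult_mat[OF c(5,2,1)])
  finally show "g * f * snd M a = snd L a * (g * f)" .
qed

lemma mor_id: "is_mod sc M \<Longrightarrow> mor M M (1\<^sub>m (fst M))"
  by (intro morI) (auto simp: left_mult_one_mat[OF mod_carrier] right_mult_one_mat[OF mod_carrier])

lemma mor_zero: "is_mod sc M \<Longrightarrow> is_mod sc N \<Longrightarrow> mor M N (0\<^sub>m (fst N) (fst M))"
  by (intro morI) (auto simp: left_mult_zero_mat[OF mod_carrier] right_mult_zero_mat[OF mod_carrier])

lemma mor_add:
  assumes "mor M N f" "mor M N g"
  shows "mor M N (f + g)"
proof (rule morI[OF mor_mod[OF assms(1)] add_carrier_mat[OF mor_carrier[OF assms(2)]]])
  fix a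
  note c = mor_carrier[OF assms(1)] mor_carrier[OF assms(2)] mod_carrier[OF mor_mod(1)[OF assms(1)], of a]
    mod_carrier[OF mor_mod(2)[OF assms(1)], of a]
  show "(f + g) * snd M a = snd N a * (f + g)"
    unfolding add_mult_distrib_mat[OF c(1-3)] mult_add_distrib_mat[OF c(4,1,2)]
    using assms mor_act by metis
qed

lemma mor_smult:
  assumes "mor M N f"
  shows "mor M N (c \<cdot>\<^sub>m f)"
proof (rule morI[OF mor_mod[OF assms(1)] smult_carrier_mat[OF mor_carrier[OF assms(1)]]])
  fix a
  note c = mor_carrier[OF assms(1)] mod_carrier[OF mor_mod(1)[OF assms(1)], of a]
    mod_carrier[OF mor_mod(2)[OF assms(1)], of a]
  show "c \<cdot>\<^sub>m f * snd M a = snd N a * (c \<cdot>\<^sub>m f)"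
    unfolding mult_smult_assoc_mat[OF c(1,2)] mult_smult_distrib[OF c(3,1)]
    using assms mor_act by metis
qed

lemma mor_minus:
  assumes "mor M N f" "mor M N g"
  shows "mor M N (f - g)"
proof -
  have "f - g = f + (- 1) \<cdot>\<^sub>m g"
    using mor_carrier[OF assms(1)] mor_carrier[OF assms(2)] by (intro eq_matI) auto
  then show ?thesis using mor_add[OF assms(1) mor_smult[OF assms(2), of "- 1"]] by simp
qed

lemma mor_add_comp: "mor M N f \<Longrightarrow> mor M N g \<Longrightarrow> mor N L h \<Longrightarrow> h * (f + g) = h * f + h * g"
  by (rule mult_add_distrib_mat[OF mor_carrier mor_carrier mor_carrier])

lemma mor_left_id: "mor M N f \<Longrightarrow> 1\<^sub>m (fst N) * f = f"
  by (rule left_mult_one_mat[OF mor_carrier])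

lemma mor_right_id: "mor M N f \<Longrightarrow> f * 1\<^sub>m (fst M) = f"
  by (rule right_mult_one_mat[OF mor_carrier])

lemma mor_inj_cancel:
  "injective_map u \<Longrightarrow> mor N L u \<Longrightarrow> mor M N f \<Longrightarrow> mor M N g \<Longrightarrow> u * f = u * g \<Longrightarrow> f = g"
  by (rule injective_map_cancel[OF _ mor_carrier mor_carrier mor_carrier])

lemma mor_surj_cancel:
  "surjective_map p \<Longrightarrow> mor M N p \<Longrightarrow> mor N L f \<Longrightarrow> mor N L g \<Longrightarrow> f * p = g * p \<Longrightarrow> f = g"
  by (rule surjective_map_cancel[OF _ mor_carrier mor_carrier mor_carrier])

lemma mor_inj_comp:
  assumes "injective_map u" "mor M N u" "injective_map v" "mor N L v"
  shows "injective_map (v * u)"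
proof (rule injective_mapI[OF mor_carrier[OF mor_comp[OF assms(2,4)]]])
  fix x :: "'k vec" assume x: "x \<in> carrier_vec (fst M)" "(v * u) *\<^sub>v x = 0\<^sub>v (fst L)"
  then show "x = 0\<^sub>v (fst M)"
    using mor_assoc_vec[OF assms(2,4) x(1)] injective_mapD[OF assms(3) mor_carrier[OF assms(4)] mor_vec[OF assms(2) x(1)]]
      injective_mapD[OF assms(1) mor_carrier[OF assms(2)] x(1)] by metis
qed

lemma mor_surj_comp:
  assumes "surjective_map p" "mor M N p" "surjective_map q" "mor N L q"
  shows "surjective_map (q * p)"
proof (rule surjective_mapI[OF mor_carrier[OF mor_comp[OF assms(2,4)]]])
  fix z :: "'k vec" assume "z \<in> carrier_vec (fst L)"
  then obtain y where y: "y \<in> carrier_vec (fst N)" "q *\<^sub>v y = z"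
    using surjective_mapD[OF assms(3) mor_carrier[OF assms(4)]] by blast
  then obtain x where x: "x \<in> carrier_vec (fst M)" "p *\<^sub>v x = y"
    using surjective_mapD[OF assms(1) mor_carrier[OF assms(2)]] by blast
  then show "\<exists>x\<in>carrier_vec (fst M). (q * p) *\<^sub>v x = z"
    using y mor_assoc_vec[OF assms(2,4)] by (intro bexI[of _ x]) auto
qed

text \<open>A linear factorization exists columnwise; since u can be cancelled on the left, it
  commutes with the action automatically.\<close>

lemma mor_factor_inj:
  assumes u: "mor U M u" "injective_map u" and h: "mor Z M h"
    and im: "\<And>x. x \<in> carrier_vec (fst Z) \<Longrightarrow> \<exists>y\<in>carrier_vec (fst U). u *\<^sub>v y = h *\<^sub>v x"
  obtains h' where "mor Z U h'" "u * h' = h"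
proof -
  obtain h' where h': "h' \<in> carrier_mat (fst U) (fst Z)" "u * h' = h"
    using mat_factor_through_image[OF mor_carrier[OF u(1)] mor_carrier[OF h] im] by blast
  have "mor Z U h'"
  proof (rule morI[OF mor_mod(1)[OF h] mor_mod(1)[OF u(1)] h'(1)])
    fix a
    note c = mor_carrier[OF u(1)] h'(1) mod_carrier[OF mor_mod(1)[OF h], of a]
      mod_carrier[OF mor_mod(1)[OF u(1)], of a] mod_carrier[OF mor_mod(2)[OF u(1)], of a]
    have "u * (h' * snd Z a) = h * snd Z a" using assoc_mult_mat[OF c(1-3)] h'(2) by simp
    also have "\<dots> = snd M a * (u * h')" using mor_act[OF h] h'(2) by simp
    also have "\<dots> = u * (snd U a * h')"
      using assoc_mult_mat[OF c(5,1,2)] mor_act[OF u(1)] assoc_mult_mat[OF c(1,4,2)] by metis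
    finally show "h' * snd Z a = snd U a * h'"
      using injective_map_cancel[OF u(2) c(1) mult_carrier_mat[OF c(2,3)] mult_carrier_mat[OF c(4,2)]] by simp
  qed
  then show ?thesis using that h'(2) by blast
qed

text \<open>Dual to \<open>mor_factor_inj\<close>: the linear factor commutes with the action
  because g can be cancelled on the right.\<close>

lemma mor_factor_surj:
  assumes g: "mor M V g" "surjective_map g" and h: "mor M Z h"
    and ker: "\<And>x. x \<in> carrier_vec (fst M) \<Longrightarrow> g *\<^sub>v x = 0\<^sub>v (fst V) \<Longrightarrow> h *\<^sub>v x = 0\<^sub>v (fst Z)"
  obtains h' where "mor V Z h'" "h' * g = h"
proof -
  obtain h' where h': "h' \<in> carrier_mat (fst Z) (fst V)" "h' * g = h"
    using mat_factor_through_surjective[OF mor_carrier[OF g(1)] g(2) mor_carrier[OF h] ker] by blast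
  have "mor V Z h'"
  proof (rule morI[OF mor_mod(2)[OF g(1)] mor_mod(2)[OF h] h'(1)])
    fix a
    note c = mor_carrier[OF g(1)] h'(1) mod_carrier[OF mor_mod(1)[OF h], of a]
      mod_carrier[OF mor_mod(2)[OF g(1)], of a] mod_carrier[OF mor_mod(2)[OF h], of a]
    have "h' * snd V a * g = h' * g * snd M a"
      using assoc_mult_mat[OF c(2,4,1)] assoc_mult_mat[OF c(2,1,3)] mor_act[OF g(1)] by simp
    also have "\<dots> = snd Z a * h' * g" using assoc_mult_mat[OF c(5,2,1)] h'(2) mor_act[OF h] by simp
    finally show "h' * snd V a = snd Z a * h'"
      using surjective_map_cancel[OF g(2) c(1) mult_carrier_mat[OF c(2,4)] mult_carrier_mat[OF c(5,2)]] by simp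
  qed
  then show ?thesis using that h'(2) by blast
qed

section \<open>Submodules, quotients, kernels and images\<close>

lemma submodule_exists:
  assumes M: "is_mod sc M" and W: "subsp (fst M) W"
    and inv: "\<And>a x. x \<in> W \<Longrightarrow> snd M a *\<^sub>v x \<in> W"
  obtains U u where "mor U M u" "injective_map u" "(\<lambda>x. u *\<^sub>v x) ` carrier_vec (fst U) = W"
proof -
  obtain r u where u: "u \<in> carrier_mat (fst M) r" "injective_map u" "(\<lambda>x. u *\<^sub>v x) ` carrier_vec r = W"
    using subspace_is_image[OF W] .
  note mc = mod_carrier[OF M]
  have "\<exists>B\<in>carrier_mat r r. u * B = snd M a * u" for a
  proof (rule mat_factor_through_image[OF u(1) mult_carrier_mat[OF mc u(1)]])
    fix v :: "'k vec" assume v: "v \<in> carrier_vec r"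
    then have "snd M a *\<^sub>v (u *\<^sub>v v) \<in> W" using u(3) inv by blast
    then show "\<exists>x\<in>carrier_vec r. u *\<^sub>v x = (snd M a * u) *\<^sub>v v"
      using u(3) unfolding assoc_mult_mat_vec[OF mc u(1) v] by force
  qed
  then obtain B where B: "\<And>a. B a \<in> carrier_mat r r" "\<And>a. u * B a = snd M a * u" by metis
  \<comment> \<open>B is the action of M restricted along u; each module law for B follows from that
    of M by cancelling u.\<close>
  note cancel = injective_map_cancel[OF u(2,1)]
  have "is_mod sc (r, B)" unfolding is_mod_def fst_conv snd_conv
  proof (intro conjI allI)
    show "B a \<in> carrier_mat r r" for a by (rule B)
    show "B (a + b) = B a + B b" for a b
    proof (rule cancel[OF B(1) add_carrier_mat[OF B(1)]])
      have "snd M (a + b) = snd M a + snd M b" using M unfolding is_mod_def by blast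
      then show "u * B (a + b) = u * (B a + B b)"
        using add_mult_distrib_mat[OF mc mc u(1)] mult_add_distrib_mat[OF u(1) B(1) B(1)] B(2) by metis
    qed
    show "B (a * b) = B a * B b" for a b
    proof (rule cancel[OF B(1) mult_carrier_mat[OF B(1) B(1)]])
      have "snd M (a * b) = snd M a * snd M b" using M unfolding is_mod_def by blast
      then show "u * B (a * b) = u * (B a * B b)"
        using assoc_mult_mat[OF mc mc u(1)] assoc_mult_mat[OF mc u(1) B(1)] assoc_mult_mat[OF u(1) B(1) B(1)]
          B(2) by metis
    qed
    show "B 1 = 1\<^sub>m r"
    proof (rule cancel[OF B(1) one_carrier_mat])
      have "snd M 1 = 1\<^sub>m (fst M)" using M unfolding is_mod_def by blast
      then show "u * B 1 = u * 1\<^sub>m r" using B(2)[of 1] u(1) by simp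
    qed
    show "B (sc c a) = c \<cdot>\<^sub>m B a" for c a
    proof (rule cancel[OF B(1) smult_carrier_mat[OF B(1)]])
      have "snd M (sc c a) = c \<cdot>\<^sub>m snd M a" using M unfolding is_mod_def by blast
      then show "u * B (sc c a) = u * (c \<cdot>\<^sub>m B a)"
        using mult_smult_assoc_mat[OF mc u(1)] mult_smult_distrib[OF u(1) B(1)] B(2) by metis
    qed
  qed
  then have "mor (r, B) M u" by (intro morI) (use M u(1) B in auto)
  then show ?thesis using that u(2,3) by (metis fst_conv)
qed

text \<open>The action descends to the quotient because the kernel of g, being the image of u, is
  stable under it. The module laws then follow by cancelling g.\<close>

lemma quotient_exists:
  assumes u: "mor U M u" "injective_map u"
  obtains V g where "mor M V g" "surjective_map g"
    "\<And>x. x \<in> carrier_vec (fst M) \<Longrightarrow> g *\<^sub>v x = 0\<^sub>v (fst V) \<longleftrightarrow> (\<exists>y\<in>carrier_vec (fst U). x = u *\<^sub>v y)"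
    "fst U + fst V = fst M"
proof -
  obtain s g where g: "g \<in> carrier_mat s (fst M)" "surjective_map g"
    "\<And>x. x \<in> carrier_vec (fst M) \<Longrightarrow> g *\<^sub>v x = 0\<^sub>v s \<longleftrightarrow> (\<exists>y\<in>carrier_vec (fst U). x = u *\<^sub>v y)"
    "fst U + s = fst M"
    by (rule injective_map_complement[OF mor_carrier[OF u(1)] u(2)]) (rule that; assumption)
  have M: "is_mod sc M" by (rule mor_mod[OF u(1)])
  note mc = mod_carrier[OF M]
  have "\<exists>B\<in>carrier_mat s s. B * g = g * snd M a" for a
  proof (rule mat_factor_through_surjective[OF g(1,2) mult_carrier_mat[OF g(1) mc]])
    fix x :: "'k vec" assume x: "x \<in> carrier_vec (fst M)" "g *\<^sub>v x = 0\<^sub>v s"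
    then obtain y where y: "y \<in> carrier_vec (fst U)" "x = u *\<^sub>v y" using g(3) by blast
    have "snd M a *\<^sub>v x = u *\<^sub>v (snd U a *\<^sub>v y)" using mor_act_vec[OF u(1) y(1)] y(2) by simp
    moreover have "snd U a *\<^sub>v y \<in> carrier_vec (fst U)"
      by (rule mult_mat_vec_carrier[OF mod_carrier[OF mor_mod(1)[OF u(1)]] y(1)])
    ultimately have "g *\<^sub>v (snd M a *\<^sub>v x) = 0\<^sub>v s"
      using g(3)[OF mult_mat_vec_carrier[OF mc x(1)]] by blast
    then show "(g * snd M a) *\<^sub>v x = 0\<^sub>v s" unfolding assoc_mult_mat_vec[OF g(1) mc x(1)] .
  qed
  then obtain B where B: "\<And>a. B a \<in> carrier_mat s s" "\<And>a. B a * g = g * snd M a" by metis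
  note cancel = surjective_map_cancel[OF g(2,1)]
  have "is_mod sc (s, B)" unfolding is_mod_def fst_conv snd_conv
  proof (intro conjI allI)
    show "B a \<in> carrier_mat s s" for a by (rule B)
    show "B (a + b) = B a + B b" for a b
    proof (rule cancel[OF B(1) add_carrier_mat[OF B(1)]])
      have "snd M (a + b) = snd M a + snd M b" using M unfolding is_mod_def by blast
      then show "B (a + b) * g = (B a + B b) * g"
        using mult_add_distrib_mat[OF g(1) mc mc] add_mult_distrib_mat[OF B(1) B(1) g(1)] B(2) by metis
    qed
    show "B (a * b) = B a * B b" for a b
    proof (rule cancel[OF B(1) mult_carrier_mat[OF B(1) B(1)]])
      have "snd M (a * b) = snd M a * snd M b" using M unfolding is_mod_def by blast
      then show "B (a * b) * g = B a * B b * g"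
        using assoc_mult_mat[OF g(1) mc mc] assoc_mult_mat[OF B(1) g(1) mc] assoc_mult_mat[OF B(1) B(1) g(1)]
          B(2) by metis
    qed
    show "B 1 = 1\<^sub>m s"
    proof (rule cancel[OF B(1) one_carrier_mat])
      have "snd M 1 = 1\<^sub>m (fst M)" using M unfolding is_mod_def by blast
      then show "B 1 * g = 1\<^sub>m s * g" using B(2)[of 1] g(1) by simp
    qed
    show "B (sc c a) = c \<cdot>\<^sub>m B a" for c a
    proof (rule cancel[OF B(1) smult_carrier_mat[OF B(1)]])
      have "snd M (sc c a) = c \<cdot>\<^sub>m snd M a" using M unfolding is_mod_def by blast
      then show "B (sc c a) * g = c \<cdot>\<^sub>m B a * g"
        using mult_smult_assoc_mat[OF B(1) g(1)] mult_smult_distrib[OF g(1) mc] B(2) by metis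
    qed
  qed
  then have "mor M (s, B) g" by (intro morI) (use M g(1) B in auto)
  then show ?thesis using that[of "(s, B)" g] g by simp
qed

lemma kernel_exists:
  assumes f: "mor M N f"
  obtains U u where "mor U M u" "injective_map u" "f * u = 0\<^sub>m (fst N) (fst U)"
    "\<And>x. x \<in> carrier_vec (fst M) \<Longrightarrow> f *\<^sub>v x = 0\<^sub>v (fst N) \<Longrightarrow> \<exists>y\<in>carrier_vec (fst U). u *\<^sub>v y = x"
proof -
  note fc = mor_carrier[OF f] and mc = mod_carrier[OF mor_mod(1)[OF f]] and nc = mod_carrier[OF mor_mod(2)[OF f]]
  let ?W = "{x \<in> carrier_vec (fst M). f *\<^sub>v x = 0\<^sub>v (fst N)}"
  have W: "subsp (fst M) ?W"
    using mult_add_distrib_mat_vec[OF fc] mult_mat_vec[OF fc] fc by (auto simp: subsp_def)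
  have inv: "snd M a *\<^sub>v x \<in> ?W" if "x \<in> ?W" for a x
    using that mor_act_vec[OF f] mult_mat_vec_carrier[OF mc] mult_mat_vec_zero[OF nc] by auto
  obtain U u where u: "mor U M u" "injective_map u" "(\<lambda>x. u *\<^sub>v x) ` carrier_vec (fst U) = ?W"
    using submodule_exists[OF mor_mod(1)[OF f] W inv] .
  have "f * u = 0\<^sub>m (fst N) (fst U)"
  proof (rule mat_eq_on_vecI[OF mor_carrier[OF mor_comp[OF u(1) f]] zero_carrier_mat])
    fix x :: "'k vec" assume x: "x \<in> carrier_vec (fst U)"
    then have "u *\<^sub>v x \<in> ?W" using u(3) by blast
    then show "(f * u) *\<^sub>v x = 0\<^sub>m (fst N) (fst U) *\<^sub>v x"
      unfolding mor_assoc_vec[OF u(1) f x] using x by simp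
  qed
  moreover have "\<exists>y\<in>carrier_vec (fst U). u *\<^sub>v y = x"
    if "x \<in> carrier_vec (fst M)" "f *\<^sub>v x = 0\<^sub>v (fst N)" for x
  proof -
    have "x \<in> (\<lambda>x. u *\<^sub>v x) ` carrier_vec (fst U)" unfolding u(3) using that by simp
    then show ?thesis by auto
  qed
  ultimately show ?thesis using that u(1,2) by blast
qed

lemma image_exists:
  assumes f: "mor M N f"
  obtains U u p where "mor U N u" "injective_map u" "mor M U p" "surjective_map p" "u * p = f"
proof -
  note fc = mor_carrier[OF f] and mc = mod_carrier[OF mor_mod(1)[OF f]] and nc = mod_carrier[OF mor_mod(2)[OF f]]
  let ?W = "(\<lambda>x. f *\<^sub>v x) ` carrier_vec (fst M)"
  have W: "subsp (fst N) ?W" unfolding subsp_def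
  proof (intro conjI ballI allI)
    show "?W \<subseteq> carrier_vec (fst N)" using mor_vec[OF f] by auto
    show "0\<^sub>v (fst N) \<in> ?W" by (rule image_eqI[of _ _ "0\<^sub>v (fst M)"]) (use mult_mat_vec_zero[OF fc] in auto)
    fix x assume "x \<in> ?W"
    then obtain x' where x': "x' \<in> carrier_vec (fst M)" "x = f *\<^sub>v x'" by blast
    show "c \<cdot>\<^sub>v x \<in> ?W" for c
      by (rule image_eqI[of _ _ "c \<cdot>\<^sub>v x'"]) (use x' mult_mat_vec[OF fc] in auto)
    fix y assume "y \<in> ?W"
    then obtain y' where y': "y' \<in> carrier_vec (fst M)" "y = f *\<^sub>v y'" by blast
    show "x + y \<in> ?W"
      by (rule image_eqI[of _ _ "x' + y'"]) (use x' y' mult_add_distrib_mat_vec[OF fc] in auto)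
  qed
  have inv: "snd N a *\<^sub>v x \<in> ?W" if xW: "x \<in> ?W" for a x
  proof -
    obtain x' where x': "x' \<in> carrier_vec (fst M)" "x = f *\<^sub>v x'" using xW by blast
    show ?thesis
      by (rule image_eqI[of _ _ "snd M a *\<^sub>v x'"]) (use x' mor_act_vec[OF f] mult_mat_vec_carrier[OF mc] in auto)
  qed
  obtain U u where u: "mor U N u" "injective_map u" "(\<lambda>x. u *\<^sub>v x) ` carrier_vec (fst U) = ?W"
    using submodule_exists[OF mor_mod(2)[OF f] W inv] .
  have "\<exists>y\<in>carrier_vec (fst U). u *\<^sub>v y = f *\<^sub>v x" if "x \<in> carrier_vec (fst M)" for x
  proof -
    have "f *\<^sub>v x \<in> (\<lambda>x. u *\<^sub>v x) ` carrier_vec (fst U)" unfolding u(3) using that by blast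
    then show ?thesis by auto
  qed
  then obtain p where p: "mor M U p" "u * p = f" using mor_factor_inj[OF u(1,2) f] by blast
  have "surjective_map p"
  proof (rule surjective_mapI[OF mor_carrier[OF p(1)]])
    fix w :: "'k vec" assume w: "w \<in> carrier_vec (fst U)"
    then have "u *\<^sub>v w \<in> ?W" using u(3) by blast
    then obtain x where x: "x \<in> carrier_vec (fst M)" "u *\<^sub>v w = f *\<^sub>v x" by blast
    then have "u *\<^sub>v w = u *\<^sub>v (p *\<^sub>v x)" using p mor_assoc_vec[OF p(1) u(1)] by simp
    then have "w = p *\<^sub>v x"
      using injective_map_cancel_vec[OF u(2) mor_carrier[OF u(1)] w mor_vec[OF p(1) x(1)]] by simp
    then show "\<exists>x\<in>carrier_vec (fst M). p *\<^sub>v x = w" using x(1) by blast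
  qed
  then show ?thesis using that u(1,2) p by blast
qed

section \<open>Direct sums of modules\<close>

lemma dsum_simps: "fst (dsum M N) = fst M + fst N"
  "snd (dsum M N) a = four_block_mat (snd M a) (0\<^sub>m (fst M) (fst N)) (0\<^sub>m (fst N) (fst M)) (snd N a)"
  by (simp_all add: dsum_def)

lemma dsum_mod:
  assumes M: "is_mod sc M" and N: "is_mod sc N"
  shows "is_mod sc (dsum M N)"
  unfolding is_mod_def dsum_simps
proof (intro conjI allI)
  note mc = mod_carrier[OF M] and nc = mod_carrier[OF N]
  let ?d = "\<lambda>a. four_block_mat (snd M a) (0\<^sub>m (fst M) (fst N)) (0\<^sub>m (fst N) (fst M)) (snd N a)"
  show "?d a \<in> carrier_mat (fst M + fst N) (fst M + fst N)" for a
    by (rule four_block_carrier_mat[OF mc nc])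
  show "?d (a + b) = ?d a + ?d b" for a b
    using add_four_block_mat[OF mc zero_carrier_mat zero_carrier_mat nc mc zero_carrier_mat zero_carrier_mat nc]
      M N unfolding is_mod_def by simp
  show "?d (a * b) = ?d a * ?d b" for a b
    using mult_four_block_mat[OF mc zero_carrier_mat zero_carrier_mat nc mc zero_carrier_mat zero_carrier_mat nc]
      M N mult_carrier_mat[OF mc mc] mult_carrier_mat[OF nc nc] unfolding is_mod_def
    by (simp add: left_mult_zero_mat[OF nc] right_mult_zero_mat[OF mc] left_mult_zero_mat[OF mc] right_mult_zero_mat[OF nc])
  show "?d 1 = 1\<^sub>m (fst M + fst N)" using M N unfolding is_mod_def by simp
  show "?d (sc c a) = c \<cdot>\<^sub>m ?d a" for c a
    using smult_four_block_mat[OF mc zero_carrier_mat zero_carrier_mat nc] M N unfolding is_mod_def by simp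
qed

lemma dsum_mor:
  assumes M: "is_mod sc M" and N: "is_mod sc N"
  shows "mor M (dsum M N) (inj_fst (fst M) (fst N))" "mor N (dsum M N) (inj_snd (fst M) (fst N))"
    "mor (dsum M N) M (proj_fst (fst M) (fst N))" "mor (dsum M N) N (proj_snd (fst M) (fst N))"
  by (rule morI[OF M dsum_mod[OF M N]] morI[OF N dsum_mod[OF M N]] morI[OF dsum_mod[OF M N] M]
      morI[OF dsum_mod[OF M N] N];
      simp add: dsum_simps block_intertwine[OF mod_carrier[OF M] mod_carrier[OF N]])+

lemma hcat_mor:
  assumes f: "mor M L f" and g: "mor N L g"
  shows "mor (dsum M N) L (hcat (fst M) (fst N) f g)"
  unfolding hcat_def
  by (rule mor_add[OF mor_comp[OF dsum_mor(3) f] mor_comp[OF dsum_mor(4) g]]) (use assms mor_mod in blast)+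

end

lemma block_vec_proj:
  fixes x :: "'k::field vec"
  assumes x: "x \<in> carrier_vec m" and y: "y \<in> carrier_vec n"
  shows "inj_fst m n *\<^sub>v x + inj_snd m n *\<^sub>v y \<in> carrier_vec (m + n)"
    "proj_fst m n *\<^sub>v (inj_fst m n *\<^sub>v x + inj_snd m n *\<^sub>v y) = x"
    "proj_snd m n *\<^sub>v (inj_fst m n *\<^sub>v x + inj_snd m n *\<^sub>v y) = y"
proof -
  note ix = mult_mat_vec_carrier[OF block_carrier(1) x, of n]
    and iy = mult_mat_vec_carrier[OF block_carrier(2) y, of m]
  show "inj_fst m n *\<^sub>v x + inj_snd m n *\<^sub>v y \<in> carrier_vec (m + n)"
    by (rule add_carrier_vec[OF ix iy])
  show "proj_fst m n *\<^sub>v (inj_fst m n *\<^sub>v x + inj_snd m n *\<^sub>v y) = x"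
    unfolding mult_add_distrib_mat_vec[OF block_carrier(3) ix iy]
      assoc_mult_mat_vec[OF block_carrier(3) block_carrier(1) x, symmetric]
      assoc_mult_mat_vec[OF block_carrier(3) block_carrier(2) y, symmetric] block_identities
    using x y by simp
  show "proj_snd m n *\<^sub>v (inj_fst m n *\<^sub>v x + inj_snd m n *\<^sub>v y) = y"
    unfolding mult_add_distrib_mat_vec[OF block_carrier(4) ix iy]
      assoc_mult_mat_vec[OF block_carrier(4) block_carrier(1) x, symmetric]
      assoc_mult_mat_vec[OF block_carrier(4) block_carrier(2) y, symmetric] block_identities
    using x y by simp
qed

text \<open>Variants of the matrix ring laws whose side conditions only mention dimensions, so that the
  simplifier can discharge them.\<close>

lemma mat_laws:
  fixes A B C :: "'k::field mat"
  shows mat_assoc: "dim_col A = dim_row B \<Longrightarrow> dim_col B = dim_row C \<Longrightarrow> A * B * C = A * (B * C)"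
    and mat_distl: "dim_col A = dim_row B \<Longrightarrow> dim_row B = dim_row C \<Longrightarrow> dim_col B = dim_col C \<Longrightarrow>
      A * (B + C) = A * B + A * C"
    and mat_distr: "dim_col A = dim_row C \<Longrightarrow> dim_row A = dim_row B \<Longrightarrow> dim_col A = dim_col B \<Longrightarrow>
      (A + B) * C = A * C + B * C"
    and mat_minusl: "dim_col A = dim_row B \<Longrightarrow> dim_row B = dim_row C \<Longrightarrow> dim_col B = dim_col C \<Longrightarrow>
      A * (B - C) = A * B - A * C"
    and mat_minusr: "dim_col A = dim_row C \<Longrightarrow> dim_row A = dim_row B \<Longrightarrow> dim_col A = dim_col B \<Longrightarrow>
      (A - B) * C = A * C - B * C"
  by (rule assoc_mult_mat[of _ "dim_row A" "dim_col A" _ "dim_col B" _ "dim_col C"]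
      mult_add_distrib_mat[of _ "dim_row A" "dim_col A" _ "dim_col B"]
      add_mult_distrib_mat[of _ "dim_row A" "dim_col A" _ _ "dim_col C"]
      mult_minus_distrib_mat[of _ "dim_row A" "dim_col A" _ "dim_col B"]
      minus_mult_distrib_mat[of _ "dim_row A" "dim_col A" _ _ "dim_col C"];
      (rule carrier_matI; simp))+

text \<open>In products bracketed to the right, A * B occurs only within A * (B * Z); this is the
  form in which a known equation A * B = C applies there.\<close>

lemma mat_reassoc:
  fixes A B C Z :: "'k::field mat"
  shows "A * B = C \<Longrightarrow> dim_col A = dim_row B \<Longrightarrow> dim_col B = dim_row Z \<Longrightarrow> A * (B * Z) = C * Z"
  using mat_assoc by metis

lemma mat_add_laws:
  fixes A B :: "'k::field mat"
  assumes "dim_row A = n" "dim_col A = m"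
  shows "0\<^sub>m n m + A = A" "A + 0\<^sub>m n m = A" "A - 0\<^sub>m n m = A" "A - A = 0\<^sub>m n m"
    "dim_row B = n \<Longrightarrow> dim_col B = m \<Longrightarrow> A + (B - A) = B"
    "dim_row B = n \<Longrightarrow> dim_col B = m \<Longrightarrow> A - B = 0\<^sub>m n m \<longleftrightarrow> A = B"
proof -
  show "0\<^sub>m n m + A = A" "A + 0\<^sub>m n m = A" "A - 0\<^sub>m n m = A" "A - A = 0\<^sub>m n m"
    "dim_row B = n \<Longrightarrow> dim_col B = m \<Longrightarrow> A + (B - A) = B"
    using assms by (auto intro!: eq_matI)
  assume B: "dim_row B = n" "dim_col B = m"
  have "A = B" if z: "A - B = 0\<^sub>m n m"
  proof (rule eq_matI)
    fix i j assume ij: "i < dim_row B" "j < dim_col B"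
    then have "(A - B) $$ (i, j) = A $$ (i, j) - B $$ (i, j)" by simp
    then show "A $$ (i, j) = B $$ (i, j)" unfolding z using ij B by simp
  qed (use assms B in auto)
  then show "A - B = 0\<^sub>m n m \<longleftrightarrow> A = B" using assms by auto
qed

context matrix_modules
begin

lemma mor_dim: "mor M N f \<Longrightarrow> dim_row f = fst N" "mor M N f \<Longrightarrow> dim_col f = fst M"
  using mor_carrier by blast+

lemmas dsum_mor' = dsum_mor[OF mor_mod(1) mor_mod(1)]

text \<open>The universal property of the kernel, for any injective u whose image contains the
  kernel of g.\<close>

lemma mor_factor_exact:
  assumes u: "mor U M u" "injective_map u"
    and ex: "\<And>x. x \<in> carrier_vec (fst M) \<Longrightarrow> g *\<^sub>v x = 0\<^sub>v (fst V) \<Longrightarrow> \<exists>y\<in>carrier_vec (fst U). u *\<^sub>v y = x"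
    and g: "mor M V g" and h: "mor Z M h" "g * h = 0\<^sub>m (fst V) (fst Z)"
  obtains h' where "mor Z U h'" "u * h' = h"
proof (rule mor_factor_inj[OF u h(1)])
  fix x :: "'k vec" assume x: "x \<in> carrier_vec (fst Z)"
  have "g *\<^sub>v (h *\<^sub>v x) = 0\<^sub>v (fst V)"
    unfolding mor_assoc_vec[OF h(1) g x, symmetric] h(2) using x by simp
  then show "\<exists>y\<in>carrier_vec (fst U). u *\<^sub>v y = h *\<^sub>v x" using ex mor_vec[OF h(1) x] by simp
qed

section \<open>Projective presentations and the vanishing of Ext\<close>

definition lifting :: "('a, 'k) amod \<Rightarrow> bool" where
  "lifting P \<longleftrightarrow> is_mod sc P \<and> (\<forall>V N g h. mor V N g \<and> surjective_map g \<and> mor P N h \<longrightarrow>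
     (\<exists>h'. mor P V h' \<and> g * h' = h))"

lemma liftingE:
  assumes "lifting P" "mor V N g" "surjective_map g" "mor P N h"
  obtains h' where "mor P V h'" "g * h' = h"
  using assms unfolding lifting_def by blast

text \<open>By definition only surjections onto P split. Applied to the pullback of g along h, which
  projects onto P, this gives a section s; followed by the projection of the pullback to V, it lifts
  h.\<close>

lemma projective_lifting:
  assumes P: "projective sc P"
  shows "lifting P"
  unfolding lifting_def
proof (intro conjI allI impI)
  show Pm: "is_mod sc P" using P by (simp add: projective_def)
  fix V N g h assume "mor V N g \<and> surjective_map g \<and> mor P N h"
  then have g: "mor V N g" "surjective_map g" and h: "mor P N h" by auto
  note D = dsum_mor'[OF g(1) h]
  \<comment> \<open>The kernel Z of d consists of the pairs (v, x) with g v = h x, so it is the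
    pullback.\<close>
  define d where "d = g * proj_fst (fst V) (fst P) - h * proj_snd (fst V) (fst P)"
  have d: "mor (dsum V P) N d" unfolding d_def by (rule mor_minus[OF mor_comp[OF D(3) g(1)] mor_comp[OF D(4) h]])
  obtain Z u where u: "mor Z (dsum V P) u" "injective_map u" "d * u = 0\<^sub>m (fst N) (fst Z)"
    "\<And>x. x \<in> carrier_vec (fst (dsum V P)) \<Longrightarrow> d *\<^sub>v x = 0\<^sub>v (fst N) \<Longrightarrow> \<exists>y\<in>carrier_vec (fst Z). u *\<^sub>v y = x"
    by (rule kernel_exists[OF d]) (rule that; assumption)
  define q where "q = proj_snd (fst V) (fst P) * u"
  have q: "mor Z P q" unfolding q_def by (rule mor_comp[OF u(1) D(4)])
  have "surjective_map q"
  proof (rule surjective_mapI[OF mor_carrier[OF q]])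
    fix x :: "'k vec" assume x: "x \<in> carrier_vec (fst P)"
    obtain v where v: "v \<in> carrier_vec (fst V)" "g *\<^sub>v v = h *\<^sub>v x"
      using surjective_mapD[OF g(2) mor_carrier[OF g(1)] mor_vec[OF h x]] by blast
    let ?z = "inj_fst (fst V) (fst P) *\<^sub>v v + inj_snd (fst V) (fst P) *\<^sub>v x"
    note z = block_vec_proj[OF v(1) x]
    have "d *\<^sub>v ?z = (g * proj_fst (fst V) (fst P)) *\<^sub>v ?z - (h * proj_snd (fst V) (fst P)) *\<^sub>v ?z"
      unfolding d_def
      by (rule minus_mult_distrib_mat_vec[OF mor_carrier[OF mor_comp[OF D(3) g(1)], unfolded dsum_simps]
            mor_carrier[OF mor_comp[OF D(4) h], unfolded dsum_simps] z(1)])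
    also have "\<dots> = g *\<^sub>v v - h *\<^sub>v x"
      using mor_assoc_vec[OF D(3) g(1), of ?z] mor_assoc_vec[OF D(4) h, of ?z] z by (simp add: dsum_simps)
    also have "\<dots> = 0\<^sub>v (fst N)" unfolding v(2) using mor_vec[OF h x] by simp
    finally obtain y where y: "y \<in> carrier_vec (fst Z)" "u *\<^sub>v y = ?z" using u(4)[of ?z] z(1) by (auto simp: dsum_simps)
    then have "q *\<^sub>v y = x" unfolding q_def mor_assoc_vec[OF u(1) D(4) y(1)] using z(3) by simp
    then show "\<exists>y\<in>carrier_vec (fst Z). q *\<^sub>v y = x" using y(1) by blast
  qed
  then obtain s where "is_hom P Z s" "q * s = 1\<^sub>m (fst P)"
    using P q unfolding projective_def splits_def mor_def by blast
  then have s: "mor P Z s" "q * s = 1\<^sub>m (fst P)" using q Pm by (auto simp: mor_def)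
  note dims = mor_dim[OF g(1)] mor_dim[OF h] mor_dim[OF u(1)] mor_dim[OF s(1)] dsum_simps(1)
  have "g * (proj_fst (fst V) (fst P) * u) = h * q"
    using u(3) unfolding d_def q_def by (simp add: mat_laws dims mat_add_laws)
  then have "g * (proj_fst (fst V) (fst P) * u * s) = h * (q * s)"
    using mat_assoc[of g "proj_fst (fst V) (fst P) * u" s] mat_assoc[of h q s] by (simp add: dims mor_dim[OF q])
  then show "\<exists>h'. mor P V h' \<and> g * h' = h"
    using s(2) mor_right_id[OF h] mor_comp[OF s(1) mor_comp[OF u(1) D(3)]] by (intro exI) auto
qed

text \<open>A projective resolution 0 -> Q -> P -> X -> 0 of length one, with lifting in place of
  splitting.\<close>

definition pres :: "('a, 'k) amod \<Rightarrow> ('a, 'k) amod \<Rightarrow> ('a, 'k) amod \<Rightarrow> 'k mat \<Rightarrow> 'k mat \<Rightarrow> bool" where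
  "pres Q P X j g \<longleftrightarrow> lifting Q \<and> lifting P \<and> mor Q P j \<and> injective_map j \<and> mor P X g \<and> surjective_map g \<and>
     g * j = 0\<^sub>m (fst X) (fst Q) \<and>
     (\<forall>x\<in>carrier_vec (fst P). g *\<^sub>v x = 0\<^sub>v (fst X) \<longrightarrow> (\<exists>y\<in>carrier_vec (fst Q). j *\<^sub>v y = x))"

lemma presD:
  assumes "pres Q P X j g"
  shows "lifting Q" "lifting P" "mor Q P j" "injective_map j" "mor P X g" "surjective_map g"
    "g * j = 0\<^sub>m (fst X) (fst Q)"
    "\<And>x. x \<in> carrier_vec (fst P) \<Longrightarrow> g *\<^sub>v x = 0\<^sub>v (fst X) \<Longrightarrow> \<exists>y\<in>carrier_vec (fst Q). j *\<^sub>v y = x"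
  using assms unfolding pres_def by blast+

lemma pd_le_1_pres:
  assumes "pd_le_1 sc T" "is_mod sc T"
  obtains Q P j g where "pres Q P T j g"
proof -
  obtain P0 P1 f g where *: "projective sc P0" "projective sc P1" "ses P1 P0 T f g"
    using assms(1) unfolding pd_le_1_def by blast
  have m: "is_mod sc P0" "is_mod sc P1" using * by (auto simp: projective_def)
  have "pres P1 P0 T f g" unfolding pres_def
    using *(3) m assms(2) projective_lifting[OF *(1)] projective_lifting[OF *(2)]
    unfolding ses_def mor_def by blast
  then show ?thesis using that by blast
qed

text \<open>For a presentation 0 -> Q -> P -> X -> 0 this says Ext^1(X, N) = 0, as Ext^1(X, N) is
  the cokernel of the restriction map Hom(P, N) -> Hom(Q, N).\<close>

definition extends :: "('a, 'k) amod \<Rightarrow> ('a, 'k) amod \<Rightarrow> 'k mat \<Rightarrow> ('a, 'k) amod \<Rightarrow> bool" where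
  "extends Q P j N \<longleftrightarrow> (\<forall>h. mor Q N h \<longrightarrow> (\<exists>h'. mor P N h' \<and> h' * j = h))"

lemma extendsE:
  assumes "extends Q P j N" "mor Q N h"
  obtains h' where "mor P N h'" "h' * j = h"
  using assms unfolding extends_def by blast

text \<open>The pushout V of j and h is an extension 0 -> N -> V -> X -> 0. It splits by assumption,
  so f : N -> V has a retraction r, and P -> V followed by r extends h. The pushout is the quotient
  of \<open>dsum N P\<close> by the image of m = (-h, j).\<close>

lemma ext1_zero_extends:
  assumes pr: "pres Q P X j g" and ext: "ext1_zero sc X N" and N: "is_mod sc N"
  shows "extends Q P j N"
  unfolding extends_def
proof (intro allI impI)
  fix h assume h: "mor Q N h"
  note pr = presD[OF pr]
  note D = dsum_mor[OF N mor_mod(1)[OF pr(5)]]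
  let ?i1 = "inj_fst (fst N) (fst P) :: 'k mat" and ?i2 = "inj_snd (fst N) (fst P) :: 'k mat"
  let ?p1 = "proj_fst (fst N) (fst P) :: 'k mat" and ?p2 = "proj_snd (fst N) (fst P) :: 'k mat"
  note dims = mor_dim[OF pr(3)] mor_dim[OF pr(5)] mor_dim[OF h] dsum_simps(1)
  define m where "m = ?i2 * j - ?i1 * h"
  have m: "mor Q (dsum N P) m" unfolding m_def by (rule mor_minus[OF mor_comp[OF pr(3) D(2)] mor_comp[OF h D(1)]])
  have pm: "?p2 * m = j" "?p1 * m = 0\<^sub>m (fst N) (fst Q) - h"
    unfolding m_def by (simp_all add: mat_laws dims mat_add_laws block_identities mat_reassoc[OF block_identities(1)]
        mat_reassoc[OF block_identities(2)] mat_reassoc[OF block_identities(3)] mat_reassoc[OF block_identities(4)])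
  have minj: "injective_map m"
  proof (rule injective_mapI[OF mor_carrier[OF m]])
    fix y :: "'k vec" assume y: "y \<in> carrier_vec (fst Q)" "m *\<^sub>v y = 0\<^sub>v (fst (dsum N P))"
    then have "j *\<^sub>v y = 0\<^sub>v (fst P)" using mor_assoc_vec[OF m D(4) y(1)] pm(1)
      by (simp add: mult_mat_vec_zero[OF mor_carrier[OF D(4)]])
    then show "y = 0\<^sub>v (fst Q)" by (rule injective_mapD[OF pr(4) mor_carrier[OF pr(3)] y(1)])
  qed
  obtain V p where V: "mor (dsum N P) V p" "surjective_map p"
    "\<And>x. x \<in> carrier_vec (fst (dsum N P)) \<Longrightarrow> p *\<^sub>v x = 0\<^sub>v (fst V) \<longleftrightarrow> (\<exists>y\<in>carrier_vec (fst Q). x = m *\<^sub>v y)"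
    by (rule quotient_exists[OF m minj]) (rule that; assumption)
  have p_m: "p * m = 0\<^sub>m (fst V) (fst Q)"
  proof (rule mat_eq_on_vecI[OF mor_carrier[OF mor_comp[OF m V(1)]] zero_carrier_mat])
    fix y :: "'k vec" assume y: "y \<in> carrier_vec (fst Q)"
    show "(p * m) *\<^sub>v y = 0\<^sub>m (fst V) (fst Q) *\<^sub>v y"
      unfolding mor_assoc_vec[OF m V(1) y] using V(3)[OF mor_vec[OF m y]] y by auto
  qed
  define f where "f = p * ?i1"
  have f: "mor N V f" unfolding f_def by (rule mor_comp[OF D(1) V(1)])
  have gp: "mor (dsum N P) X (g * ?p2)" by (rule mor_comp[OF D(4) pr(5)])
  have "g * ?p2 * m = 0\<^sub>m (fst X) (fst Q)"
    using mor_assoc[OF m D(4) pr(5)] pm(1) pr(7) by simp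
  then have gpm: "(g * ?p2) *\<^sub>v (m *\<^sub>v y) = 0\<^sub>v (fst X)" if "y \<in> carrier_vec (fst Q)" for y
    using mor_assoc_vec[OF m gp that] that by simp
  obtain e where e: "mor V X e" "e * p = g * ?p2"
  proof (rule mor_factor_surj[OF V(1,2) gp])
    fix x :: "'k vec" assume "x \<in> carrier_vec (fst (dsum N P))" "p *\<^sub>v x = 0\<^sub>v (fst V)"
    then show "(g * ?p2) *\<^sub>v x = 0\<^sub>v (fst X)" using V(3) gpm by blast
  qed
  note dims' = dims mor_dim[OF V(1)] mor_dim[OF e(1)] mor_dim[OF m]
  have ef: "e * f = 0\<^sub>m (fst X) (fst N)"
    unfolding f_def by (simp add: mat_reassoc[OF e(2)] mat_laws dims' block_identities)
  have finj: "injective_map f"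
  proof (rule injective_mapI[OF mor_carrier[OF f]])
    fix x :: "'k vec" assume x: "x \<in> carrier_vec (fst N)" "f *\<^sub>v x = 0\<^sub>v (fst V)"
    then obtain y where y: "y \<in> carrier_vec (fst Q)" "?i1 *\<^sub>v x = m *\<^sub>v y"
      using V(3)[OF mor_vec[OF D(1) x(1)]] mor_assoc_vec[OF D(1) V(1) x(1)] f_def by auto
    have "j *\<^sub>v y = ?p2 *\<^sub>v (?i1 *\<^sub>v x)" unfolding y(2) using mor_assoc_vec[OF m D(4) y(1)] pm(1) by simp
    also have "\<dots> = 0\<^sub>v (fst P)"
      unfolding mor_assoc_vec[OF D(1) D(4) x(1), symmetric] block_identities using x(1) by simp
    finally have "y = 0\<^sub>v (fst Q)" by (rule injective_mapD[OF pr(4) mor_carrier[OF pr(3)] y(1)])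
    then have "?p1 *\<^sub>v (?i1 *\<^sub>v x) = 0\<^sub>v (fst N)"
      unfolding y(2) by (simp add: mult_mat_vec_zero[OF mor_carrier[OF m]] mult_mat_vec_zero[OF mor_carrier[OF D(3)]])
    then show "x = 0\<^sub>v (fst N)"
      unfolding mor_assoc_vec[OF D(1) D(3) x(1), symmetric] block_identities using x(1) by simp
  qed
  have "surjective_map (e * p)" unfolding e(2)
  proof (rule mor_surj_comp[OF _ D(4) pr(6,5)])
    show "surjective_map ?p2"
      by (rule right_inverse_surjective[OF block_identities(2) block_carrier(4) block_carrier(2)])
  qed
  then have esurj: "surjective_map e"
  proof -
    assume s: "surjective_map (e * p)"
    show ?thesis
    proof (rule surjective_mapI[OF mor_carrier[OF e(1)]])
      fix w :: "'k vec" assume "w \<in> carrier_vec (fst X)"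
      then obtain v where v: "v \<in> carrier_vec (fst (dsum N P))" "(e * p) *\<^sub>v v = w"
        using surjective_mapD[OF s mor_carrier[OF mor_comp[OF V(1) e(1)]]] by blast
      then show "\<exists>v\<in>carrier_vec (fst V). e *\<^sub>v v = w"
        using mor_assoc_vec[OF V(1) e(1) v(1)] mor_vec[OF V(1) v(1)] by auto
    qed
  qed
  have exact: "\<exists>x\<in>carrier_vec (fst N). f *\<^sub>v x = v"
    if v: "v \<in> carrier_vec (fst V)" "e *\<^sub>v v = 0\<^sub>v (fst X)" for v
  proof -
    obtain d where d: "d \<in> carrier_vec (fst (dsum N P))" "p *\<^sub>v d = v"
      using surjective_mapD[OF V(2) mor_carrier[OF V(1)] v(1)] by blast
    note p1d = mor_vec[OF D(3) d(1)] and p2d = mor_vec[OF D(4) d(1)]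
    have "g *\<^sub>v (?p2 *\<^sub>v d) = 0\<^sub>v (fst X)"
      using mor_assoc_vec[OF D(4) pr(5) d(1)] mor_assoc_vec[OF V(1) e(1) d(1)] e(2) d(2) v(2) by simp
    then obtain y where y: "y \<in> carrier_vec (fst Q)" "j *\<^sub>v y = ?p2 *\<^sub>v d" using pr(8)[OF p2d] by blast
    have my: "m *\<^sub>v y = ?i2 *\<^sub>v (j *\<^sub>v y) - ?i1 *\<^sub>v (h *\<^sub>v y)"
      unfolding m_def using minus_mult_distrib_mat_vec[OF mor_carrier[OF mor_comp[OF pr(3) D(2)]]
          mor_carrier[OF mor_comp[OF h D(1)]] y(1)] mor_assoc_vec[OF pr(3) D(2) y(1)] mor_assoc_vec[OF h D(1) y(1)]
      by simp
    note hy = mor_vec[OF h y(1)]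
    \<comment> \<open>Modulo the image of m, the component j y of d in P may be replaced by h y in
      N.\<close>
    let ?x = "?p1 *\<^sub>v d + h *\<^sub>v y"
    have x: "?x \<in> carrier_vec (fst N)" by (rule add_carrier_vec[OF p1d hy])
    have i1x: "?i1 *\<^sub>v ?x = ?i1 *\<^sub>v (?p1 *\<^sub>v d) + ?i1 *\<^sub>v (h *\<^sub>v y)"
      by (rule mult_add_distrib_mat_vec[OF mor_carrier[OF D(1)] p1d hy])
    have "d = ?i1 *\<^sub>v (?p1 *\<^sub>v d) + ?i2 *\<^sub>v (j *\<^sub>v y)"
      using block_vec_eq[of d "fst N" "fst P"] d(1) y(2) by (simp add: dsum_simps)
    also have "\<dots> = ?i1 *\<^sub>v ?x + m *\<^sub>v y"
      unfolding my i1x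
      using mor_vec[OF D(1) p1d] mor_vec[OF D(1) hy] mor_vec[OF D(2) mor_vec[OF pr(3) y(1)]]
      by (intro eq_vecI) (auto simp del: index_mult_mat_vec simp: dsum_simps)
    finally have "v = p *\<^sub>v (?i1 *\<^sub>v ?x) + p *\<^sub>v (m *\<^sub>v y)"
      using d(2) mult_add_distrib_mat_vec[OF mor_carrier[OF V(1)] mor_vec[OF D(1) x] mor_vec[OF m y(1)]] by simp
    also have "p *\<^sub>v (m *\<^sub>v y) = 0\<^sub>v (fst V)" using V(3)[OF mor_vec[OF m y(1)]] y(1) by blast
    also have "p *\<^sub>v (?i1 *\<^sub>v ?x) + 0\<^sub>v (fst V) = f *\<^sub>v ?x"
      unfolding f_def mor_assoc_vec[OF D(1) V(1) x] using mor_vec[OF V(1) mor_vec[OF D(1) x]] by simp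
    finally show ?thesis using x by blast
  qed
  have "ses N V X f e" unfolding ses_def
    using mor_hom[OF f] mor_hom[OF e(1)] finj esurj ef exact by blast
  then have "splits V X e" using ext mor_mod(2)[OF V(1)] unfolding ext1_zero_def by blast
  then obtain s where "is_hom X V s" and es: "e * s = 1\<^sub>m (fst X)" unfolding splits_def by blast
  then have s: "mor X V s" using e(1) by (auto simp: mor_def)
  note dims'' = dims' mor_dim[OF s] mor_dim[OF f]
  \<comment> \<open>The section s of e yields a retraction of f: 1 - s e has its image in the kernel
    of e, which is the image of f, and so equals f r.\<close>
  have k: "mor V V (1\<^sub>m (fst V) - s * e)" by (rule mor_minus[OF mor_id[OF mor_mod(1)[OF e(1)]] mor_comp[OF e(1) s]])
  have "e * (1\<^sub>m (fst V) - s * e) = 0\<^sub>m (fst X) (fst V)"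
    by (simp add: mat_laws dims'' mat_reassoc[OF es] mat_add_laws)
  then obtain r where r: "mor V N r" "f * r = 1\<^sub>m (fst V) - s * e"
    using mor_factor_exact[OF f finj exact e(1) k] by blast
  note dims3 = dims'' mor_dim[OF r(1)]
  have "f * (r * f) = f * 1\<^sub>m (fst N)"
    by (simp add: mat_reassoc[OF r(2)] mat_laws dims3 ef mat_add_laws)
  then have rf: "r * f = 1\<^sub>m (fst N)" by (rule mor_inj_cancel[OF finj f mor_comp[OF f r(1)] mor_id[OF N]])
  have "p * (?i2 * j) = f * h"
    using p_m unfolding m_def f_def by (simp add: mat_laws dims3 mat_add_laws)
  then have "r * (p * ?i2) * j = h"
    by (simp add: mat_laws dims3 mat_reassoc[OF rf])
  then show "\<exists>h'. mor P N h' \<and> h' * j = h" using mor_comp[OF mor_comp[OF D(2) V(1)] r(1)] by blast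
qed

text \<open>The projective P0 is kept and Q is the kernel of P0 -> T -> X. The identity of Q is the
  sum of a map through P1 and a map through P0, so Q inherits lifting from both, and extension of
  maps along j reduces to extension along i.\<close>

lemma summand_pres:
  assumes pr: "pres P1 P0 T i g" and io: "mor X T io" and q: "mor T X q" and qi: "q * io = 1\<^sub>m (fst X)"
  obtains Q j where "pres Q P0 X j (q * g)" "\<And>N. extends P1 P0 i N \<Longrightarrow> extends Q P0 j N"
proof -
  note pr = presD[OF pr]
  have qg: "mor P0 X (q * g)" by (rule mor_comp[OF pr(5) q])
  obtain Q j where j: "mor Q P0 j" "injective_map j" "q * g * j = 0\<^sub>m (fst X) (fst Q)"
    "\<And>x. x \<in> carrier_vec (fst P0) \<Longrightarrow> (q * g) *\<^sub>v x = 0\<^sub>v (fst X) \<Longrightarrow> \<exists>y\<in>carrier_vec (fst Q). j *\<^sub>v y = x"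
    by (rule kernel_exists[OF qg]) (rule that; assumption)
  \<comment> \<open>The map e covers the idempotent io q of T. Thus e j lands in the image of i,
    which gives a, and 1 - e lands in the image of j, which gives b.\<close>
  obtain e where e: "mor P0 P0 e" "g * e = io * (q * g)"
    using liftingE[OF pr(2) pr(5,6) mor_comp[OF qg io]] .
  note dims = mor_dim[OF pr(3)] mor_dim[OF pr(5)] mor_dim[OF io] mor_dim[OF q] mor_dim[OF j(1)] mor_dim[OF e(1)]
  have qgj: "q * (g * j) = 0\<^sub>m (fst X) (fst Q)" using j(3) by (simp add: mat_laws dims)
  have "g * (e * j) = 0\<^sub>m (fst T) (fst Q)"
    by (simp add: mat_reassoc[OF e(2)] mat_laws dims qgj)
  then obtain a where a: "mor Q P1 a" "i * a = e * j"
    using mor_factor_exact[OF pr(3,4,8) pr(5) mor_comp[OF j(1) e(1)]] by blast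
  have "q * g * i = 0\<^sub>m (fst X) (fst P1)" by (simp add: mat_laws dims pr(7))
  then obtain k where k: "mor P1 Q k" "j * k = i"
    using mor_factor_exact[OF j(1,2,4) qg pr(3)] by blast
  have "q * g * (1\<^sub>m (fst P0) - e) = 0\<^sub>m (fst X) (fst P0)"
    by (simp add: mat_laws dims e(2) mat_reassoc[OF qi] mat_add_laws)
  then obtain b where b: "mor P0 Q b" "j * b = 1\<^sub>m (fst P0) - e"
    using mor_factor_exact[OF j(1,2,4) qg mor_minus[OF mor_id[OF mor_mod(1)[OF e(1)]] e(1)]] by blast
  note dims' = dims mor_dim[OF a(1)] mor_dim[OF k(1)] mor_dim[OF b(1)]
  \<comment> \<open>This is the sum e j + (1 - e) j.\<close>
  have "j * (k * a + b * j) = j * 1\<^sub>m (fst Q)"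
    by (simp add: mat_laws dims' mat_reassoc[OF k(2)] mat_reassoc[OF b(2)] a(2) mat_add_laws)
  then have id: "k * a + b * j = 1\<^sub>m (fst Q)"
    by (rule mor_inj_cancel[OF j(2,1) mor_add[OF mor_comp[OF a(1) k(1)] mor_comp[OF j(1) b(1)]]
          mor_id[OF mor_mod(1)[OF j(1)]]])
  have id': "h * (k * a) + h * (b * j) = h" if h: "mor Q N h" for N h
  proof -
    have "h * (k * a + b * j) = h" unfolding id by (rule mor_right_id[OF h])
    then show ?thesis by (simp add: mat_laws dims' mor_dim[OF h])
  qed
  have "lifting Q" unfolding lifting_def
  proof (intro conjI allI impI)
    show "is_mod sc Q" by (rule mor_mod[OF j(1)])
    fix V N s h assume "mor V N s \<and> surjective_map s \<and> mor Q N h"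
    then have s: "mor V N s" "surjective_map s" and h: "mor Q N h" by auto
    obtain l1 where l1: "mor P1 V l1" "s * l1 = h * k" using liftingE[OF pr(1) s mor_comp[OF k(1) h]] .
    obtain l2 where l2: "mor P0 V l2" "s * l2 = h * b" using liftingE[OF pr(2) s mor_comp[OF b(1) h]] .
    have "s * (l1 * a + l2 * j) = h"
      by (simp add: mat_laws dims' mor_dim[OF h] mor_dim[OF s(1)] mor_dim[OF l1(1)] mor_dim[OF l2(1)]
          mat_reassoc[OF l1(2)] mat_reassoc[OF l2(2)] id'[OF h])
    then show "\<exists>h'. mor Q V h' \<and> s * h' = h"
      using mor_add[OF mor_comp[OF a(1) l1(1)] mor_comp[OF j(1) l2(1)]] by blast
  qed
  moreover have "surjective_map (q * g)"
    by (rule mor_surj_comp[OF pr(6,5) right_inverse_surjective[OF qi mor_carrier[OF q] mor_carrier[OF io]] q])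
  ultimately have 1: "pres Q P0 X j (q * g)"
    unfolding pres_def using pr(2) j qg by blast
  have 2: "extends Q P0 j N" if ext: "extends P1 P0 i N" for N
    unfolding extends_def
  proof (intro allI impI)
    fix h assume h: "mor Q N h"
    obtain e1 where e1: "mor P0 N e1" "e1 * i = h * k" using extendsE[OF ext mor_comp[OF k(1) h]] .
    have "(e1 * e + h * b) * j = h"
    proof -
      have "(e1 * e + h * b) * j = e1 * (i * a) + h * (b * j)"
        by (simp add: mat_laws dims' mor_dim[OF h] mor_dim[OF e1(1)] a(2))
      also have "\<dots> = h"
        by (simp add: mat_laws dims' mor_dim[OF h] mor_dim[OF e1(1)] mat_reassoc[OF e1(2)] id'[OF h])
      finally show ?thesis .
    qed
    then show "\<exists>h'. mor P0 N h' \<and> h' * j = h"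
      using mor_add[OF mor_comp[OF e(1) e1(1)] mor_comp[OF b(1) h]] by blast
  qed
  show ?thesis using that[OF 1 2] .
qed

lemma extends_summand:
  assumes "extends Q P j T" "mor X T io" "mor T X q" "q * io = 1\<^sub>m (fst X)" "mor Q P j"
  shows "extends Q P j X"
  unfolding extends_def
proof (intro allI impI)
  fix h assume h: "mor Q X h"
  obtain h' where h': "mor P T h'" "h' * j = io * h" using extendsE[OF assms(1) mor_comp[OF h assms(2)]] .
  have "q * h' * j = h"
    by (simp add: mat_laws mor_dim[OF h'(1)] mor_dim[OF h] mor_dim[OF assms(2)] mor_dim[OF assms(3)]
        mor_dim[OF assms(5)] h'(2) mat_reassoc[OF assms(4)])
  then show "\<exists>h'. mor P X h' \<and> h' * j = h" using mor_comp[OF h'(1) assms(3)] by blast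
qed

text \<open>As Q is projective, h lifts to E, extends there and can be pushed back to N. This is the
  right exactness of Ext^1 for projective dimension at most 1.\<close>

lemma extends_quotient:
  assumes "extends Q P j E" "lifting Q" "mor E N p" "surjective_map p" "mor Q P j"
  shows "extends Q P j N"
  unfolding extends_def
proof (intro allI impI)
  fix h assume h: "mor Q N h"
  obtain l where l: "mor Q E l" "p * l = h" using liftingE[OF assms(2-4) h] .
  obtain h' where h': "mor P E h'" "h' * j = l" using extendsE[OF assms(1) l(1)] .
  have "p * h' * j = h" using mor_assoc[OF assms(5) h'(1) assms(3)] h'(2) l(2) by simp
  then show "\<exists>h'. mor P N h' \<and> h' * j = h" using mor_comp[OF h'(1) assms(3)] by blast
qed

lemma extends_dsum:
  assumes "extends Q P j M" "extends Q P j N" "is_mod sc M" "is_mod sc N" "mor Q P j"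
  shows "extends Q P j (dsum M N)"
  unfolding extends_def
proof (intro allI impI)
  note D = dsum_mor[OF assms(3,4)]
  fix h assume h: "mor Q (dsum M N) h"
  obtain a where a: "mor P M a" "a * j = proj_fst (fst M) (fst N) * h"
    using extendsE[OF assms(1) mor_comp[OF h D(3)]] .
  obtain b where b: "mor P N b" "b * j = proj_snd (fst M) (fst N) * h"
    using extendsE[OF assms(2) mor_comp[OF h D(4)]] .
  have "(inj_fst (fst M) (fst N) * proj_fst (fst M) (fst N) + inj_snd (fst M) (fst N) * proj_snd (fst M) (fst N)) * h = h"
    unfolding block_identities using mor_left_id[OF h] by (simp add: dsum_simps)
  then have "(inj_fst (fst M) (fst N) * a + inj_snd (fst M) (fst N) * b) * j = h"
    by (simp add: mat_laws mor_dim[OF h] mor_dim[OF a(1)] mor_dim[OF b(1)] mor_dim[OF assms(5)] a(2) b(2) dsum_simps)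
  then show "\<exists>h'. mor P (dsum M N) h' \<and> h' * j = h"
    using mor_add[OF mor_comp[OF a(1) D(1)] mor_comp[OF b(1) D(2)]] by blast
qed

end

subsection \<open>Indecomposable modules\<close>

lemma surjective_map_dim_le:
  fixes g :: "'k::field mat"
  assumes "surjective_map g" "g \<in> carrier_mat m n"
  shows "m \<le> n"
proof -
  obtain s where s: "s \<in> carrier_mat n m" "g * s = 1\<^sub>m m" using surjective_map_right_inverse[OF assms] .
  show ?thesis by (rule injective_map_dim_le[OF left_inverse_injective[OF s(2) assms(2) s(1)] s(1)])
qed

lemma mult_mat_through_0:
  fixes A B :: "'k::field mat"
  assumes "A \<in> carrier_mat m 0" "B \<in> carrier_mat 0 n"
  shows "A * B = 0\<^sub>m m n"
  using assms by (intro eq_matI) (auto simp: scalar_prod_def)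

lemma pow_mat_add:
  fixes A :: "'k::field mat"
  assumes "A \<in> carrier_mat n n"
  shows "A ^\<^sub>m (k + l) = A ^\<^sub>m k * A ^\<^sub>m l"
proof (induction l)
  case 0
  then show ?case using assms by simp
next
  case (Suc l)
  then show ?case
    using assoc_mult_mat[OF pow_carrier_mat[OF assms] pow_carrier_mat[OF assms] assms] by simp
qed

lemma pow_mat_fixed:
  fixes A :: "'k::field mat"
  assumes "A \<in> carrier_mat n n" "x \<in> carrier_vec n" "A *\<^sub>v x = x"
  shows "A ^\<^sub>m k *\<^sub>v x = x"
proof (induction k)
  case 0
  then show ?case using assms by simp
next
  case (Suc k)
  then show ?case
    using assoc_mult_mat_vec[OF pow_carrier_mat[OF assms(1)] assms(1,2)] assms(3) by simp
qed

text \<open>For l \<ge> n, where there is no summand l, the recursion yields the zero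
  matrix.\<close>

fun bigsum_inj :: "(nat \<Rightarrow> ('a, 'k::field) amod) \<Rightarrow> nat \<Rightarrow> nat \<Rightarrow> 'k mat" where
  "bigsum_inj Z 0 l = 0\<^sub>m 0 (fst (Z l))"
| "bigsum_inj Z (Suc n) l = (if l = n then inj_snd (fst (bigsum Z n)) (fst (Z n))
    else inj_fst (fst (bigsum Z n)) (fst (Z n)) * bigsum_inj Z n l)"

fun bigsum_proj :: "(nat \<Rightarrow> ('a, 'k::field) amod) \<Rightarrow> nat \<Rightarrow> nat \<Rightarrow> 'k mat" where
  "bigsum_proj Z 0 l = 0\<^sub>m (fst (Z l)) 0"
| "bigsum_proj Z (Suc n) l = (if l = n then proj_snd (fst (bigsum Z n)) (fst (Z n))
    else bigsum_proj Z n l * proj_fst (fst (bigsum Z n)) (fst (Z n)))"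

lemma bigsum_cong: "(\<And>l. l < n \<Longrightarrow> Z l = Z' l) \<Longrightarrow> bigsum Z n = bigsum Z' n"
  by (induction n) auto

lemma bigsum_inj_cong: "(\<And>l. l < n \<Longrightarrow> Z l = Z' l) \<Longrightarrow> k < n \<Longrightarrow> bigsum_inj Z n k = bigsum_inj Z' n k"
proof (induction n)
  case (Suc n)
  then show ?case using bigsum_cong[of n Z Z'] by (cases "k = n") auto
qed simp

context matrix_modules
begin

section \<open>Isomorphisms\<close>

definition miso :: "('a, 'k) amod \<Rightarrow> ('a, 'k) amod \<Rightarrow> 'k mat \<Rightarrow> bool" where
  "miso M N h \<longleftrightarrow> mor M N h \<and> (\<exists>t. mor N M t \<and> t * h = 1\<^sub>m (fst M) \<and> h * t = 1\<^sub>m (fst N))"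

lemma miso_mor: "miso M N h \<Longrightarrow> mor M N h"
  unfolding miso_def by blast

lemma misoE:
  assumes "miso M N h"
  obtains t where "mor N M t" "t * h = 1\<^sub>m (fst M)" "h * t = 1\<^sub>m (fst N)" "miso N M t"
  using assms unfolding miso_def by blast

lemma misoI: "mor M N h \<Longrightarrow> mor N M t \<Longrightarrow> t * h = 1\<^sub>m (fst M) \<Longrightarrow> h * t = 1\<^sub>m (fst N) \<Longrightarrow> miso M N h"
  unfolding miso_def by blast

lemma miso_iso: "miso M N h \<Longrightarrow> iso M N"
  unfolding miso_def iso_def mor_def by blast

lemma iso_miso:
  assumes "iso M N" "is_mod sc M" "is_mod sc N"
  obtains h where "miso M N h"
  using assms unfolding miso_def iso_def mor_def by blast

lemma miso_comp:
  assumes "miso M N f" "miso N L g"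
  shows "miso M L (g * f)"
proof -
  obtain s where s: "mor N M s" "s * f = 1\<^sub>m (fst M)" "f * s = 1\<^sub>m (fst N)" using misoE[OF assms(1)] by blast
  obtain t where t: "mor L N t" "t * g = 1\<^sub>m (fst N)" "g * t = 1\<^sub>m (fst L)" using misoE[OF assms(2)] by blast
  note f = miso_mor[OF assms(1)] and g = miso_mor[OF assms(2)]
  note d = mor_dim[OF f] mor_dim[OF g] mor_dim[OF s(1)] mor_dim[OF t(1)]
  show ?thesis
    by (rule misoI[OF mor_comp[OF f g] mor_comp[OF t(1) s(1)]])
      (simp_all add: mat_laws d mat_reassoc[OF s(2)] mat_reassoc[OF s(3)] mat_reassoc[OF t(2)] mat_reassoc[OF t(3)] s t)
qed

lemma miso_inj: "miso M N h \<Longrightarrow> injective_map h"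
  using left_inverse_injective[OF _ mor_carrier mor_carrier] miso_def by blast

lemma miso_fst: "miso M N h \<Longrightarrow> fst M = fst N"
  using injective_map_dim_le[OF miso_inj mor_carrier[OF miso_mor]] misoE le_antisym by metis

text \<open>Between modules of equal dimension injectivity suffices; the inverse matrix commutes
  with the action because h does.\<close>

lemma square_miso:
  assumes h: "mor M N h" and inj: "injective_map h" and eq: "fst M = fst N"
  shows "miso M N h"
proof -
  note hc = mor_carrier[OF h]
  obtain t where t: "t \<in> carrier_mat (fst N) (fst N)" "t * h = 1\<^sub>m (fst N)" "h * t = 1\<^sub>m (fst N)"
    by (rule injective_map_square_inverse[OF inj, of "fst N"]) (use hc eq in auto)
  have "mor N M t"
  proof (rule morI[OF mor_mod(2,1)[OF h]])
    show "t \<in> carrier_mat (fst M) (fst N)" using t(1) eq by simp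
    fix a
    have d: "dim_row (snd M a) = fst M" "dim_col (snd M a) = fst M" "dim_row (snd N a) = fst N"
      "dim_col (snd N a) = fst N" "dim_row t = fst N" "dim_col t = fst N" "dim_row h = fst N" "dim_col h = fst M"
      using mod_carrier[OF mor_mod(1)[OF h], of a] mod_carrier[OF mor_mod(2)[OF h], of a] t(1) hc by auto
    have "t * snd N a = t * (snd N a * h) * t"
      using t(3) by (simp add: mat_laws d eq)
    also have "\<dots> = snd M a * t"
      unfolding mor_act[OF h, symmetric] by (simp add: mat_laws d eq mat_reassoc[OF t(2)])
    finally show "t * snd N a = snd M a * t" .
  qed
  then show ?thesis using misoI[OF h _ _ t(3)] t(2) eq by simp
qed

text \<open>The map factors through its image, which is strictly smaller than M: at equal dimension
  the surjection p, and with it f, would be injective. The strict drop contradicts minimality in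
  \<open>fitting\<close>.\<close>

lemma noninjective_factor:
  assumes f: "mor M N f" and ni: "\<not> injective_map f"
  obtains U u p where "mor U N u" "mor M U p" "u * p = f" "fst U < fst M"
proof -
  obtain U u p where *: "mor U N u" "injective_map u" "mor M U p" "surjective_map p" "u * p = f"
    using image_exists[OF f] .
  have le: "fst U \<le> fst M" by (rule surjective_map_dim_le[OF *(4) mor_carrier[OF *(3)]])
  have "fst U \<noteq> fst M"
  proof
    assume e: "fst U = fst M"
    have "injective_map p" by (rule surjective_map_square_injective[OF *(4)]) (use mor_carrier[OF *(3)] e in auto)
    then show False using mor_inj_comp[OF _ *(3) *(2,1)] *(5) ni by simp
  qed
  then show ?thesis using that[OF *(1,3,5)] le by simp
qed

section \<open>Retracts of indecomposables, Fitting's lemma and locality\<close>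

lemma indec_mod: "indecomposable sc M \<Longrightarrow> is_mod sc M" "indecomposable sc M \<Longrightarrow> 0 < fst M"
  unfolding indecomposable_def by auto

text \<open>The complement C is the kernel of q, since 1 - w q projects M onto it. If C is zero then
  so is 1 - w q, which makes w and q mutually inverse.\<close>

lemma retract_complement:
  assumes w: "mor W M w" and q: "mor M W q" and qw: "q * w = 1\<^sub>m (fst W)"
  obtains C where "is_mod sc C" "iso M (dsum W C)" "fst C = 0 \<Longrightarrow> w * q = 1\<^sub>m (fst M)"
proof -
  obtain C c where c: "mor C M c" "injective_map c" "q * c = 0\<^sub>m (fst W) (fst C)"
    "\<And>x. x \<in> carrier_vec (fst M) \<Longrightarrow> q *\<^sub>v x = 0\<^sub>v (fst W) \<Longrightarrow> \<exists>y\<in>carrier_vec (fst C). c *\<^sub>v y = x"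
    by (rule kernel_exists[OF q]) (rule that; assumption)
  note dims = mor_dim[OF w] mor_dim[OF q] mor_dim[OF c(1)]
  have k: "mor M M (1\<^sub>m (fst M) - w * q)" by (rule mor_minus[OF mor_id[OF mor_mod(2)[OF w]] mor_comp[OF q w]])
  have "q * (1\<^sub>m (fst M) - w * q) = 0\<^sub>m (fst W) (fst M)"
    by (simp add: mat_laws dims mat_reassoc[OF qw] mat_add_laws)
  then obtain r where r: "mor M C r" "c * r = 1\<^sub>m (fst M) - w * q"
    using mor_factor_exact[OF c(1,2,4) q k] by blast
  note dims' = dims mor_dim[OF r(1)] dsum_simps(1)
  have cr: "c * (r * w) = c * 0\<^sub>m (fst C) (fst W)"
    by (simp add: mat_reassoc[OF r(2)] mat_laws dims' qw mat_add_laws)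
  have rw: "r * w = 0\<^sub>m (fst C) (fst W)"
    by (rule mor_inj_cancel[OF c(2,1) mor_comp[OF w r(1)] mor_zero[OF mor_mod(1)[OF w] mor_mod(1)[OF c(1)]] cr])
  have cr': "c * (r * c) = c * 1\<^sub>m (fst C)"
    by (simp add: mat_reassoc[OF r(2)] mat_laws dims' c(3) mat_add_laws)
  have rc: "r * c = 1\<^sub>m (fst C)"
    by (rule mor_inj_cancel[OF c(2,1) mor_comp[OF c(1) r(1)] mor_id[OF mor_mod(1)[OF c(1)]] cr'])
  note D = dsum_mor'[OF w c(1)]
  define f where "f = inj_fst (fst W) (fst C) * q + inj_snd (fst W) (fst C) * r"
  define g where "g = hcat (fst W) (fst C) w c"
  have f: "mor M (dsum W C) f" unfolding f_def by (rule mor_add[OF mor_comp[OF q D(1)] mor_comp[OF r(1) D(2)]])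
  have g: "mor (dsum W C) M g" unfolding g_def by (rule hcat_mor[OF w c(1)])
  have gi: "g * inj_fst (fst W) (fst C) = w" "g * inj_snd (fst W) (fst C) = c"
    unfolding g_def using hcat_inj[OF mor_carrier[OF w] mor_carrier[OF c(1)]] by auto
  have gf: "g * f = 1\<^sub>m (fst M)"
    unfolding f_def
    by (simp add: mat_laws dims' mor_dim[OF g] mat_reassoc[OF gi(1)] mat_reassoc[OF gi(2)] r(2) mat_add_laws)
  have "f * g = inj_fst (fst W) (fst C) * proj_fst (fst W) (fst C) + inj_snd (fst W) (fst C) * proj_snd (fst W) (fst C)"
    unfolding f_def g_def hcat_def
    by (simp add: mat_laws dims' mat_reassoc[OF qw] mat_reassoc[OF c(3)] mat_reassoc[OF rw] mat_reassoc[OF rc] mat_add_laws)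
  then have fg: "f * g = 1\<^sub>m (fst (dsum W C))" unfolding block_identities by (simp add: dsum_simps)
  have wq: "w * q = 1\<^sub>m (fst M)" if "fst C = 0"
  proof -
    have "c * r = 0\<^sub>m (fst M) (fst M)"
      using mult_mat_through_0 mor_carrier[OF c(1)] mor_carrier[OF r(1)] that by metis
    then have "1\<^sub>m (fst M) - w * q = 0\<^sub>m (fst M) (fst M)" using r(2) by simp
    then show ?thesis using mat_add_laws(6)[of "1\<^sub>m (fst M) :: 'k mat" "fst M" "fst M" "w * q"] dims by simp
  qed
  show ?thesis by (rule that[OF mor_mod(1)[OF c(1)] miso_iso[OF misoI[OF f g gf fg]] wq])
qed

lemma indec_retract:
  assumes M: "indecomposable sc M" and w: "mor W M w" and q: "mor M W q"
    and qw: "q * w = 1\<^sub>m (fst W)" and W: "0 < fst W"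
  shows "w * q = 1\<^sub>m (fst M)"
proof -
  obtain C where C: "is_mod sc C" "iso M (dsum W C)" "fst C = 0 \<Longrightarrow> w * q = 1\<^sub>m (fst M)"
    by (rule retract_complement[OF w q qw]) (rule that; assumption)
  have dec: "is_mod sc W \<and> is_mod sc C \<and> fst W > 0 \<and> fst C > 0 \<and> iso M (dsum W C)" if "fst C > 0"
    using that W mor_mod(1)[OF w] C(1,2) by simp
  have "\<not> (\<exists>U V. is_mod sc U \<and> is_mod sc V \<and> fst U > 0 \<and> fst V > 0 \<and> iso M (dsum U V))"
    using M by (simp only: indecomposable_def not_False_eq_True simp_thms)
  then have "\<not> fst C > 0" using dec by metis
  then show ?thesis using C(3) by simp
qed

text \<open>Correcting q by the inverse t of q w turns it into a genuine retraction t q of w, and a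
  nonzero retract of an indecomposable module is all of it.\<close>

lemma indec_retract_miso:
  assumes N: "indecomposable sc N" and M: "0 < fst M" and w: "mor M N w" and q: "mor N M q"
    and qw: "miso M M (q * w)"
  shows "miso M N w" "miso N M q"
proof -
  obtain t where t: "mor M M t" "t * (q * w) = 1\<^sub>m (fst M)" "q * w * t = 1\<^sub>m (fst M)" using misoE[OF qw] by blast
  note dims = mor_dim[OF w] mor_dim[OF q] mor_dim[OF t(1)]
  have 1: "t * q * w = 1\<^sub>m (fst M)" using mor_assoc[OF w q t(1)] t(2) by simp
  have 2: "w * (t * q) = 1\<^sub>m (fst N)"
    by (rule indec_retract[OF N w mor_comp[OF q t(1)] 1 M])
  show "miso M N w" by (rule misoI[OF w mor_comp[OF q t(1)] 1 2])
  show "miso N M q"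
    by (rule misoI[OF q mor_comp[OF t(1) w]]) (use t(3) 2 in \<open>simp_all add: mat_laws dims\<close>)
qed

text \<open>Among all modules W through which some power of h factors, one of least dimension is
  taken. Minimality makes p w an automorphism of W, so W is zero or isomorphic to M. The latter is
  impossible, since h is not injective and factors through its smaller image.\<close>

lemma fitting:
  assumes M: "indecomposable sc M" and h: "mor M M h" and ni: "\<not> miso M M h"
  obtains k where "h ^\<^sub>m k = 0\<^sub>m (fst M) (fst M)"
proof -
  define S where "S r \<longleftrightarrow> (\<exists>W w p k. fst W = r \<and> mor W M w \<and> mor M W p \<and> w * p = h ^\<^sub>m k)" for r
  have h1: "1\<^sub>m (fst M) * h = h ^\<^sub>m 1" using mor_dim[OF h] by simp
  have "S (fst M)" unfolding S_def
    using mor_id[OF indec_mod(1)[OF M]] h h1 by blast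
  then obtain r where r: "S r" "\<And>r'. S r' \<Longrightarrow> r \<le> r'" by (metis LeastI Least_le)
  obtain W w p k where W: "fst W = r" "mor W M w" "mor M W p" "w * p = h ^\<^sub>m k" using r(1) unfolding S_def by blast
  have pw: "mor W W (p * w)" by (rule mor_comp[OF W(2,3)])
  \<comment> \<open>If p w were not injective it would factor through a smaller U, and so would w (p
    w) p, the square of the given power of h.\<close>
  have "injective_map (p * w)"
  proof (rule ccontr)
    assume "\<not> injective_map (p * w)"
    then obtain U u s where U: "mor U W u" "mor W U s" "u * s = p * w" "fst U < fst W"
      using noninjective_factor[OF pw] by blast
    note dims = mor_dim[OF W(2)] mor_dim[OF W(3)] mor_dim[OF U(1)] mor_dim[OF U(2)]
    have "w * u * (s * p) = h ^\<^sub>m k * h ^\<^sub>m k"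
      unfolding W(4)[symmetric] by (simp add: mat_laws dims mat_reassoc[OF U(3)])
    then have "S (fst U)" unfolding S_def pow_mat_add[OF mor_carrier[OF h], symmetric]
      using mor_comp[OF U(1) W(2)] mor_comp[OF W(3) U(2)] by blast
    then show False using r(2) U(4) W(1) by fastforce
  qed
  then have "miso W W (p * w)" by (rule square_miso[OF pw _ refl])
  then have "miso W M w" if "0 < fst W" by (rule indec_retract_miso(1)[OF M that W(2,3)])
  then have "fst W = fst M" if "0 < fst W" using that miso_fst by blast
  moreover have "fst W \<noteq> fst M"
  proof
    assume e: "fst W = fst M"
    have "\<not> injective_map h" using square_miso[OF h] ni by blast
    then obtain U u s where U: "mor U M u" "mor M U s" "u * s = h" "fst U < fst M"
      using noninjective_factor[OF h] by blast
    have "u * s = h ^\<^sub>m 1" using U(3) h1 mor_left_id[OF h] by simp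
    then have "S (fst U)" unfolding S_def using U(1,2) by blast
    then show False using r(2) U(4) W(1) e by fastforce
  qed
  ultimately have "fst W = 0" by blast
  then have "h ^\<^sub>m k = 0\<^sub>m (fst M) (fst M)"
    using mult_mat_through_0 mor_carrier[OF W(2)] mor_carrier[OF W(3)] W(4) by metis
  then show ?thesis by (rule that)
qed

text \<open>Endomorphism rings of indecomposables are local. After normalizing the sum to 1, suppose
  t a is not invertible. It is then nilpotent by \<open>fitting\<close>; a vector killed by t b is
  fixed by t a, hence zero, so t b is invertible.\<close>

lemma indec_local:
  assumes M: "indecomposable sc M" and a: "mor M M a" and b: "mor M M b" and ab: "miso M M (a + b)"
  shows "miso M M a \<or> miso M M b"
proof -
  obtain t where t: "mor M M t" "t * (a + b) = 1\<^sub>m (fst M)" "(a + b) * t = 1\<^sub>m (fst M)" using misoE[OF ab] by blast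
  note ta = mor_comp[OF a t(1)] and tb = mor_comp[OF b t(1)]
  \<comment> \<open>The map c is recovered from t c by composing with the automorphism a +
    b.\<close>
  have untwist: "miso M M c" if c: "mor M M c" "miso M M (t * c)" for c
  proof -
    have "(a + b) * (t * c) = c"
      using mor_assoc[OF c(1) t(1) miso_mor[OF ab]] t(3) mor_left_id[OF c(1)] by simp
    then show ?thesis using miso_comp[OF c(2) ab] by simp
  qed
  have sum: "t * a + t * b = 1\<^sub>m (fst M)" using t(2) mor_add_comp[OF a b t(1)] by simp
  show ?thesis
  proof (cases "miso M M (t * a)")
    case True
    then show ?thesis using untwist[OF a] by blast
  next
    case False
    then obtain k where k: "(t * a) ^\<^sub>m k = 0\<^sub>m (fst M) (fst M)" using fitting[OF M ta] by blast
    have "injective_map (t * b)"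
    proof (rule injective_mapI[OF mor_carrier[OF tb]])
      fix x :: "'k vec" assume x: "x \<in> carrier_vec (fst M)" "(t * b) *\<^sub>v x = 0\<^sub>v (fst M)"
      have "(t * a + t * b) *\<^sub>v x = (t * a) *\<^sub>v x + (t * b) *\<^sub>v x"
        by (rule add_mult_distrib_mat_vec[OF mor_carrier[OF ta] mor_carrier[OF tb] x(1)])
      then have "(t * a) *\<^sub>v x = x" unfolding sum x(2) using x(1) mor_vec[OF ta x(1)] by simp
      then have "(t * a) ^\<^sub>m k *\<^sub>v x = x" by (rule pow_mat_fixed[OF mor_carrier[OF ta] x(1)])
      then show "x = 0\<^sub>v (fst M)" unfolding k using x(1) by simp
    qed
    then have "miso M M (t * b)" by (rule square_miso[OF tb _ refl])
    then show ?thesis using untwist[OF b] by blast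
  qed
qed

section \<open>Finite direct sums and Krull-Schmidt\<close>

lemma bigsum_mod: "(\<And>l. l < n \<Longrightarrow> is_mod sc (Z l)) \<Longrightarrow> is_mod sc (bigsum Z n)"
proof (induction n)
  case 0
  show ?case by (auto simp: is_mod_def intro!: eq_matI)
next
  case (Suc n)
  then show ?case using dsum_mod by simp
qed

lemma bigsum_mor:
  assumes "\<And>l. l < n \<Longrightarrow> is_mod sc (Z l)" "l < n"
  shows "mor (Z l) (bigsum Z n) (bigsum_inj Z n l)" "mor (bigsum Z n) (Z l) (bigsum_proj Z n l)"
    "bigsum_proj Z n l * bigsum_inj Z n l = 1\<^sub>m (fst (Z l))"
proof -
  have "mor (Z l) (bigsum Z n) (bigsum_inj Z n l) \<and> mor (bigsum Z n) (Z l) (bigsum_proj Z n l) \<and>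
    bigsum_proj Z n l * bigsum_inj Z n l = 1\<^sub>m (fst (Z l))"
    using assms
  proof (induction n)
    case (Suc n)
    note D = dsum_mor[OF bigsum_mod[of n Z] Suc.prems(1)[of n]]
    show ?case
    proof (cases "l = n")
      case True
      then show ?thesis using D Suc.prems(1) by (simp add: block_identities)
    next
      case False
      then have IH: "mor (Z l) (bigsum Z n) (bigsum_inj Z n l)" "mor (bigsum Z n) (Z l) (bigsum_proj Z n l)"
        "bigsum_proj Z n l * bigsum_inj Z n l = 1\<^sub>m (fst (Z l))"
        using Suc by auto
      have "bigsum_proj Z n l * proj_fst (fst (bigsum Z n)) (fst (Z n)) *
        (inj_fst (fst (bigsum Z n)) (fst (Z n)) * bigsum_inj Z n l) = 1\<^sub>m (fst (Z l))"
        by (simp add: mat_laws mor_dim[OF IH(1)] mor_dim[OF IH(2)] mat_reassoc[OF block_identities(1)] IH(3))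
      then show ?thesis using False mor_comp[OF IH(1) D(1)] mor_comp[OF D(3) IH(2)] Suc.prems(1) by simp
    qed
  qed simp
  then show "mor (Z l) (bigsum Z n) (bigsum_inj Z n l)" "mor (bigsum Z n) (Z l) (bigsum_proj Z n l)"
    "bigsum_proj Z n l * bigsum_inj Z n l = 1\<^sub>m (fst (Z l))" by auto
qed

text \<open>The composite f g is the sum of its components through the single summands; locality,
  applied to one summand at a time, finds an invertible one. For n = 0 the identity of the nonzero
  module M would vanish.\<close>

lemma miso_through_bigsum:
  assumes M: "indecomposable sc M" and Z: "\<And>l. l < n \<Longrightarrow> is_mod sc (Z l)"
    and g: "mor M (bigsum Z n) g" and f: "mor (bigsum Z n) M f" and fg: "miso M M (f * g)"
  shows "\<exists>l<n. miso M M ((f * bigsum_inj Z n l) * (bigsum_proj Z n l * g))"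
  using Z g f fg
proof (induction n arbitrary: f g)
  case 0
  have z: "f * g = 0\<^sub>m (fst M) (fst M)"
    using mult_mat_through_0 mor_carrier[OF "0.prems"(2)] mor_carrier[OF "0.prems"(3)] by simp
  obtain t where t: "mor M M t" "t * (f * g) = 1\<^sub>m (fst M)" using misoE[OF "0.prems"(4)] by blast
  have "(1\<^sub>m (fst M) :: 'k mat) = 0\<^sub>m (fst M) (fst M)" using t(2) mor_dim[OF t(1)] unfolding z by simp
  moreover have "(1\<^sub>m (fst M) :: 'k mat) $$ (0, 0) = 1" "(0\<^sub>m (fst M) (fst M) :: 'k mat) $$ (0, 0) = 0"
    using indec_mod(2)[OF M] by simp_all
  ultimately show ?case by simp
next
  case (Suc n)
  let ?B = "bigsum Z n"
  have B: "is_mod sc ?B" "is_mod sc (Z n)" using bigsum_mod Suc.prems(1) by auto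
  note D = dsum_mor[OF B]
  have g: "mor M (dsum ?B (Z n)) g" and f: "mor (dsum ?B (Z n)) M f" using Suc.prems(2,3) by auto
  let ?i1 = "inj_fst (fst ?B) (fst (Z n)) :: 'k mat" and ?i2 = "inj_snd (fst ?B) (fst (Z n)) :: 'k mat"
  let ?p1 = "proj_fst (fst ?B) (fst (Z n)) :: 'k mat" and ?p2 = "proj_snd (fst ?B) (fst (Z n)) :: 'k mat"
  note dims = mor_dim[OF f] mor_dim[OF g] dsum_simps(1)
  have "f * ((?i1 * ?p1 + ?i2 * ?p2) * g) = f * g"
    unfolding block_identities by (simp add: dims)
  then have "(f * ?i1) * (?p1 * g) + (f * ?i2) * (?p2 * g) = f * g"
    by (simp add: mat_laws dims)
  then have "miso M M ((f * ?i1) * (?p1 * g)) \<or> miso M M ((f * ?i2) * (?p2 * g))"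
    using indec_local[OF M mor_comp[OF mor_comp[OF g D(3)] mor_comp[OF D(1) f]]
        mor_comp[OF mor_comp[OF g D(4)] mor_comp[OF D(2) f]]] Suc.prems(4) by simp
  then show ?case
  proof
    assume "miso M M ((f * ?i2) * (?p2 * g))"
    then show ?thesis by (intro exI[of _ n]) simp
  next
    assume "miso M M ((f * ?i1) * (?p1 * g))"
    then obtain l where l: "l < n" "miso M M ((f * ?i1 * bigsum_inj Z n l) * (bigsum_proj Z n l * (?p1 * g)))"
      using Suc.IH[OF _ mor_comp[OF g D(3)] mor_comp[OF D(1) f]] Suc.prems(1) by auto
    note b = bigsum_mor[of n Z, OF Suc.prems(1) l(1)]
    have "f * ?i1 * bigsum_inj Z n l = f * (?i1 * bigsum_inj Z n l)"
      "bigsum_proj Z n l * (?p1 * g) = bigsum_proj Z n l * ?p1 * g"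
      using mor_dim[OF b(1)] mor_dim[OF b(2)] by (simp_all add: mat_laws dims)
    then show ?thesis using l by (intro exI[of _ l]) simp
  qed
qed

text \<open>The identity of M factors through the sum of the Z l, hence by locality an automorphism
  of M factors through a single Z l. As Z l is indecomposable, its retract M is all of it.\<close>

lemma krull_schmidt_summand:
  assumes M: "indecomposable sc M" and Z: "\<And>l. l < n \<Longrightarrow> indecomposable sc (Z l)"
    and ds: "direct_summand sc M (bigsum Z n)"
  shows "\<exists>l<n. iso M (Z l)"
proof -
  obtain C where C: "is_mod sc C" "iso (bigsum Z n) (dsum M C)" using ds unfolding direct_summand_def by blast
  note Zm = indec_mod(1)[OF Z]
  obtain h where "miso (bigsum Z n) (dsum M C) h"
    using iso_miso[OF C(2) bigsum_mod[OF Zm] dsum_mod[OF indec_mod(1)[OF M] C(1)]] by blast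
  then obtain t where h: "mor (bigsum Z n) (dsum M C) h" and t: "mor (dsum M C) (bigsum Z n) t"
    "h * t = 1\<^sub>m (fst (dsum M C))" unfolding miso_def by blast
  note D = dsum_mor[OF indec_mod(1)[OF M] C(1)]
  have "(proj_fst (fst M) (fst C) * h) * (t * inj_fst (fst M) (fst C)) = 1\<^sub>m (fst M)"
    by (simp add: mat_laws mor_dim[OF h] mor_dim[OF t(1)] mat_reassoc[OF t(2)] dsum_simps block_identities)
  then have "miso M M ((proj_fst (fst M) (fst C) * h) * (t * inj_fst (fst M) (fst C)))"
    using misoI[OF mor_id mor_id] indec_mod(1)[OF M] by simp
  then obtain l where l: "l < n" "miso M M ((proj_fst (fst M) (fst C) * h * bigsum_inj Z n l) *
      (bigsum_proj Z n l * (t * inj_fst (fst M) (fst C))))"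
    using miso_through_bigsum[OF M Zm mor_comp[OF D(1) t(1)] mor_comp[OF h D(3)]] by blast
  note b = bigsum_mor[of n Z, OF Zm l(1)]
  have "miso M (Z l) (bigsum_proj Z n l * (t * inj_fst (fst M) (fst C)))"
    by (rule indec_retract_miso(1)[OF Z[OF l(1)] indec_mod(2)[OF M] mor_comp[OF mor_comp[OF D(1) t(1)] b(2)]
          mor_comp[OF b(1) mor_comp[OF h D(3)]] l(2)])
  then show ?thesis using l(1) miso_iso by blast
qed

lemma extends_bigsum:
  assumes "\<And>l. l < n \<Longrightarrow> is_mod sc (Z l)" "\<And>l. l < n \<Longrightarrow> extends Q P j (Z l)" "mor Q P j"
  shows "extends Q P j (bigsum Z n)"
  using assms
proof (induction n)
  case 0
  have B: "is_mod sc (bigsum Z 0)" by (rule bigsum_mod) simp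
  show ?case unfolding extends_def
  proof (intro allI impI)
    fix h assume h: "mor Q (bigsum Z 0) h"
    have "0\<^sub>m 0 (fst P) * j = h" using mor_dim[OF h] mor_dim[OF assms(3)] by (intro eq_matI) auto
    then show "\<exists>h'. mor P (bigsum Z 0) h' \<and> h' * j = h"
      using mor_zero[OF mor_mod(2)[OF assms(3)] B] by auto
  qed
next
  case (Suc n)
  then show ?case using extends_dsum[of Q P j "bigsum Z n" "Z n"] bigsum_mod[of n Z] by simp
qed

end

subsection \<open>Dimensions of Hom spaces\<close>

text \<open>Matrices of a fixed format do not form a type, so they are embedded into the vector space
  of functions on pairs of indices.\<close>

definition flat :: "'k::field mat \<Rightarrow> nat \<times> nat \<Rightarrow> 'k" where
  "flat A = (\<lambda>(i, j). if i < dim_row A \<and> j < dim_col A then A $$ (i, j) else 0)"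

definition fscale :: "'k::field \<Rightarrow> (nat \<times> nat \<Rightarrow> 'k) \<Rightarrow> nat \<times> nat \<Rightarrow> 'k" where
  "fscale c F = (\<lambda>x. c * F x)"

interpretation mv: vector_space fscale
  by unfold_locales (auto simp: fscale_def fun_eq_iff algebra_simps)

lemma mat_flat: "A \<in> carrier_mat r c \<Longrightarrow> mat r c (flat A) = A"
  by (rule eq_matI) (auto simp: flat_def)

lemma flat_add: "A \<in> carrier_mat r c \<Longrightarrow> B \<in> carrier_mat r c \<Longrightarrow> flat (A + B) = flat A + flat B"
  by (auto simp: flat_def fun_eq_iff)

lemma flat_smult: "flat (c \<cdot>\<^sub>m A) = fscale c (flat A)"
  by (auto simp: flat_def fscale_def fun_eq_iff)

lemma flat_zero: "flat (0\<^sub>m r c) = 0"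
  by (auto simp: flat_def fun_eq_iff)

lemma sum_fun_at: "(\<Sum>p\<in>I. f p) x = (\<Sum>p\<in>I. f p x)" for f :: "'b \<Rightarrow> 'c \<Rightarrow> 'd::comm_monoid_add"
  by (induction I rule: infinite_finite_induct) auto

lemma flat_span:
  obtains T where "finite T" "\<And>A. A \<in> carrier_mat r c \<Longrightarrow> flat A \<in> mv.span T"
proof -
  define e :: "nat \<times> nat \<Rightarrow> nat \<times> nat \<Rightarrow> 'a" where "e = (\<lambda>p x. if x = p then 1 else 0)"
  let ?I = "{..<r} \<times> {..<c}"
  have "flat A \<in> mv.span (e ` ?I)" if A: "A \<in> carrier_mat r c" for A
  proof -
    have "flat A = (\<Sum>p\<in>?I. fscale (flat A p) (e p))"
    proof
      fix x
      have "(\<Sum>p\<in>?I. fscale (flat A p) (e p)) x = (\<Sum>p\<in>?I. if x = p then flat A p else 0)"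
        unfolding sum_fun_at by (rule sum.cong) (auto simp: fscale_def e_def)
      also have "\<dots> = flat A x" using A by (auto simp: flat_def split: prod.splits)
      finally show "flat A x = (\<Sum>p\<in>?I. fscale (flat A p) (e p)) x" by simp
    qed
    also have "\<dots> \<in> mv.span (e ` ?I)" by (intro mv.span_sum mv.span_scale mv.span_base imageI)
    finally show ?thesis .
  qed
  then show ?thesis using that[of "e ` ?I"] by simp
qed

definition mdim :: "'k::field mat set \<Rightarrow> nat" where
  "mdim S = mv.dim (flat ` S)"

definition msub :: "nat \<Rightarrow> nat \<Rightarrow> 'k::field mat set \<Rightarrow> bool" where
  "msub r c S \<longleftrightarrow> S \<subseteq> carrier_mat r c \<and> 0\<^sub>m r c \<in> S \<and> (\<forall>A\<in>S. \<forall>B\<in>S. A + B \<in> S) \<and>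
     (\<forall>a. \<forall>A\<in>S. a \<cdot>\<^sub>m A \<in> S)"

lemma msub_subspace:
  assumes "msub r c S"
  shows "mv.subspace (flat ` S)"
  unfolding mv.subspace_def
proof (intro conjI ballI allI)
  have S: "S \<subseteq> carrier_mat r c" "0\<^sub>m r c \<in> S" "\<And>A B. A \<in> S \<Longrightarrow> B \<in> S \<Longrightarrow> A + B \<in> S"
    "\<And>a A. A \<in> S \<Longrightarrow> a \<cdot>\<^sub>m A \<in> S" using assms unfolding msub_def by auto
  show "0 \<in> flat ` S" using S(2) flat_zero by (metis imageI)
  fix F assume "F \<in> flat ` S"
  then obtain A where A: "A \<in> S" "F = flat A" by blast
  show "fscale a F \<in> flat ` S" for a using S(4)[OF A(1)] A(2) flat_smult by (metis imageI)
  fix G assume "G \<in> flat ` S"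
  then obtain B where B: "B \<in> S" "G = flat B" by blast
  show "F + G \<in> flat ` S" using S(3)[OF A(1) B(1)] flat_add[of A r c B] S(1) A B by (metis imageI subsetD)
qed

lemma flat_mem:
  assumes "A \<in> carrier_mat r c" "S \<subseteq> carrier_mat r c" "flat A \<in> flat ` S"
  shows "A \<in> S"
proof -
  obtain B where B: "B \<in> S" "flat A = flat B" using assms(3) by blast
  have "A = B" using mat_flat[OF assms(1)] mat_flat[of B r c] B assms(2) by auto
  then show ?thesis using B by simp
qed

lemma mdim_mono:
  fixes S :: "'a::field mat set"
  assumes "S \<subseteq> S'" "S' \<subseteq> carrier_mat r c"
  shows "mdim S \<le> mdim S'"
proof -
  obtain T :: "(nat \<times> nat \<Rightarrow> 'a) set"
    where T: "finite T" "\<And>A. A \<in> carrier_mat r c \<Longrightarrow> flat A \<in> mv.span T"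
    using flat_span[where r=r and c=c] by blast
  show ?thesis unfolding mdim_def by (rule mv.dim_mono_finite[OF _ _ T(1)]) (use assms T(2) in auto)
qed

lemma mdim_psubset:
  fixes S :: "'a::field mat set"
  assumes "msub r c S" "S \<subseteq> S'" "S' \<subseteq> carrier_mat r c" "A \<in> S'" "A \<notin> S"
  shows "mdim S < mdim S'"
proof -
  obtain T :: "(nat \<times> nat \<Rightarrow> 'a) set"
    where T: "finite T" "\<And>A. A \<in> carrier_mat r c \<Longrightarrow> flat A \<in> mv.span T"
    using flat_span[where r=r and c=c] by blast
  have "flat A \<notin> flat ` S" using flat_mem[of A r c S] assms by auto
  then show ?thesis unfolding mdim_def
    by (intro mv.dim_psubset_finite[OF _ _ T(1) msub_subspace[OF assms(1)], where x="flat A"]) (use assms T(2) in auto)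
qed

lemma mdim_zero: "mdim {0\<^sub>m r c} = 0"
  unfolding mdim_def by (rule mv.dim_unique[of "{}"]) (auto simp: flat_zero mv.span_empty mv.independent_empty)

lemma mdim_rank_nullity:
  fixes L :: "'k::field mat \<Rightarrow> 'k mat"
  assumes S: "msub r c S"
    and Lc: "\<And>A. A \<in> carrier_mat r c \<Longrightarrow> L A \<in> carrier_mat r' c'"
    and La: "\<And>A B. A \<in> carrier_mat r c \<Longrightarrow> B \<in> carrier_mat r c \<Longrightarrow> L (A + B) = L A + L B"
    and Ls: "\<And>a A. A \<in> carrier_mat r c \<Longrightarrow> L (a \<cdot>\<^sub>m A) = a \<cdot>\<^sub>m L A"
  shows "mdim S = mdim (L ` S) + mdim {A \<in> S. L A = 0\<^sub>m r' c'}"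
proof -
  \<comment> \<open>Restricting an arbitrary function to the r by c window makes L' linear on the
    whole function space, although L is controlled only on matrices of that format.\<close>
  define L' where "L' F = flat (L (mat r c F))" for F
  obtain T :: "(nat \<times> nat \<Rightarrow> 'k) set" where T: "finite T" "\<And>A. A \<in> carrier_mat r c \<Longrightarrow> flat A \<in> mv.span T"
    using flat_span[where r=r and c=c] by blast
  have Sc: "S \<subseteq> carrier_mat r c" using S by (simp add: msub_def)
  have "Vector_Spaces.linear fscale fscale L'"
    unfolding Vector_Spaces.linear_iff
  proof (intro conjI allI)
    fix F G :: "nat \<times> nat \<Rightarrow> 'k" and a :: 'k
    have "mat r c (F + G) = mat r c F + mat r c G" by (rule eq_matI) auto
    then show "L' (F + G) = L' F + L' G" unfolding L'_def
      using La[of "mat r c F" "mat r c G"] flat_add[OF Lc[of "mat r c F"] Lc[of "mat r c G"]] by simp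
    have "mat r c (fscale a F) = a \<cdot>\<^sub>m mat r c F" by (rule eq_matI) (auto simp: fscale_def)
    then show "L' (fscale a F) = fscale a (L' F)" unfolding L'_def
      using Ls[of "mat r c F" a] by (simp add: flat_smult)
  qed (rule mv.vector_space_axioms)+
  then interpret l: Vector_Spaces.linear fscale fscale L' .
  have L'f: "L' (flat A) = flat (L A)" if "A \<in> S" for A
    unfolding L'_def using mat_flat[of A r c] that Sc by auto
  have 1: "L' ` flat ` S = flat ` L ` S" using L'f by (auto simp: image_image)
  have "flat (L A) = 0 \<longleftrightarrow> L A = 0\<^sub>m r' c'" if "A \<in> S" for A
  proof -
    have c: "L A \<in> carrier_mat r' c'" using Lc that Sc by auto
    have "L A = 0\<^sub>m r' c'" if "flat (L A) = 0"
      using mat_flat[OF c] mat_flat[OF zero_carrier_mat, of r' c'] that flat_zero by metis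
    moreover have "flat (L A) = 0" if "L A = 0\<^sub>m r' c'" unfolding that by (rule flat_zero)
    ultimately show ?thesis by blast
  qed
  then have 2: "{x \<in> flat ` S. L' x = 0} = flat ` {A \<in> S. L A = 0\<^sub>m r' c'}" using L'f by (auto simp: flat_zero)
  have "flat ` S \<subseteq> mv.span T" using T(2) Sc by auto
  from l.dim_image_plus_dim_kernel[OF msub_subspace[OF S] this T(1)]
  show ?thesis unfolding mdim_def 1 2 .
qed

context matrix_modules
begin

definition Hom :: "('a, 'k) amod \<Rightarrow> ('a, 'k) amod \<Rightarrow> 'k mat set" where
  "Hom M N = {f. mor M N f}"

definition hom_dim :: "('a, 'k) amod \<Rightarrow> ('a, 'k) amod \<Rightarrow> nat" where
  "hom_dim M N = mdim (Hom M N)"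

lemma Hom_carrier: "Hom M N \<subseteq> carrier_mat (fst N) (fst M)"
  unfolding Hom_def using mor_carrier by blast

lemma Hom_msub: "is_mod sc M \<Longrightarrow> is_mod sc N \<Longrightarrow> msub (fst N) (fst M) (Hom M N)"
  unfolding msub_def using Hom_carrier mor_zero mor_add mor_smult by (auto simp: Hom_def)

lemma hom_dim_post:
  assumes g: "mor N L g" and P: "is_mod sc P"
  shows "hom_dim P N = mdim ((\<lambda>f. g * f) ` Hom P N) + mdim {f \<in> Hom P N. g * f = 0\<^sub>m (fst L) (fst P)}"
  unfolding hom_dim_def
  by (rule mdim_rank_nullity[OF Hom_msub[OF P mor_mod(1)[OF g]]])
    (use mult_carrier_mat[OF mor_carrier[OF g]] mult_add_distrib_mat[OF mor_carrier[OF g]]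
      mult_smult_distrib[OF mor_carrier[OF g]] in auto)

lemma hom_dim_pre:
  assumes j: "mor Q P j" and N: "is_mod sc N"
  shows "hom_dim P N = mdim ((\<lambda>f. f * j) ` Hom P N) + mdim {f \<in> Hom P N. f * j = 0\<^sub>m (fst N) (fst Q)}"
  unfolding hom_dim_def
  by (rule mdim_rank_nullity[OF Hom_msub[OF mor_mod(2)[OF j] N]])
    (use mult_carrier_mat[OF _ mor_carrier[OF j]] add_mult_distrib_mat[OF _ _ mor_carrier[OF j]]
      mult_smult_assoc_mat[OF _ mor_carrier[OF j]] in auto)

lemma hom_dim_post_inj:
  assumes u: "mor U N u" "injective_map u" and P: "is_mod sc P"
  shows "mdim ((\<lambda>f. u * f) ` Hom P U) = hom_dim P U"
proof -
  have z: "u * 0\<^sub>m (fst U) (fst P) = 0\<^sub>m (fst N) (fst P)" using mor_carrier[OF u(1)] by simp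
  note zm = mor_zero[OF P mor_mod(1)[OF u(1)]]
  have "f = 0\<^sub>m (fst U) (fst P)" if "mor P U f" "u * f = 0\<^sub>m (fst N) (fst P)" for f
    using mor_inj_cancel[OF u(2,1) that(1) zm] that(2) z by simp
  then have "{f \<in> Hom P U. u * f = 0\<^sub>m (fst N) (fst P)} = {0\<^sub>m (fst U) (fst P)}"
    using z zm unfolding Hom_def by blast
  then show ?thesis using hom_dim_post[OF u(1) P] mdim_zero by simp
qed

lemma hom_dim_pre_surj:
  assumes g: "mor P X g" "surjective_map g" and N: "is_mod sc N"
  shows "mdim ((\<lambda>f. f * g) ` Hom X N) = hom_dim X N"
proof -
  have z: "0\<^sub>m (fst N) (fst X) * g = 0\<^sub>m (fst N) (fst P)" using mor_carrier[OF g(1)] by simp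
  note zm = mor_zero[OF mor_mod(2)[OF g(1)] N]
  have "f = 0\<^sub>m (fst N) (fst X)" if "mor X N f" "f * g = 0\<^sub>m (fst N) (fst P)" for f
    using mor_surj_cancel[OF g(2,1) that(1) zm] that(2) z by simp
  then have "{f \<in> Hom X N. f * g = 0\<^sub>m (fst N) (fst P)} = {0\<^sub>m (fst N) (fst X)}"
    using z zm unfolding Hom_def by blast
  then show ?thesis using hom_dim_pre[OF g(1) N] mdim_zero by simp
qed

text \<open>By \<open>fac\<close>, K need only look like the kernel of f to maps from X. This is
  weaker than being the kernel and allows K to be a trace.\<close>

lemma hom_dim_kernel:
  assumes f: "mor E M f" and X: "is_mod sc X" and u: "mor K E u" "injective_map u"
    and fu: "f * u = 0\<^sub>m (fst M) (fst K)"
    and fac: "\<And>h. mor X E h \<Longrightarrow> f * h = 0\<^sub>m (fst M) (fst X) \<Longrightarrow> \<exists>h'. mor X K h' \<and> u * h' = h"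
  shows "hom_dim X E = mdim ((\<lambda>h. f * h) ` Hom X E) + hom_dim X K"
proof -
  have "f * (u * h) = 0\<^sub>m (fst M) (fst X)" if "mor X K h" for h
    by (simp add: mat_reassoc[OF fu] mor_dim[OF f] mor_dim[OF u(1)] mor_dim[OF that])
  then have "{h \<in> Hom X E. f * h = 0\<^sub>m (fst M) (fst X)} = (\<lambda>h. u * h) ` Hom X K"
    using fac mor_comp[OF _ u(1)] unfolding Hom_def by blast
  then show ?thesis using hom_dim_post[OF f X] hom_dim_post_inj[OF u X] by simp
qed

text \<open>Lifting makes composition with g map Hom(P, N) onto Hom(P, V), and the kernel of this
  map is Hom(P, U).\<close>

lemma hom_dim_ses:
  assumes P: "lifting P" and u: "mor U N u" "injective_map u" and g: "mor N V g" "surjective_map g"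
    and gu: "g * u = 0\<^sub>m (fst V) (fst U)"
    and ex: "\<And>x. x \<in> carrier_vec (fst N) \<Longrightarrow> g *\<^sub>v x = 0\<^sub>v (fst V) \<Longrightarrow> \<exists>y\<in>carrier_vec (fst U). u *\<^sub>v y = x"
  shows "hom_dim P N = hom_dim P U + hom_dim P V"
proof -
  have Pm: "is_mod sc P" using P by (simp add: lifting_def)
  have "(\<lambda>f. g * f) ` Hom P N = Hom P V"
  proof (intro equalityI subsetI)
    fix f assume "f \<in> Hom P V"
    then obtain f' where "mor P N f'" "g * f' = f" using liftingE[OF P g] by (auto simp: Hom_def)
    then show "f \<in> (\<lambda>f. g * f) ` Hom P N" by (auto simp: Hom_def)
  qed (use mor_comp[OF _ g(1)] in \<open>unfold Hom_def; blast\<close>)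
  then show ?thesis
    using hom_dim_kernel[OF g(1) Pm u gu] mor_factor_exact[OF u ex g(1)] unfolding hom_dim_def by (metis add.commute)
qed

text \<open>Hom(-, N) turns the presentation into a sequence whose last map Hom(P, N) -> Hom(Q, N)
  is onto by \<open>extends\<close>. So dim Hom(P, N) - dim Hom(Q, N) computes dim Hom(X,
  N).\<close>

lemma hom_dim_pres:
  assumes pr: "pres Q P X j g" and ext: "extends Q P j N" and N: "is_mod sc N"
  shows "hom_dim P N = hom_dim X N + hom_dim Q N"
proof -
  note pr = presD[OF pr]
  have 1: "(\<lambda>f. f * j) ` Hom P N = Hom Q N"
  proof (intro equalityI subsetI)
    fix f assume "f \<in> Hom Q N"
    then obtain f' where "mor P N f'" "f' * j = f" using extendsE[OF ext] by (auto simp: Hom_def)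
    then show "f \<in> (\<lambda>f. f * j) ` Hom P N" by (auto simp: Hom_def)
  qed (use mor_comp[OF pr(3)] in \<open>unfold Hom_def; blast\<close>)
  have 2: "{f \<in> Hom P N. f * j = 0\<^sub>m (fst N) (fst Q)} = (\<lambda>f. f * g) ` Hom X N"
  proof (intro equalityI subsetI)
    fix f assume "f \<in> {f \<in> Hom P N. f * j = 0\<^sub>m (fst N) (fst Q)}"
    then have f: "mor P N f" "f * j = 0\<^sub>m (fst N) (fst Q)" by (auto simp: Hom_def)
    have "f *\<^sub>v x = 0\<^sub>v (fst N)" if x: "x \<in> carrier_vec (fst P)" "g *\<^sub>v x = 0\<^sub>v (fst X)" for x
    proof -
      obtain y where y: "y \<in> carrier_vec (fst Q)" "j *\<^sub>v y = x" using pr(8)[OF x] by blast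
      have "f *\<^sub>v x = (f * j) *\<^sub>v y" using mor_assoc_vec[OF pr(3) f(1) y(1)] y(2) by simp
      then show ?thesis unfolding f(2) using y(1) by simp
    qed
    then obtain f' where "mor X N f'" "f' * g = f" using mor_factor_surj[OF pr(5,6) f(1)] by blast
    then show "f \<in> (\<lambda>f. f * g) ` Hom X N" by (auto simp: Hom_def)
  next
    fix f assume "f \<in> (\<lambda>f. f * g) ` Hom X N"
    then obtain f' where f': "mor X N f'" "f = f' * g" by (auto simp: Hom_def)
    have "f * j = 0\<^sub>m (fst N) (fst Q)"
      unfolding f'(2) by (simp add: mat_laws mor_dim[OF f'(1)] mor_dim[OF pr(5)] mor_dim[OF pr(3)] pr(7))
    then show "f \<in> {f \<in> Hom P N. f * j = 0\<^sub>m (fst N) (fst Q)}" using mor_comp[OF pr(5) f'(1)] f'(2) by (auto simp: Hom_def)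
  qed
  show ?thesis using hom_dim_pre[OF pr(3) N] hom_dim_pre_surj[OF pr(5,6) N] unfolding 1 2 by (simp add: hom_dim_def)
qed

lemma hom_dim_miso:
  assumes h: "miso N N' h" and P: "is_mod sc P"
  shows "hom_dim P N = hom_dim P N'"
proof -
  obtain t where t: "mor N' N t" "t * h = 1\<^sub>m (fst N)" "h * t = 1\<^sub>m (fst N')" using misoE[OF h] by blast
  have "(\<lambda>f. h * f) ` Hom P N = Hom P N'"
  proof (intro equalityI subsetI)
    fix f assume "f \<in> Hom P N'"
    then have f: "mor P N' f" by (simp add: Hom_def)
    have "f = h * (t * f)" using mor_assoc[OF f t(1) miso_mor[OF h]] t(3) mor_left_id[OF f] by simp
    then show "f \<in> (\<lambda>f. h * f) ` Hom P N" using mor_comp[OF f t(1)] by (auto simp: Hom_def)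
  qed (use mor_comp[OF _ miso_mor[OF h]] in \<open>unfold Hom_def; blast\<close>)
  then show ?thesis using hom_dim_post_inj[OF miso_mor[OF h] miso_inj[OF h] P] by (simp add: hom_dim_def)
qed

lemma Hom_post_msub:
  assumes f: "mor E N f" and M: "is_mod sc M"
  shows "msub (fst N) (fst M) ((\<lambda>h. f * h) ` Hom M E)"
  unfolding msub_def
proof (intro conjI ballI allI)
  show "(\<lambda>h. f * h) ` Hom M E \<subseteq> carrier_mat (fst N) (fst M)"
    using mor_carrier[OF mor_comp[OF _ f]] unfolding Hom_def by blast
  show "0\<^sub>m (fst N) (fst M) \<in> (\<lambda>h. f * h) ` Hom M E"
    by (rule image_eqI[of _ _ "0\<^sub>m (fst E) (fst M)"]) (use mor_carrier[OF f] mor_zero[OF M mor_mod(1)[OF f]] in \<open>auto simp: Hom_def\<close>)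
  fix A assume "A \<in> (\<lambda>h. f * h) ` Hom M E"
  then obtain a where a: "mor M E a" "A = f * a" by (auto simp: Hom_def)
  show "c \<cdot>\<^sub>m A \<in> (\<lambda>h. f * h) ` Hom M E" for c
    by (rule image_eqI[of _ _ "c \<cdot>\<^sub>m a"])
      (use a mor_smult mult_smult_distrib[OF mor_carrier[OF f] mor_carrier[OF a(1)]] in \<open>auto simp: Hom_def\<close>)
  fix B assume "B \<in> (\<lambda>h. f * h) ` Hom M E"
  then obtain b where b: "mor M E b" "B = f * b" by (auto simp: Hom_def)
  show "A + B \<in> (\<lambda>h. f * h) ` Hom M E"
    by (rule image_eqI[of _ _ "a + b"])
      (use a b mor_add mor_add_comp[OF a(1) b(1) f] in \<open>auto simp: Hom_def\<close>)
qed

text \<open>The sum of copies of the $M_j$ is obtained by enlarging it as long as some map in $R$ does not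
  factor; the dimensions of the spaces of factoring maps bound this process.\<close>

lemma exists_approximation:
  fixes M :: "nat \<Rightarrow> ('a, 'k) amod" and m :: nat
  assumes M: "\<And>j. j < m \<Longrightarrow> is_mod sc (M j)" and N: "is_mod sc N"
    and R: "\<And>j h. j < m \<Longrightarrow> h \<in> R j \<Longrightarrow> mor (M j) N h"
  obtains r k f where "\<And>l. l < r \<Longrightarrow> k l < m" "mor (bigsum (\<lambda>l. M (k l)) r) N f"
    "\<And>l. l < r \<Longrightarrow> f * bigsum_inj (\<lambda>l. M (k l)) r l \<in> R (k l)"
    "\<And>j h. j < m \<Longrightarrow> h \<in> R j \<Longrightarrow> \<exists>h'. mor (M j) (bigsum (\<lambda>l. M (k l)) r) h' \<and> f * h' = h"
proof -
  define E where "E k r = bigsum (\<lambda>l. M (k l)) r" for k and r :: nat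
  define V where "V r k f \<longleftrightarrow> (\<forall>l<r. k l < m) \<and> mor (E k r) N f \<and>
    (\<forall>l<r. f * bigsum_inj (\<lambda>l. M (k l)) r l \<in> R (k l))" for r k f
  define I where "I r k f j = (\<lambda>h. f * h) ` Hom (M j) (E k r)" for r k f j
  define mu where "mu r k f = (\<Sum>j<m. mdim (I r k f j))" for r k f
  define G where "G n \<longleftrightarrow> (\<exists>r k f. V r k f \<and> mu r k f = n)" for n
  have E0: "mor (E k 0) N (0\<^sub>m (fst N) 0)" for k
    using mor_zero[OF bigsum_mod N, of 0 "\<lambda>l. M (k l)"] by (simp add: E_def)
  have IH: "I r k f j \<subseteq> Hom (M j) N" if "V r k f" for r k f j
    using that mor_comp unfolding V_def I_def Hom_def by blast
  have "G (mu 0 (\<lambda>_. 0) (0\<^sub>m (fst N) 0))" unfolding G_def V_def using E0 by blast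
  moreover have "n \<le> (\<Sum>j<m. hom_dim (M j) N)" if Gn: "G n" for n
  proof -
    obtain r k f where V: "V r k f" "mu r k f = n" using Gn unfolding G_def by blast
    have "mu r k f \<le> (\<Sum>j<m. hom_dim (M j) N)" unfolding mu_def hom_dim_def
      by (rule sum_mono) (rule mdim_mono[OF IH[OF V(1)] Hom_carrier])
    then show ?thesis using V(2) by simp
  qed
  ultimately obtain n where n: "G n" "\<And>n'. G n' \<Longrightarrow> n' \<le> n"
    using Nat.ex_has_greatest_nat[of G _ "\<Sum>j<m. hom_dim (M j) N"] by blast
  obtain r k f where V: "V r k f" "mu r k f = n" using n(1) unfolding G_def by blast
  have k: "\<And>l. l < r \<Longrightarrow> k l < m" and f: "mor (E k r) N f"
    and comp: "\<And>l. l < r \<Longrightarrow> f * bigsum_inj (\<lambda>l. M (k l)) r l \<in> R (k l)" using V(1) unfolding V_def by auto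
  have "\<exists>h'. mor (M j) (E k r) h' \<and> f * h' = h" if j: "j < m" and h: "h \<in> R j" for j h
  proof (rule ccontr)
    assume no: "\<not> ?thesis"
    \<comment> \<open>Appending M j as a further summand with component h keeps all earlier
      factorizations and adds one for h, so mu increases strictly.\<close>
    define k' where "k' = k(r := j)"
    define f' where "f' = hcat (fst (E k r)) (fst (M j)) f h"
    note hm = R[OF j h]
    have Eeq: "E k' r = E k r" unfolding E_def k'_def by (rule bigsum_cong) auto
    then have ES: "E k' (Suc r) = dsum (E k r) (M j)" unfolding E_def k'_def by simp
    note D = dsum_mor'[OF f hm]
    have f': "mor (E k' (Suc r)) N f'" unfolding ES f'_def by (rule hcat_mor[OF f hm])
    have fi: "f' * inj_fst (fst (E k r)) (fst (M j)) = f" "f' * inj_snd (fst (E k r)) (fst (M j)) = h"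
      unfolding f'_def using hcat_inj[OF mor_carrier[OF f] mor_carrier[OF hm]] by auto
    have "f' * bigsum_inj (\<lambda>l. M (k' l)) (Suc r) l \<in> R (k' l)" if l: "l < Suc r" for l
    proof (cases "l = r")
      case True
      then show ?thesis using fi(2) h Eeq unfolding E_def by (simp add: k'_def)
    next
      case False
      then have l: "l < r" using l by simp
      have b: "bigsum_inj (\<lambda>l. M (k' l)) r l = bigsum_inj (\<lambda>l. M (k l)) r l"
        by (rule bigsum_inj_cong[OF _ l]) (simp add: k'_def)
      have bm: "mor (M (k l)) (E k r) (bigsum_inj (\<lambda>l. M (k l)) r l)"
        unfolding E_def by (rule bigsum_mor(1)[of r "\<lambda>l. M (k l)", OF M[OF k] l])
      have "f' * (inj_fst (fst (E k r)) (fst (M j)) * bigsum_inj (\<lambda>l. M (k l)) r l) = f * bigsum_inj (\<lambda>l. M (k l)) r l"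
        using fi(1) mor_dim[OF bm] mor_dim[OF f'] by (simp add: mat_reassoc[OF fi(1)] ES dsum_simps)
      then show ?thesis using comp[OF l] l Eeq b unfolding E_def by (simp add: k'_def)
    qed
    then have V': "V (Suc r) k' f'" using f' k j unfolding V_def k'_def by auto
    have sub: "I r k f i \<subseteq> I (Suc r) k' f' i" for i
    proof
      fix x assume "x \<in> I r k f i"
      then obtain a where a: "mor (M i) (E k r) a" "x = f * a" unfolding I_def Hom_def by blast
      have "x = f' * (inj_fst (fst (E k r)) (fst (M j)) * a)"
        using mor_dim[OF a(1)] mor_dim[OF f'] by (simp add: mat_reassoc[OF fi(1)] a(2) ES dsum_simps)
      then show "x \<in> I (Suc r) k' f' i" unfolding I_def ES Hom_def using mor_comp[OF a(1) D(1)] by blast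
    qed
    have hI: "h \<in> I (Suc r) k' f' j" unfolding I_def ES Hom_def using fi(2) D(2) by blast
    have hI': "h \<notin> I r k f j" using no unfolding I_def Hom_def by blast
    have c: "I (Suc r) k' f' i \<subseteq> carrier_mat (fst N) (fst (M i))" for i using IH[OF V'] Hom_carrier by blast
    have "mu r k f < mu (Suc r) k' f'" unfolding mu_def
    proof (rule sum_strict_mono_ex1)
      show "\<forall>i\<in>{..<m}. mdim (I r k f i) \<le> mdim (I (Suc r) k' f' i)" using mdim_mono[OF sub c] by blast
      have "msub (fst N) (fst (M j)) (I r k f j)" unfolding I_def by (rule Hom_post_msub[OF f M[OF j]])
      then have "mdim (I r k f j) < mdim (I (Suc r) k' f' j)" by (rule mdim_psubset[OF _ sub c hI hI'])
      then show "\<exists>i\<in>{..<m}. mdim (I r k f i) < mdim (I (Suc r) k' f' i)" using j by blast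
    qed simp
    moreover have "mu (Suc r) k' f' \<le> n" using n(2) V' unfolding G_def by blast
    ultimately show False using V(2) by simp
  qed
  then show ?thesis using that[of r k f] k f comp unfolding E_def by blast
qed

end

subsection \<open>Composition factors\<close>

text \<open>If the matrix B with columns b j kills v, pairing with a i leaves a nonzero multiple of
  the entry v i; so B is injective and has at least m rows. The integers are embedded into
  \<open>rat\<close> because ranks are taken over a field.\<close>

lemma rank_bound:
  fixes a b :: "nat \<Rightarrow> 'c \<Rightarrow> int"
  assumes fin: "finite C"
    and diag: "\<And>i. i < m \<Longrightarrow> (\<Sum>x\<in>C. a i x * b i x) \<noteq> 0"
    and off: "\<And>i j. i < m \<Longrightarrow> j < m \<Longrightarrow> i \<noteq> j \<Longrightarrow> (\<Sum>x\<in>C. a i x * b j x) = 0"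
  shows "m \<le> card C"
proof -
  define n where "n = card C"
  obtain h where h: "bij_betw h {..<n} C"
    using ex_bij_betw_nat_finite[OF fin] unfolding n_def atLeast0LessThan by blast
  define B :: "rat mat" where "B = mat n m (\<lambda>(k, j). of_int (b j (h k)))"
  have B: "B \<in> carrier_mat n m" by (simp add: B_def)
  have "injective_map B"
  proof (rule injective_mapI[OF B])
    fix v :: "rat vec" assume v: "v \<in> carrier_vec m" "B *\<^sub>v v = 0\<^sub>v n"
    have row: "(\<Sum>j<m. of_int (b j (h k)) * v $ j) = 0" if k: "k < n" for k
    proof -
      have "(\<Sum>j<m. of_int (b j (h k)) * v $ j) = (B *\<^sub>v v) $ k"
        using k v(1) by (auto simp: B_def scalar_prod_def atLeast0LessThan intro!: sum.cong)
      then show ?thesis using v(2) k by simp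
    qed
    have "v $ i = 0" if i: "i < m" for i
    proof -
      let ?d = "\<lambda>j. of_int (\<Sum>x\<in>C. a i x * b j x) :: rat"
      have "(\<Sum>j<m. ?d j * v $ j) = (\<Sum>j<m. (\<Sum>k<n. of_int (a i (h k) * b j (h k))) * v $ j)"
        unfolding sum.reindex_bij_betw[OF h, symmetric] by simp
      also have "\<dots> = (\<Sum>j<m. \<Sum>k<n. of_int (a i (h k)) * (of_int (b j (h k)) * v $ j))"
        unfolding sum_distrib_right by (simp add: mult.assoc)
      also have "\<dots> = (\<Sum>k<n. \<Sum>j<m. of_int (a i (h k)) * (of_int (b j (h k)) * v $ j))"
        by (rule sum.swap)
      also have "\<dots> = 0" unfolding sum_distrib_left[symmetric] using row by simp
      finally have "(\<Sum>j<m. ?d j * v $ j) = 0" .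
      moreover have "(\<Sum>j<m. ?d j * v $ j) = (\<Sum>j<m. if j = i then ?d i * v $ i else 0)"
        by (rule sum.cong) (use off[OF i] in \<open>auto simp del: of_int_sum of_int_mult\<close>)
      ultimately have "?d i * v $ i = 0" using i by simp
      moreover have "?d i \<noteq> 0" using diag[OF i] of_int_eq_0_iff by blast
      ultimately show ?thesis by simp
    qed
    then show "v = 0\<^sub>v m" using v(1) by (intro eq_vecI) auto
  qed
  then show ?thesis using injective_map_dim_le[OF _ B] n_def by simp
qed

context matrix_modules
begin

definition simple_classes :: "('a, 'k) amod set set" where
  "simple_classes = {S. simple_mod sc S} // iso_rel sc"

lemma mor_surj_kernel_comp:
  assumes u: "mor U M u" and g: "mor M V g"
    and k: "\<And>x. x \<in> carrier_vec (fst M) \<Longrightarrow> g *\<^sub>v x = 0\<^sub>v (fst V) \<longleftrightarrow> (\<exists>y\<in>carrier_vec (fst U). x = u *\<^sub>v y)"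
  shows "g * u = 0\<^sub>m (fst V) (fst U)"
proof (rule mat_eq_on_vecI[OF mor_carrier[OF mor_comp[OF u g]] zero_carrier_mat])
  fix y :: "'k vec" assume y: "y \<in> carrier_vec (fst U)"
  show "(g * u) *\<^sub>v y = 0\<^sub>m (fst V) (fst U) *\<^sub>v y"
    unfolding mor_assoc_vec[OF u g y] using k[OF mor_vec[OF u y]] y by auto
qed

text \<open>A nonzero module that is not simple has a proper nonzero submodule, and dimensions of
  Hom(P, -) add up along the resulting sequence. The order of quantifiers matters: one list of
  factors serves all P.\<close>

lemma composition_factors:
  assumes "is_mod sc N"
  shows "\<exists>Ss. (\<forall>S\<in>set Ss. simple_mod sc S) \<and> (\<forall>P. lifting P \<longrightarrow> hom_dim P N = sum_list (map (hom_dim P) Ss))"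
  using assms
proof (induction "fst N" arbitrary: N rule: less_induct)
  case less
  note N = less.prems
  show ?case
  proof (cases "fst N = 0 \<or> simple_mod sc N")
    case True
    show ?thesis
    proof (cases "fst N = 0")
      case z: True
      have "hom_dim P N = 0" for P
      proof -
        have "mdim (Hom P N) \<le> mdim {0\<^sub>m 0 (fst P) :: 'k mat}"
        proof (rule mdim_mono[where r = 0 and c = "fst P"])
          show "Hom P N \<subseteq> {0\<^sub>m 0 (fst P)}"
          proof
            fix f assume "f \<in> Hom P N"
            then have "f \<in> carrier_mat 0 (fst P)" using Hom_carrier z by fastforce
            then have "f = 0\<^sub>m 0 (fst P)" by (intro eq_matI) auto
            then show "f \<in> {0\<^sub>m 0 (fst P)}" by simp
          qed
        qed simp
        then show ?thesis unfolding hom_dim_def using mdim_zero[of 0 "fst P", where 'a='k] by simp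
      qed
      then show ?thesis by (intro exI[of _ "[]"]) simp
    next
      case False
      then show ?thesis using True by (intro exI[of _ "[N]"]) simp
    qed
  next
    case False
    then obtain U u where *: "is_mod sc U" "is_hom U N u" "injective_map u" "fst U > 0" "fst U \<noteq> fst N"
      using N unfolding simple_mod_def by (metis gr0I)
    have u: "mor U N u" using * N by (simp add: mor_def)
    obtain V g where V: "mor N V g" "surjective_map g"
      "\<And>x. x \<in> carrier_vec (fst N) \<Longrightarrow> g *\<^sub>v x = 0\<^sub>v (fst V) \<longleftrightarrow> (\<exists>y\<in>carrier_vec (fst U). x = u *\<^sub>v y)"
      "fst U + fst V = fst N"
      by (rule quotient_exists[OF u *(3)]) (rule that; assumption)
    have lt: "fst U < fst N" "fst V < fst N" using V(4) *(4,5) by auto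
    obtain Ss where Ss: "\<forall>S\<in>set Ss. simple_mod sc S" "\<And>P. lifting P \<Longrightarrow> hom_dim P U = sum_list (map (hom_dim P) Ss)"
      using less.hyps[OF lt(1) *(1)] by blast
    obtain Ss' where Ss': "\<forall>S\<in>set Ss'. simple_mod sc S" "\<And>P. lifting P \<Longrightarrow> hom_dim P V = sum_list (map (hom_dim P) Ss')"
      using less.hyps[OF lt(2) mor_mod(2)[OF V(1)]] by blast
    have ex: "\<exists>y\<in>carrier_vec (fst U). u *\<^sub>v y = x" if "x \<in> carrier_vec (fst N)" "g *\<^sub>v x = 0\<^sub>v (fst V)" for x
      using V(3) that by metis
    have "hom_dim P N = hom_dim P U + hom_dim P V" if "lifting P" for P
      by (rule hom_dim_ses[OF that u *(3) V(1,2) mor_surj_kernel_comp[OF u V(1,3)] ex])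
    then have "hom_dim P N = sum_list (map (hom_dim P) (Ss @ Ss'))" if "lifting P" for P
      using Ss(2)[OF that] Ss'(2)[OF that] that by simp
    moreover have "\<forall>S\<in>set (Ss @ Ss'). simple_mod sc S" unfolding set_append using Ss(1) Ss'(1) by blast
    ultimately show ?thesis by blast
  qed
qed

text \<open>An isomorphism class has no preferred member, so later sums evaluate
  \<open>hom_dim\<close> at a chosen one; isomorphic modules give the same value.\<close>

lemma simple_class_rep:
  assumes "simple_mod sc S" "lifting P"
  shows "hom_dim P (SOME S'. S' \<in> iso_rel sc `` {S}) = hom_dim P S"
proof -
  have S: "is_mod sc S" using assms(1) by (simp add: simple_mod_def)
  have "iso S S" by (rule miso_iso[OF misoI[OF mor_id[OF S] mor_id[OF S]]]) auto
  then have "S \<in> iso_rel sc `` {S}" using S by (simp add: iso_rel_def)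
  then have "(SOME S'. S' \<in> iso_rel sc `` {S}) \<in> iso_rel sc `` {S}" by (rule someI)
  then have "iso S (SOME S'. S' \<in> iso_rel sc `` {S})" "is_mod sc (SOME S'. S' \<in> iso_rel sc `` {S})"
    by (auto simp: iso_rel_def)
  then obtain h where h: "miso S (SOME S'. S' \<in> iso_rel sc `` {S}) h" using iso_miso S by blast
  have "is_mod sc P" using assms(2) by (simp add: lifting_def)
  then show ?thesis using hom_dim_miso[OF h] by simp
qed

text \<open>The coefficients are the multiplicities of the composition factors, hence common to all
  P. Finiteness matters because a sum over an infinite set is 0 by convention.\<close>

lemma hom_dim_via_simple_classes:
  assumes N: "is_mod sc N" and fin: "finite simple_classes"
  shows "\<exists>c. \<forall>P. lifting P \<longrightarrow> hom_dim P N = (\<Sum>C\<in>simple_classes. c C * hom_dim P (SOME S. S \<in> C))"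
proof -
  obtain Ss where Ss: "\<forall>S\<in>set Ss. simple_mod sc S" "\<And>P. lifting P \<Longrightarrow> hom_dim P N = sum_list (map (hom_dim P) Ss)"
    using composition_factors[OF N] by blast
  define cl where "cl S = iso_rel sc `` {S}" for S
  have sub: "set (map cl Ss) \<subseteq> simple_classes"
    using Ss(1) unfolding simple_classes_def cl_def by (auto intro!: quotientI)
  have "hom_dim P N = (\<Sum>C\<in>simple_classes. count_list (map cl Ss) C * hom_dim P (SOME S. S \<in> C))" if P: "lifting P" for P
  proof -
    have "hom_dim P N = sum_list (map (\<lambda>C. hom_dim P (SOME S. S \<in> C)) (map cl Ss))"
      using Ss(1) simple_class_rep[OF _ P] unfolding Ss(2)[OF P] cl_def
      by (auto simp: comp_def intro!: arg_cong[of _ _ sum_list])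
    also have "\<dots> = (\<Sum>C\<in>simple_classes. count_list (map cl Ss) C * hom_dim P (SOME S. S \<in> C))"
      by (rule sum_list_map_eq_sum_count2[OF sub fin])
    finally show ?thesis .
  qed
  then show ?thesis by blast
qed

subsection \<open>Bounding Ext-orthogonal families\<close>

lemma bigsum_mor_zero:
  assumes "\<And>l. l < n \<Longrightarrow> is_mod sc (Z l)" "mor (bigsum Z n) N h"
    "\<And>l. l < n \<Longrightarrow> h * bigsum_inj Z n l = 0\<^sub>m (fst N) (fst (Z l))"
  shows "h = 0\<^sub>m (fst N) (fst (bigsum Z n))"
  using assms
proof (induction n arbitrary: h)
  case 0
  then show ?case using mor_dim[OF 0(2)] by (intro eq_matI) auto
next
  case (Suc n)
  let ?B = "bigsum Z n"
  have B: "is_mod sc ?B" "is_mod sc (Z n)" using bigsum_mod Suc.prems(1) by auto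
  note D = dsum_mor[OF B]
  let ?i1 = "inj_fst (fst ?B) (fst (Z n)) :: 'k mat" and ?i2 = "inj_snd (fst ?B) (fst (Z n)) :: 'k mat"
  let ?p1 = "proj_fst (fst ?B) (fst (Z n)) :: 'k mat" and ?p2 = "proj_snd (fst ?B) (fst (Z n)) :: 'k mat"
  have h: "mor (dsum ?B (Z n)) N h" using Suc.prems(2) by simp
  note dims = mor_dim[OF h] dsum_simps(1)
  have 2: "h * ?i2 = 0\<^sub>m (fst N) (fst (Z n))" using Suc.prems(3)[of n] by simp
  have "h * ?i1 * bigsum_inj Z n l = 0\<^sub>m (fst N) (fst (Z l))" if l: "l < n" for l
  proof -
    have "mor (Z l) ?B (bigsum_inj Z n l)" using bigsum_mor(1)[of n Z l] Suc.prems(1) l by simp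
    then show ?thesis using Suc.prems(3)[of l] l by (simp add: mat_laws dims mor_dim)
  qed
  then have 1: "h * ?i1 = 0\<^sub>m (fst N) (fst ?B)"
    using Suc.IH[OF _ mor_comp[OF D(1) h]] Suc.prems(1) by simp
  have "h * (?i1 * ?p1 + ?i2 * ?p2) = h" unfolding block_identities by (simp add: dims)
  moreover have "h * (?i1 * ?p1 + ?i2 * ?p2) = 0\<^sub>m (fst N) (fst ?B + fst (Z n))"
    by (simp add: mat_laws dims mat_reassoc[OF 1] mat_reassoc[OF 2] mat_add_laws)
  ultimately show ?case by (simp add: dsum_simps)
qed

text \<open>Here $E$ is the source of a right radical approximation of $Z_i$ and $K$ the trace of the $Z_j$ in
  its kernel. These modules and $Z_i$ are quotients of sums of the $Z_j$, where $Hom(Z_j, -)$ may be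
  computed from the presentation.\<close>

lemma dual_test_modules:
  fixes Z :: "nat \<Rightarrow> ('a, 'k) amod"
  assumes Z: "\<And>i. i < m \<Longrightarrow> indecomposable sc (Z i)"
    and noniso: "\<And>i j. i < m \<Longrightarrow> j < m \<Longrightarrow> i \<noteq> j \<Longrightarrow> \<not> iso (Z i) (Z j)"
    and pr: "\<And>i. i < m \<Longrightarrow> pres (Q i) (P i) (Z i) (\<iota> i) (g i)"
    and ext: "\<And>i j. i < m \<Longrightarrow> j < m \<Longrightarrow> extends (Q i) (P i) (\<iota> i) (Z j)"
    and i: "i < m"
  defines "phi \<equiv> \<lambda>j N. int (hom_dim (P j) N) - int (hom_dim (Q j) N)"
  obtains E K where "is_mod sc E" "is_mod sc K"
    "\<And>j. j < m \<Longrightarrow> j \<noteq> i \<Longrightarrow> phi j E - phi j (Z i) - phi j K = 0"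
    "phi i E - phi i (Z i) - phi i K \<noteq> 0"
proof -
  have Zm: "is_mod sc (Z j)" if "j < m" for j using indec_mod(1)[OF Z[OF that]] .
  \<comment> \<open>These are the radical maps to Z i: all maps when j differs from i, and the
    non-invertible endomorphisms when j = i.\<close>
  define R where "R j = {h. mor (Z j) (Z i) h \<and> \<not> miso (Z j) (Z i) h}" for j
  obtain r k f where k: "\<And>l. l < r \<Longrightarrow> k l < m" and f: "mor (bigsum (\<lambda>l. Z (k l)) r) (Z i) f"
    and fc: "\<And>l. l < r \<Longrightarrow> f * bigsum_inj (\<lambda>l. Z (k l)) r l \<in> R (k l)"
    and fR: "\<And>j h. j < m \<Longrightarrow> h \<in> R j \<Longrightarrow> \<exists>h'. mor (Z j) (bigsum (\<lambda>l. Z (k l)) r) h' \<and> f * h' = h"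
    by (rule exists_approximation[of m Z "Z i" R, OF Zm Zm[OF i]]) (auto simp: R_def)
  define E where "E = bigsum (\<lambda>l. Z (k l)) r"
  have f: "mor E (Z i) f" using f E_def by simp
  have Em: "is_mod sc E" by (rule mor_mod[OF f])
  define R' where "R' j = {h. mor (Z j) E h \<and> f * h = 0\<^sub>m (fst (Z i)) (fst (Z j))}" for j
  obtain r' k' f' where k': "\<And>l. l < r' \<Longrightarrow> k' l < m" and f'': "mor (bigsum (\<lambda>l. Z (k' l)) r') E f'"
    and fc': "\<And>l. l < r' \<Longrightarrow> f' * bigsum_inj (\<lambda>l. Z (k' l)) r' l \<in> R' (k' l)"
    and fR': "\<And>j h. j < m \<Longrightarrow> h \<in> R' j \<Longrightarrow> \<exists>h'. mor (Z j) (bigsum (\<lambda>l. Z (k' l)) r') h' \<and> f' * h' = h"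
    by (rule exists_approximation[of m Z E R', OF Zm Em]) (auto simp: R'_def)
  define E' where "E' = bigsum (\<lambda>l. Z (k' l)) r'"
  have f': "mor E' E f'" using f'' E'_def by simp
  \<comment> \<open>Every map from some Z j to E that f kills factors through f', so the image K of
    f' is the trace of the family in the kernel of f.\<close>
  obtain K u p where K: "mor K E u" "injective_map u" "mor E' K p" "surjective_map p" "u * p = f'"
    using image_exists[OF f'] .
  note Km = mor_mod(1)[OF K(1)]
  have "f * f' = 0\<^sub>m (fst (Z i)) (fst E')" unfolding E'_def
  proof (rule bigsum_mor_zero)
    show "is_mod sc (Z (k' l))" if "l < r'" for l using Zm k' that by blast
    show "mor (bigsum (\<lambda>l. Z (k' l)) r') (Z i) (f * f')" using mor_comp[OF f' f] E'_def by simp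
    fix l assume l: "l < r'"
    have b: "mor (Z (k' l)) E' (bigsum_inj (\<lambda>l. Z (k' l)) r' l)"
      unfolding E'_def using bigsum_mor(1)[of r' "\<lambda>l. Z (k' l)" l] Zm k' l by blast
    show "f * f' * bigsum_inj (\<lambda>l. Z (k' l)) r' l = 0\<^sub>m (fst (Z i)) (fst (Z (k' l)))"
      using fc'[OF l] mor_assoc[OF b f' f] by (simp add: R'_def)
  qed
  then have "f * u * p = 0\<^sub>m (fst (Z i)) (fst K) * p"
    using mor_assoc[OF K(3,1) f] K(5) mor_dim[OF K(3)] by simp
  then have fu: "f * u = 0\<^sub>m (fst (Z i)) (fst K)"
    by (rule mor_surj_cancel[OF K(4,3) mor_comp[OF K(1) f] mor_zero[OF Km Zm[OF i]]])
  have hdE: "hom_dim (Z j) E = mdim ((\<lambda>h. f * h) ` Hom (Z j) E) + hom_dim (Z j) K" if j: "j < m" for j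
  proof (rule hom_dim_kernel[OF f Zm[OF j] K(1,2) fu])
    fix h assume h: "mor (Z j) E h" "f * h = 0\<^sub>m (fst (Z i)) (fst (Z j))"
    then obtain h' where h': "mor (Z j) E' h'" "f' * h' = h" using fR'[OF j, of h] unfolding R'_def E'_def by blast
    have "u * (p * h') = h" using mor_assoc[OF h'(1) K(3,1)] K(5) h'(2) by simp
    then show "\<exists>h'. mor (Z j) K h' \<and> u * h' = h" using mor_comp[OF h'(1) K(3)] by blast
  qed
  have phi: "phi j N = int (hom_dim (Z j) N)" if "j < m" "is_mod sc N" "extends (Q j) (P j) (\<iota> j) N" for j N
    unfolding phi_def using hom_dim_pres[OF pr[OF that(1)] that(3,2)] by simp
  have j_mor: "mor (Q j) (P j) (\<iota> j)" if "j < m" for j using presD(3)[OF pr[OF that]] .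
  have extB: "extends (Q j) (P j) (\<iota> j) (bigsum (\<lambda>l. Z (q l)) s)" if "j < m" "\<And>l. l < s \<Longrightarrow> q l < m" for j q s
    by (rule extends_bigsum[OF _ _ j_mor[OF that(1)]]) (use that Zm ext in auto)
  have phiE: "phi j E = int (hom_dim (Z j) E)" if "j < m" for j
    using phi[OF that Em] extB[OF that k] E_def by simp
  have phiZ: "phi j (Z i) = int (hom_dim (Z j) (Z i))" if "j < m" for j by (rule phi[OF that Zm[OF i] ext[OF that i]])
  have phiK: "phi j K = int (hom_dim (Z j) K)" if "j < m" for j
  proof (rule phi[OF that Km])
    have "extends (Q j) (P j) (\<iota> j) E'" using extB[OF that k'] E'_def by simp
    then show "extends (Q j) (P j) (\<iota> j) K"
      by (rule extends_quotient[OF _ presD(1)[OF pr[OF that]] K(3,4) j_mor[OF that]])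
  qed
  have sub: "(\<lambda>h. f * h) ` Hom (Z j) E \<subseteq> Hom (Z j) (Z i)" for j
    using mor_comp[OF _ f] unfolding Hom_def by blast
  have off: "phi j E - phi j (Z i) - phi j K = 0" if j: "j < m" "j \<noteq> i" for j
  proof -
    have "Hom (Z j) (Z i) \<subseteq> (\<lambda>h. f * h) ` Hom (Z j) E"
    proof
      fix h assume "h \<in> Hom (Z j) (Z i)"
      then have "h \<in> R j" using noniso[OF j(1) i j(2)] miso_iso unfolding R_def Hom_def by blast
      then show "h \<in> (\<lambda>h. f * h) ` Hom (Z j) E" using fR[OF j(1)] unfolding E_def Hom_def by blast
    qed
    then have "hom_dim (Z j) (Z i) = mdim ((\<lambda>h. f * h) ` Hom (Z j) E)" using sub unfolding hom_dim_def by (metis subset_antisym)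
    then show ?thesis using hdE[OF j(1)] phiE[OF j(1)] phiZ[OF j(1)] phiK[OF j(1)] by simp
  qed
  have id: "mor (Z i) (Z i) (1\<^sub>m (fst (Z i)))" by (rule mor_id[OF Zm[OF i]])
  \<comment> \<open>A section of f would, by locality, make some component of f invertible, but the
    components of f are radical maps. So the maps factoring through f form a proper subspace of the
    endomorphisms of Z i.\<close>
  have "1\<^sub>m (fst (Z i)) \<notin> (\<lambda>h. f * h) ` Hom (Z i) E"
  proof
    assume "1\<^sub>m (fst (Z i)) \<in> (\<lambda>h. f * h) ` Hom (Z i) E"
    then obtain h where h: "mor (Z i) E h" "f * h = 1\<^sub>m (fst (Z i))" unfolding Hom_def by auto
    have "miso (Z i) (Z i) (f * h)" unfolding h(2) by (rule misoI[OF id id]) auto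
    then obtain l where l: "l < r"
      "miso (Z i) (Z i) ((f * bigsum_inj (\<lambda>l. Z (k l)) r l) * (bigsum_proj (\<lambda>l. Z (k l)) r l * h))"
      using miso_through_bigsum[OF Z[OF i], of r "\<lambda>l. Z (k l)" h f] Zm k h(1) f unfolding E_def by blast
    have b: "mor (Z (k l)) E (bigsum_inj (\<lambda>l. Z (k l)) r l)" "mor E (Z (k l)) (bigsum_proj (\<lambda>l. Z (k l)) r l)"
      unfolding E_def using bigsum_mor(1,2)[of r "\<lambda>l. Z (k l)" l] Zm k l(1) by blast+
    have "miso (Z (k l)) (Z i) (f * bigsum_inj (\<lambda>l. Z (k l)) r l)"
      by (rule indec_retract_miso(2)[OF Z[OF k[OF l(1)]] indec_mod(2)[OF Z[OF i]] mor_comp[OF h(1) b(2)]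
            mor_comp[OF b(1) f] l(2)])
    then show False using fc[OF l(1)] unfolding R_def by blast
  qed
  then have "mdim ((\<lambda>h. f * h) ` Hom (Z i) E) < hom_dim (Z i) (Z i)" unfolding hom_dim_def
    using mdim_psubset[OF Hom_post_msub[OF f Zm[OF i]] sub Hom_carrier] id unfolding Hom_def by blast
  then have "phi i E - phi i (Z i) - phi i K \<noteq> 0"
    using hdE[OF i] phiE[OF i] phiZ[OF i] phiK[OF i] by simp
  then show ?thesis using that[OF Em Km off] by blast
qed

text \<open>Each \<open>phi j\<close> is a linear function of multiplicity vectors indexed by the
  simple classes. The test modules supply for every i such a vector on which exactly
  \<open>phi i\<close> is nonzero, so \<open>rank_bound\<close> applies.\<close>

lemma rigid_family_bound:
  fixes Z :: "nat \<Rightarrow> ('a, 'k) amod"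
  assumes fin: "finite simple_classes"
    and Z: "\<And>i. i < m \<Longrightarrow> indecomposable sc (Z i)"
    and noniso: "\<And>i j. i < m \<Longrightarrow> j < m \<Longrightarrow> i \<noteq> j \<Longrightarrow> \<not> iso (Z i) (Z j)"
    and pr: "\<And>i. i < m \<Longrightarrow> \<exists>Q P \<iota> g. pres Q P (Z i) \<iota> g \<and> (\<forall>j<m. extends Q P \<iota> (Z j))"
  shows "m \<le> card simple_classes"
proof -
  obtain Q P \<iota> g where pr': "\<And>i. i < m \<Longrightarrow> pres (Q i) (P i) (Z i) (\<iota> i) (g i)"
    "\<And>i j. i < m \<Longrightarrow> j < m \<Longrightarrow> extends (Q i) (P i) (\<iota> i) (Z j)" using pr by metis
  define phi where "phi j N = int (hom_dim (P j) N) - int (hom_dim (Q j) N)" for j N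
  have lin: "\<exists>c. \<forall>j<m. phi j N = (\<Sum>C\<in>simple_classes. c C * phi j (SOME S. S \<in> C))"
    if N: "is_mod sc N" for N
  proof -
    obtain c where c: "\<And>P. lifting P \<Longrightarrow> hom_dim P N = (\<Sum>C\<in>simple_classes. c C * hom_dim P (SOME S. S \<in> C))"
      using hom_dim_via_simple_classes[OF N fin] by blast
    have *: "phi j N = (\<Sum>C\<in>simple_classes. int (c C) * phi j (SOME S. S \<in> C))" if j: "j < m" for j
      unfolding phi_def c[OF presD(1)[OF pr'(1)[OF j]]] c[OF presD(2)[OF pr'(1)[OF j]]]
      by (simp add: right_diff_distrib sum_subtractf)
    show ?thesis by (intro exI[of _ "\<lambda>C. int (c C)"] allI impI) (rule *)
  qed
  define A where "A i a \<longleftrightarrow> (\<Sum>C\<in>simple_classes. a C * phi i (SOME S. S \<in> C)) \<noteq> 0 \<and>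
    (\<forall>j<m. j \<noteq> i \<longrightarrow> (\<Sum>C\<in>simple_classes. a C * phi j (SOME S. S \<in> C)) = 0)" for i a
  have "\<exists>a. A i a" if i: "i < m" for i
  proof -
    obtain E K where EK: "is_mod sc E" "is_mod sc K"
      "\<And>j. j < m \<Longrightarrow> j \<noteq> i \<Longrightarrow> phi j E - phi j (Z i) - phi j K = 0"
      "phi i E - phi i (Z i) - phi i K \<noteq> 0"
      by (rule dual_test_modules[of m Z Q P \<iota> g i, OF Z noniso pr' i, folded phi_def];
          (assumption | (rule that; assumption)))
    obtain cE where cE: "\<And>j. j < m \<Longrightarrow> phi j E = (\<Sum>C\<in>simple_classes. cE C * phi j (SOME S. S \<in> C))"
      using lin[OF EK(1)] by blast
    obtain cK where cK: "\<And>j. j < m \<Longrightarrow> phi j K = (\<Sum>C\<in>simple_classes. cK C * phi j (SOME S. S \<in> C))"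
      using lin[OF EK(2)] by blast
    obtain cZ where cZ: "\<And>j. j < m \<Longrightarrow> phi j (Z i) = (\<Sum>C\<in>simple_classes. cZ C * phi j (SOME S. S \<in> C))"
      using lin[OF indec_mod(1)[OF Z[OF i]]] by blast
    have *: "(\<Sum>C\<in>simple_classes. (cE C - cZ C - cK C) * phi j (SOME S. S \<in> C)) = phi j E - phi j (Z i) - phi j K"
      if j: "j < m" for j
      unfolding cE[OF j] cK[OF j] cZ[OF j] by (simp add: left_diff_distrib sum_subtractf)
    \<comment> \<open>The vector is a difference of multiplicities and may have negative entries,
      hence the passage to integers.\<close>
    have "A i (\<lambda>C. cE C - cZ C - cK C)"
      unfolding A_def
    proof (intro conjI allI impI)
      show "(\<Sum>C\<in>simple_classes. (cE C - cZ C - cK C) * phi i (SOME S. S \<in> C)) \<noteq> 0"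
        unfolding *[OF i] by (rule EK(4))
      show "(\<Sum>C\<in>simple_classes. (cE C - cZ C - cK C) * phi j (SOME S. S \<in> C)) = 0" if "j < m" "j \<noteq> i" for j
        unfolding *[OF that(1)] by (rule EK(3)[OF that])
    qed
    then show ?thesis by blast
  qed
  then have "\<forall>i. \<exists>a. i < m \<longrightarrow> A i a" by blast
  then obtain a where aA: "\<And>i. i < m \<Longrightarrow> A i (a i)" using choice by metis
  have a: "i < m \<Longrightarrow> (\<Sum>C\<in>simple_classes. a i C * phi i (SOME S. S \<in> C)) \<noteq> 0"
    "i < m \<Longrightarrow> j < m \<Longrightarrow> i \<noteq> j \<Longrightarrow> (\<Sum>C\<in>simple_classes. a i C * phi j (SOME S. S \<in> C)) = 0" for i j
    using aA[of i] unfolding A_def by auto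
  show ?thesis
    by (rule rank_bound[OF fin, of m a "\<lambda>j C. phi j (SOME S. S \<in> C)"]) (use a in auto)
qed

end

subsection \<open>Hall's theorem\<close>

text \<open>If some proper nonempty J is tight, it is matched within its own neighbours B and the
  rest outside B. Otherwise every such set has a surplus of at least one, so an arbitrary pair a, b
  can be matched first: removing b costs the others at most one neighbour.\<close>

lemma hall:
  assumes "finite A" "\<And>i. i \<in> A \<Longrightarrow> finite (N i)"
    and "\<And>J. J \<subseteq> A \<Longrightarrow> card J \<le> card (\<Union>i\<in>J. N i)"
  shows "\<exists>s. inj_on s A \<and> (\<forall>i\<in>A. s i \<in> N i)"
  using assms
proof (induction "card A" arbitrary: A N rule: less_induct)
  case less
  note fin = less.prems(1,2) and hall = less.prems(3)
  have finU: "finite (\<Union>i\<in>J. N i)" if "J \<subseteq> A" for J using that fin finite_subset by blast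
  show ?case
  proof (cases "\<exists>J. J \<subset> A \<and> J \<noteq> {} \<and> card (\<Union>i\<in>J. N i) \<le> card J")
    case True
    then obtain J where J: "J \<subset> A" "J \<noteq> {}" "card (\<Union>i\<in>J. N i) \<le> card J" by blast
    define B where "B = (\<Union>i\<in>J. N i)"
    have finJ: "finite J" using J(1) fin(1) finite_subset by blast
    have "\<exists>s. inj_on s J \<and> (\<forall>i\<in>J. s i \<in> N i)"
      by (rule less.hyps) (use J psubset_card_mono[OF fin(1) J(1)] finJ fin(2) hall in auto)
    then obtain s where s: "inj_on s J" "\<And>i. i \<in> J \<Longrightarrow> s i \<in> N i" by blast
    have "\<exists>s. inj_on s (A - J) \<and> (\<forall>i\<in>A - J. s i \<in> N i - B)"
    proof (rule less.hyps)
      show "card (A - J) < card A" using J fin(1) by (intro psubset_card_mono) auto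
      fix K assume K: "K \<subseteq> A - J"
      have finK: "finite K" using K fin(1) finite_subset by blast
      \<comment> \<open>Hall's condition for K \<union> J, less the at most card J elements of B,
        leaves enough neighbours for K.\<close>
      have "card K + card J = card (K \<union> J)" using K finK finJ by (subst card_Un_disjoint) auto
      also have "\<dots> \<le> card (\<Union>i\<in>K \<union> J. N i)" by (rule hall) (use K J(1) in auto)
      also have "(\<Union>i\<in>K \<union> J. N i) = (\<Union>i\<in>K. N i - B) \<union> B" by (auto simp: B_def)
      also have "card \<dots> \<le> card (\<Union>i\<in>K. N i - B) + card B" by (rule card_Un_le)
      finally show "card K \<le> card (\<Union>i\<in>K. N i - B)" using J(3) B_def by simp
    qed (use fin in auto)
    then obtain t where t: "inj_on t (A - J)" "\<And>i. i \<in> A - J \<Longrightarrow> t i \<in> N i - B" by blast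
    let ?s = "\<lambda>i. if i \<in> J then s i else t i"
    have "inj_on ?s A"
    proof (rule inj_onI)
      fix x y assume xy: "x \<in> A" "y \<in> A" "?s x = ?s y"
      have sB: "s i \<in> B" if "i \<in> J" for i using s(2)[OF that] that by (auto simp: B_def)
      show "x = y"
        using xy sB t(2) inj_onD[OF s(1), of x y] inj_onD[OF t(1), of x y]
        by (cases "x \<in> J"; cases "y \<in> J") fastforce+
    qed
    moreover have "\<forall>i\<in>A. ?s i \<in> N i" using s(2) t(2) by auto
    ultimately show ?thesis by blast
  next
    case strict: False
    show ?thesis
    proof (cases "A = {}")
      case True
      then show ?thesis by simp
    next
      case ne: False
      then obtain a where a: "a \<in> A" by blast
      have "card {a} \<le> card (\<Union>i\<in>{a}. N i)" by (rule hall) (use a in simp)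
      then have "N a \<noteq> {}" by auto
      then obtain b where b: "b \<in> N a" by blast
      have "\<exists>s. inj_on s (A - {a}) \<and> (\<forall>i\<in>A - {a}. s i \<in> N i - {b})"
      proof (rule less.hyps)
        show "card (A - {a}) < card A" using a fin(1) by (intro psubset_card_mono) auto
        fix K assume K: "K \<subseteq> A - {a}"
        show "card K \<le> card (\<Union>i\<in>K. N i - {b})"
        proof (cases "K = {}")
          case False
          have "K \<subset> A" using K a by blast
          then have "card K < card (\<Union>i\<in>K. N i)" using strict False not_le by blast
          moreover have "card (\<Union>i\<in>K. N i) \<le> card (\<Union>i\<in>K. N i - {b}) + 1"
          proof -
            have eq: "(\<Union>i\<in>K. N i - {b}) = (\<Union>i\<in>K. N i) - {b}" by blast
            show ?thesis unfolding eq using diff_card_le_card_Diff[of "{b}" "\<Union>i\<in>K. N i"] by simp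
          qed
          ultimately show ?thesis by simp
        qed simp
      qed (use fin in auto)
      then obtain s where s: "inj_on s (A - {a})" "\<And>i. i \<in> A - {a} \<Longrightarrow> s i \<in> N i - {b}" by blast
      let ?s = "s(a := b)"
      have "inj_on ?s A"
      proof (rule inj_onI)
        fix x y assume xy: "x \<in> A" "y \<in> A" "?s x = ?s y"
        then show "x = y" using s(2)[of x] s(2)[of y] inj_onD[OF s(1), of x y]
          by (cases "x = a"; cases "y = a") auto
      qed
      moreover have "\<forall>i\<in>A. ?s i \<in> N i" using s(2) b by auto
      ultimately show ?thesis by blast
    qed
  qed
qed

subsection \<open>Tilting modules\<close>

context matrix_modules
begin

lemma iso_trans: "iso M N \<Longrightarrow> iso N L \<Longrightarrow> is_mod sc M \<Longrightarrow> is_mod sc N \<Longrightarrow> is_mod sc L \<Longrightarrow> iso M L"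
  using iso_miso miso_comp miso_iso by metis

lemma iso_sym: "iso M N \<Longrightarrow> iso N M"
  unfolding iso_def by blast

text \<open>The tilting condition equates the number of simple classes with that of the classes of
  indecomposable summands, and by Krull-Schmidt the latter are among the classes of the X l.\<close>

lemma simple_classes_of_tilting:
  assumes X: "\<And>i. i < n \<Longrightarrow> indecomposable sc (X i)" and T: "tilting sc (bigsum X n)" and n: "0 < n"
  shows "finite simple_classes" "card simple_classes \<le> n"
proof -
  note Xm = indec_mod(1)[OF X]
  define D where "D = {M. indecomposable sc M \<and> direct_summand sc M (bigsum X n)} // iso_rel sc"
  have card: "card D = card simple_classes"
    using T unfolding tilting_def num_indec_summands_def num_simples_def simple_classes_def D_def by blast
  have sub: "D \<subseteq> (\<lambda>l. iso_rel sc `` {X l}) ` {..<n}"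
  proof
    fix C assume "C \<in> D"
    then obtain M where M: "indecomposable sc M" "direct_summand sc M (bigsum X n)" "C = iso_rel sc `` {M}"
      unfolding D_def by (auto elim!: quotientE)
    obtain l where l: "l < n" "iso M (X l)" using krull_schmidt_summand[OF M(1) X M(2)] by blast
    note m = indec_mod(1)[OF M(1)] Xm[OF l(1)]
    have "iso_rel sc `` {M} = iso_rel sc `` {X l}"
      using iso_trans[OF l(2) _ m] iso_trans[OF iso_sym[OF l(2)] _ m(2,1)] m unfolding iso_rel_def by blast
    then show "C \<in> (\<lambda>l. iso_rel sc `` {X l}) ` {..<n}" using M(3) l(1) by blast
  qed
  have finD: "finite D" using sub finite_subset by blast
  have "card D \<le> card ((\<lambda>l. iso_rel sc `` {X l}) ` {..<n})" by (rule card_mono[OF _ sub]) simp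
  also have "\<dots> \<le> n" using card_image_le[of "{..<n}"] by simp
  finally show "card simple_classes \<le> n" using card by simp
  \<comment> \<open>Since \<open>card\<close> of an infinite set is 0, equal cardinality alone does
    not give finiteness. The class of \<open>X 0\<close> makes card D positive, and so the simple
    classes form a finite set.\<close>
  note b = bigsum_mor[of n X, OF Xm n]
  obtain Z where "is_mod sc Z" "iso (bigsum X n) (dsum (X 0) Z)"
    by (rule retract_complement[OF b]; (assumption | (rule that; assumption)))
  then have "direct_summand sc (X 0) (bigsum X n)" unfolding direct_summand_def by blast
  then have "iso_rel sc `` {X 0} \<in> D" unfolding D_def using X[OF n] by (intro quotientI) simp
  then have "card D > 0" using finD card_gt_0_iff by blast
  then show "finite simple_classes" using card card_ge_0_finite by simp
qed

text \<open>The tilting module as a whole has a presentation along which maps into it extend. This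
  survives cutting down to a summand both in the presented module and in the target.\<close>

lemma tilting_summand_pres:
  assumes X: "\<And>i. i < n \<Longrightarrow> is_mod sc (X i)" and T: "tilting sc (bigsum X n)" and i: "i < n"
  shows "\<exists>Q P \<iota> g. pres Q P (X i) \<iota> g \<and> (\<forall>k<n. extends Q P \<iota> (X k))"
proof -
  have t: "is_mod sc (bigsum X n)" "pd_le_1 sc (bigsum X n)" "ext1_zero sc (bigsum X n) (bigsum X n)"
    using T unfolding tilting_def by auto
  obtain Q P j g where pr: "pres Q P (bigsum X n) j g" using pd_le_1_pres[OF t(2,1)] by blast
  have "extends Q P j (bigsum X n)" by (rule ext1_zero_extends[OF pr t(3,1)])
  then have ext: "extends Q P j (X k)" if "k < n" for k
    using extends_summand[OF _ bigsum_mor[of n X, OF X that] presD(3)[OF pr]] by blast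
  obtain Q' j' where "pres Q' P (X i) j' (bigsum_proj X n i * g)" "\<And>N. extends Q P j N \<Longrightarrow> extends Q' P j' N"
    using summand_pres[OF pr bigsum_mor[of n X, OF X i]] by blast
  then show ?thesis using ext by blast
qed

text \<open>The X i with i in J and the Y k with k in L together satisfy
  \<open>rigid_family_bound\<close>: Ext vanishes within each part by tilting and between the parts
  by \<open>orth\<close>.\<close>

lemma tilting_hall_condition:
  assumes X: "\<And>i. i < n \<Longrightarrow> indecomposable sc (X i)" and Y: "\<And>i. i < n \<Longrightarrow> indecomposable sc (Y i)"
    and Xn: "\<And>i k. i < n \<Longrightarrow> k < n \<Longrightarrow> i \<noteq> k \<Longrightarrow> \<not> iso (X i) (X k)"
    and Yn: "\<And>i k. i < n \<Longrightarrow> k < n \<Longrightarrow> i \<noteq> k \<Longrightarrow> \<not> iso (Y i) (Y k)"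
    and TX: "tilting sc (bigsum X n)" and TY: "tilting sc (bigsum Y n)"
    and J: "J \<subseteq> {..<n}" and L: "L \<subseteq> {..<n}"
    and orth: "\<And>i k. i \<in> J \<Longrightarrow> k \<in> L \<Longrightarrow> \<not> iso (X i) (Y k) \<and> ext1_zero sc (X i) (Y k) \<and> ext1_zero sc (Y k) (X i)"
  shows "card J + card L \<le> n"
proof (cases "n = 0")
  case True
  then show ?thesis using J L by simp
next
  \<comment> \<open>A positive n provides the summand from which finiteness of the simple classes
    was derived.\<close>
  case False
  then have n: "0 < n" by simp
  note Xm = indec_mod(1)[OF X] and Ym = indec_mod(1)[OF Y]
  have fin: "finite J" "finite L" using J L finite_subset by auto
  obtain e where e: "bij_betw e {..<card J} J"
    using ex_bij_betw_nat_finite[OF fin(1)] unfolding atLeast0LessThan by blast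
  obtain e' where e': "bij_betw e' {..<card L} L"
    using ex_bij_betw_nat_finite[OF fin(2)] unfolding atLeast0LessThan by blast
  define Z where "Z l = (if l < card J then X (e l) else Y (e' (l - card J)))" for l
  let ?m = "card J + card L"
  have eJ: "e l \<in> J" if "l < card J" for l using bij_betwE[OF e] that by simp
  have eL: "e' (l - card J) \<in> L" if "l < ?m" "\<not> l < card J" for l using bij_betwE[OF e'] that by simp
  have Jn: "i < n" if "i \<in> J" for i using J that by auto
  have Ln: "i < n" if "i \<in> L" for i using L that by auto
  have "?m \<le> card simple_classes"
  proof (rule rigid_family_bound[OF simple_classes_of_tilting(1)[OF X TX n]])
    show "indecomposable sc (Z l)" if l: "l < ?m" for l
      using X[OF Jn[OF eJ]] Y[OF Ln[OF eL[OF l]]] unfolding Z_def by simp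
    show "\<not> iso (Z l) (Z l')" if l: "l < ?m" "l' < ?m" "l \<noteq> l'" for l l'
    proof (cases "l < card J"; cases "l' < card J")
      assume c: "l < card J" "l' < card J"
      have "e l \<noteq> e l'" using bij_betw_imp_inj_on[OF e] c l(3) by (auto dest: inj_onD)
      then show ?thesis using Xn[OF Jn[OF eJ[OF c(1)]] Jn[OF eJ[OF c(2)]]] c by (simp add: Z_def)
    next
      assume c: "\<not> l < card J" "\<not> l' < card J"
      have "e' (l - card J) \<noteq> e' (l' - card J)"
      proof
        assume "e' (l - card J) = e' (l' - card J)"
        then have "l - card J = l' - card J"
          using inj_onD[OF bij_betw_imp_inj_on[OF e'], of "l - card J" "l' - card J"] c l by simp
        then show False using c l by linarith
      qed
      then show ?thesis using Yn[OF Ln[OF eL[OF l(1) c(1)]] Ln[OF eL[OF l(2) c(2)]]] c by (simp add: Z_def)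
    next
      assume c: "l < card J" "\<not> l' < card J"
      then show ?thesis using orth[OF eJ[OF c(1)] eL[OF l(2) c(2)]] by (simp add: Z_def)
    next
      assume c: "\<not> l < card J" "l' < card J"
      then show ?thesis using orth[OF eJ[OF c(2)] eL[OF l(1) c(1)]] iso_sym[of "Z l" "Z l'"] by (auto simp: Z_def)
    qed
    show "\<exists>Q P \<iota> g. pres Q P (Z l) \<iota> g \<and> (\<forall>l'<?m. extends Q P \<iota> (Z l'))" if l: "l < ?m" for l
    proof (cases "l < card J")
      case True
      obtain Q P \<iota> g where pr: "pres Q P (X (e l)) \<iota> g" "\<And>k. k < n \<Longrightarrow> extends Q P \<iota> (X k)"
        using tilting_summand_pres[OF Xm TX Jn[OF eJ[OF True]]] by blast
      have "extends Q P \<iota> (Y k)" if "k \<in> L" for k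
        by (rule ext1_zero_extends[OF pr(1) _ Ym[OF Ln[OF that]]]) (use orth[OF eJ[OF True] that] in blast)
      then have "\<forall>l'<?m. extends Q P \<iota> (Z l')" using pr(2)[OF Jn[OF eJ]] eL unfolding Z_def by auto
      moreover have "pres Q P (Z l) \<iota> g" using pr(1) True by (simp add: Z_def)
      ultimately show ?thesis by blast
    next
      case False
      obtain Q P \<iota> g where pr: "pres Q P (Y (e' (l - card J))) \<iota> g" "\<And>k. k < n \<Longrightarrow> extends Q P \<iota> (Y k)"
        using tilting_summand_pres[OF Ym TY Ln[OF eL[OF l False]]] by blast
      have "extends Q P \<iota> (X k)" if "k \<in> J" for k
        by (rule ext1_zero_extends[OF pr(1) _ Xm[OF Jn[OF that]]]) (use orth[OF that eL[OF l False]] in blast)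
      then have "\<forall>l'<?m. extends Q P \<iota> (Z l')" using pr(2)[OF Ln[OF eL]] eJ unfolding Z_def by auto
      moreover have "pres Q P (Z l) \<iota> g" using pr(1) False by (simp add: Z_def)
      ultimately show ?thesis by blast
    qed
  qed
  then show ?thesis using simple_classes_of_tilting(2)[OF X TX n] by simp
qed

end

theorem theorem4:
  fixes sc :: "'k::field \<Rightarrow> 'a::ring_1 \<Rightarrow> 'a"
    and n :: nat
    and X Y :: "nat \<Rightarrow> ('a, 'k) amod"
  assumes "fd_algebra sc"
    and "\<forall>i<n. indecomposable sc (X i)"
    and "\<forall>i<n. indecomposable sc (Y i)"
    and "\<forall>i<n. \<forall>j<n. i \<noteq> j \<longrightarrow> \<not> iso (X i) (X j)"
    and "\<forall>i<n. \<forall>j<n. i \<noteq> j \<longrightarrow> \<not> iso (Y i) (Y j)"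
    and "tilting sc (bigsum X n)"
    and "tilting sc (bigsum Y n)"
  shows "\<exists>s. bij_betw s {..<n} {..<n} \<and>
           (\<forall>i<n. iso (X i) (Y (s i)) \<or>
                  (\<exists>U W. {U, W} = {X i, Y (s i)} \<and> nonsplit_ses_exists sc U W))"
proof -
  interpret matrix_modules sc .
  define N where "N i = {k. k < n \<and> (iso (X i) (Y k) \<or> \<not> ext1_zero sc (X i) (Y k) \<or> \<not> ext1_zero sc (Y k) (X i))}" for i
  have "card J \<le> card (\<Union>i\<in>J. N i)" if J: "J \<subseteq> {..<n}" for J
  proof -
    let ?B = "\<Union>i\<in>J. N i"
    have B: "?B \<subseteq> {..<n}" by (auto simp: N_def)
    \<comment> \<open>An index k outside ?B is adjacent to no i in J, which is precisely
      non-isomorphism together with vanishing of Ext in both directions.\<close>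
    have "card J + card ({..<n} - ?B) \<le> n"
      by (rule tilting_hall_condition[of n X Y]) (use assms J in \<open>auto simp: N_def\<close>)
    moreover have "card ({..<n} - ?B) = n - card ?B" using card_Diff_subset[OF finite_subset[OF B] B] by simp
    moreover have "card ?B \<le> n" using card_mono[OF _ B] by simp
    ultimately show ?thesis by simp
  qed
  then obtain s where s: "inj_on s {..<n}" "\<And>i. i < n \<Longrightarrow> s i \<in> N i"
    using hall[of "{..<n}" N] by (auto simp: N_def)
  have "s ` {..<n} = {..<n}" by (rule endo_inj_surj[OF _ _ s(1)]) (use s(2) in \<open>auto simp: N_def\<close>)
  then have bij: "bij_betw s {..<n} {..<n}" using s(1) by (simp add: bij_betw_def)
  \<comment> \<open>The roles are exchanged: an extension witnessing that Ext^1(A, B) is nonzero has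
    B as its submodule and A as its quotient.\<close>
  have nonsplit: "nonsplit_ses_exists sc B A" if "\<not> ext1_zero sc A B" for A B :: "('a, 'k) amod"
    using that unfolding ext1_zero_def nonsplit_ses_exists_def by blast
  have "iso (X i) (Y (s i)) \<or> (\<exists>U W. {U, W} = {X i, Y (s i)} \<and> nonsplit_ses_exists sc U W)" if "i < n" for i
    using s(2)[OF that] nonsplit unfolding N_def by blast
  then show ?thesis using bij by blast
qed

end
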